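(* Let $\lambda=(p,0,r;a,1/2;x)\in\mathcal{I}$ be a non-elementary solution to Problem I. (1) If $x\in\mathbb{Q}$, then $\lambda=k\lambda_1$ or $\lambda=k\lambda_2$ for some $k\in\mathbb{N}$, where $\lambda_1=(1,0,3;0,1/2;3/4)$ and $\lambda_2=(1,0,3;1/3,1/2;3/4)$. (2) If $x$ is a quadratic irrational, then $\lambda=k\lambda_3$ for some $k\in\mathbb{N}$, where $\lambda_3=(2,0,4;0,1/2;2\sqrt2-2)$.
   Context: For $\lambda=(p,q,r;a,b;x)\in\mathbb{R}^6$ with $0<x<1$ put $f(w;\lambda):={}_2F_1(pw+a,\,qw+b;\,rw;\,x)$ (Gauss hypergeometric function, meromorphic in $w\in\mathbb{C}$). $\lambda$ is a solution to Problem I if there are $C,d\in\mathbb{C}^\times$, $u_i,v_j\in\mathbb{C}$ with $f(w;\lambda)=C\,d^w\prod_{i=1}^m\Gamma(w+u_i)/\prod_{j=1}^n\Gamma(w+v_j)$ identically in $w$. $\lambda$ is elementary if $f(w;\lambda)$ has finitely many poles in $w$. $\mathcal{I}:=\{(p,0,r;a,b;x)\in\mathbb{R}^6:0<p<r,\ 0<x<1\}$. For $k\in\mathbb{N}$, the $k$-multiple of $\lambda=(p,q,r;a,b;x)$ is $k\lambda:=(kp,kq,kr;a,b;x)$. (The data $\lambda_1,\lambda_2,\lambda_3$ are known to be non-elementary solutions, hence the primitive solutions with rational, resp. quadratic irrational, argument.) *)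

theory Defs
  imports "HOL-Complex_Analysis.Complex_Analysis"
begin

text \<open>Gauss hypergeometric series 2F1(a,b;c;z) (for |z|<1 and c not a nonpositive integer).\<close>
definition hyp2F1 :: "complex \<Rightarrow> complex \<Rightarrow> complex \<Rightarrow> complex \<Rightarrow> complex" where
  "hyp2F1 a b c z =
     (\<Sum>n. pochhammer a n * pochhammer b n / (pochhammer c n * fact n) * z ^ n)"

text \<open>f(w; lambda) = 2F1(p w + a, q w + b; r w; x), as a function of complex w.
  Its values at the points with r w a nonpositive integer are irrelevant
  (they are excluded wherever f is compared, and is_pole ignores them).\<close>
definition fHyp :: "real \<Rightarrow> real \<Rightarrow> real \<Rightarrow> real \<Rightarrow> real \<Rightarrow> real \<Rightarrow> complex \<Rightarrow> complex" where
  "fHyp p q r a b x w =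
     hyp2F1 (of_real p * w + of_real a) (of_real q * w + of_real b) (of_real r * w) (of_real x)"

text \<open>Problem I: f(w) = C d^w prod Gamma(w+u_i) / prod Gamma(w+v_j) identically in w,
  where d^w = exp(delta w) for some logarithm delta of d.  The identity of meromorphic
  functions is expressed as equality at every w where both sides are given by their
  defining formulas (complement of a discrete set).\<close>
definition solution_I :: "real \<Rightarrow> real \<Rightarrow> real \<Rightarrow> real \<Rightarrow> real \<Rightarrow> real \<Rightarrow> bool" where
  "solution_I p q r a b x \<longleftrightarrow>
     (\<exists>(C::complex) (\<delta>::complex) (m::nat) (n::nat) (u::nat \<Rightarrow> complex) (v::nat \<Rightarrow> complex).
        C \<noteq> 0 \<and>
        (\<forall>w. of_real r * w \<notin> \<int>\<^sub>\<le>\<^sub>0 \<and> (\<forall>i<m. w + u i \<notin> \<int>\<^sub>\<le>\<^sub>0) \<longrightarrow>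
             fHyp p q r a b x w =
               C * exp (\<delta> * w) * (\<Prod>i<m. Gamma (w + u i)) / (\<Prod>j<n. Gamma (w + v j))))"

definition elementary :: "real \<Rightarrow> real \<Rightarrow> real \<Rightarrow> real \<Rightarrow> real \<Rightarrow> real \<Rightarrow> bool" where
  "elementary p q r a b x \<longleftrightarrow> finite {w. is_pole (fHyp p q r a b x) w}"

definition quadratic_irrational :: "real \<Rightarrow> bool" where
  "quadratic_irrational x \<longleftrightarrow> x \<notin> \<rat> \<and>
     (\<exists>A B C :: int. A \<noteq> 0 \<and> of_int A * x ^ 2 + of_int B * x + of_int C = 0)"

end

theory Submission
  imports Defs "HOL-Real_Asymp.Real_Asymp"
begin

text \<open>
  As \<open>w\<close> tends to \<open>+\<infinity>\<close>, \<open>f(w) = c (1 + O(1/w))\<close> with \<open>c \<noteq> 0\<close>, so a gamma product formula makes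
  \<open>R(w) = f(w + 1) / f(w)\<close> a rational function with \<open>R(w) = 1 + O(1/w\<^sup>2)\<close>. If \<open>f\<close> has infinitely many
  poles then, because \<open>R\<close> has no zeros or poles far to the left, the poles contain a progression
  \<open>-t - k\<close>; as every pole lies in \<open>-\<nat>/r\<close>, the number \<open>r\<close> is an integer. The residue at
  \<open>-W\<close>, \<open>W = t + k\<close>, is by Euler's transformation an explicit product of gamma factors times
  \<open>H(W) = \<^sub>2F\<^sub>1(p W + 1 - a, 1/2; r W + 2; x)\<close>, and the product of the residue with \<open>f(W)\<close> changes by
  the factor \<open>R(W) / R(-W - 1) = 1 + o(1/W\<^sup>2)\<close> from one \<open>k\<close> to the next. Comparing with
  the asymptotics of the gamma factors to increasing order gives \<open>p \<in> \<int>\<close>, then \<open>r - p\<close> even and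
  \<open>x\<^sup>r p\<^sup>p (r - p)\<^sup>r\<^sup>-\<^sup>p = r\<^sup>r (1 - x)\<^sup>r\<^sup>-\<^sup>p\<close>, and finally a quadratic relation between \<open>a\<close> and \<open>x\<close>.

  Write \<open>p = g P\<close> and \<open>r - p = g S\<close> with \<open>P\<close>, \<open>S\<close> coprime. Then \<open>u = (P + S)/x\<close> is an algebraic integer
  with \<open>u\<^sup>P (u - P - S)\<^sup>S = P\<^sup>P S\<^sup>S\<close>. For rational \<open>x\<close> this forces \<open>P = 1\<close>, \<open>S = 2\<close>, \<open>u = 4\<close>;
  for quadratic \<open>x\<close>, comparing norms forces \<open>P = S = 1\<close>, \<open>u = 1 + \<surd>2\<close>. The quadratic relation then
  determines \<open>a\<close>.
\<close>

subsection \<open>The equation \<open>u\<^sup>P (u - P - S)\<^sup>S = P\<^sup>P S\<^sup>S\<close>\<close>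

text \<open>The parameters of the gamma product are unknown, so the comparison can only use
  quantities in which they cancel. R(W) and R(-W-1) agree up to o(1/W^2): replacing each parameter z
  by 1 - z does not alter the difference of the sums of squares once the plain sums agree. Hence the
  residue at -W is paired with f(W), and the comparison stops at order 1/W^2. The value b = 1/2 is
  used twice. Euler's transformation replaces b by 1 - b, so both factors of the product contain a
  hypergeometric function of the same kind with the same limit, and the explicit gamma factors have
  no 1/W term. Asymptotic relations cannot be differenced freely; the passage between a sequence and
  its steps rests on the divergence of the harmonic series. On the arithmetic side, exponential
  divisibility meets polynomial size. In the quadratic case the norms alone leave u = S + sqrt(P^2 +
  S^2) for every coprime odd pair; a monotonicity property of arsinh then excludes P different from
  S.\<close>

lemma Rats_power_int: "(x::real) \<in> \<rat> \<Longrightarrow> x powi n \<in> \<rat>"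
  by (cases n) (auto simp: power_int_def)

text \<open>With Bezout coefficients \<open>i * P + j * S = 1\<close>, the rational number
  \<open>X powi j * Y powi i\<close> has S-th power X and P-th power Y. Writing it in lowest terms
  \<open>\<alpha> / \<beta>\<close> turns an equation between rational powers into divisibility
  between natural numbers.\<close>

lemma rational_common_base:
  fixes X Y :: real
  assumes "coprime P S" "X > 0" "Y > 0" "X \<in> \<rat>" "Y \<in> \<rat>" "X ^ P = Y ^ S"
  obtains \<alpha> \<beta> :: nat where "\<alpha> > 0" "\<beta> > 0" "coprime \<alpha> \<beta>"
    "X * real \<beta> ^ S = real \<alpha> ^ S" "Y * real \<beta> ^ P = real \<alpha> ^ P"
proof -
  from \<open>coprime P S\<close> have "coprime (int P) (int S)" by simp
  then obtain i j where ij: "i * int P + j * int S = 1"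
    using bezout_int[of "int P" "int S"] by (auto simp: coprime_iff_gcd_eq_1)
  define \<tau> where "\<tau> = X powi j * Y powi i"
  have \<tau>: "\<tau> \<in> \<rat>" "\<tau> > 0"
    using assms unfolding \<tau>_def by (auto intro!: Rats_mult Rats_power_int zero_less_power_int)
  have nz: "X \<noteq> 0" "Y \<noteq> 0" using assms by auto
  have pw: "X powi (int P) = Y powi (int S)" using assms by simp
  have "\<tau> ^ S = X powi (j * int S) * (Y powi (int S)) powi i"
    unfolding \<tau>_def by (simp add: power_mult_distrib power_int_mult_distrib flip: power_int_of_nat power_int_mult)
       (simp add: mult.commute)
  also have "\<dots> = X powi (j * int S + i * int P)"
    using nz unfolding pw[symmetric]
    by (simp add: power_int_add mult.commute[of i] power_int_mult)
  also have "\<dots> = X" using ij by (simp add: add.commute)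
  finally have X: "X = \<tau> ^ S" by simp
  have "\<tau> ^ P = (X powi (int P)) powi j * Y powi (i * int P)"
    unfolding \<tau>_def by (simp add: power_mult_distrib power_int_mult_distrib flip: power_int_of_nat power_int_mult)
       (simp add: mult.commute)
  also have "\<dots> = Y powi (j * int S + i * int P)"
    using nz unfolding pw
    by (simp add: power_int_add mult.commute[of j] power_int_mult)
  also have "\<dots> = Y" using ij by (simp add: add.commute)
  finally have Y: "Y = \<tau> ^ P" by simp
  obtain m n where mn: "n \<noteq> 0" "\<bar>\<tau>\<bar> = real m / real n" "coprime m n"
    using Rats_abs_nat_div_natE[OF \<tau>(1)] by metis
  then have "\<tau> = real m / real n" using \<tau> by simp
  then have "X * real n ^ S = real m ^ S" "Y * real n ^ P = real m ^ P" "m > 0"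
    using X Y mn \<tau> by (auto simp: power_divide intro!: gr0I)
  then show ?thesis using that mn by auto
qed

lemma double_less_two_power: "n \<ge> 3 \<Longrightarrow> 2 * n < 2 ^ n" for n :: nat
proof (induction n rule: dec_induct)
  case (step n)
  then show ?case by simp
qed simp

lemma square_less_two_power: "n \<ge> 5 \<Longrightarrow> n\<^sup>2 < 2 ^ n" for n :: nat
proof (induction n rule: dec_induct)
  case (step n)
  have "(Suc n)\<^sup>2 = n\<^sup>2 + 2 * n + 1" by (simp add: power2_eq_square)
  also have "n\<^sup>2 + 2 * n + 1 \<le> n\<^sup>2 + n\<^sup>2"
    using mult_right_mono[of 3 n n] step unfolding power2_eq_square by linarith
  finally have "(Suc n)\<^sup>2 \<le> n\<^sup>2 + n\<^sup>2" .
  then show ?case using step by simp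
qed simp


lemma map_poly_of_int_mult:
  "map_poly real_of_int (p * q) = map_poly of_int p * map_poly of_int q"
  by (rule poly_eqI) (simp add: coeff_map_poly coeff_mult)

lemma map_poly_of_int_power:
  "map_poly real_of_int (p ^ n) = map_poly of_int p ^ n"
  by (induction n) (simp_all add: map_poly_of_int_mult)

lemma map_poly_of_int_add:
  "map_poly real_of_int (p + q) = map_poly of_int p + map_poly of_int q"
  by (rule poly_eqI) (simp add: coeff_map_poly)

text \<open>This polynomial is the witness that solutions of the equation are algebraic integers.
  \<open>P > 0\<close> keeps the subtracted constant away from the leading coefficient.\<close>

lemma monic_int_poly:
  assumes "P > 0"
  obtains F :: "int poly" where "lead_coeff F = 1"
    "\<And>z. poly (map_poly real_of_int F) z = z ^ P * (z - real k) ^ S - real c"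
proof -
  define G :: "int poly" where "G = [:0,1:] ^ P * [:- int k, 1:] ^ S"
  define F where "F = G + [:- int c:]"
  have deg: "degree G = P + S" unfolding G_def
    by (subst degree_mult_eq) (auto simp: degree_power_eq)
  have lc: "lead_coeff G = 1" unfolding G_def by (simp add: lead_coeff_mult lead_coeff_power)
  have dF: "degree F = degree G" unfolding F_def using deg assms
    by (intro degree_add_eq_left) simp
  have "lead_coeff F = 1" unfolding dF using lc deg assms
    by (simp add: F_def coeff_pCons split: nat.split)
  moreover have "poly (map_poly real_of_int F) z = z ^ P * (z - real k) ^ S - real c" for z
    by (simp add: F_def G_def map_poly_of_int_add map_poly_of_int_mult map_poly_of_int_power map_poly_pCons)
  ultimately show ?thesis using that by blast
qed

text \<open>A rational algebraic integer is an integer n, which gives (n / P)^P = (S / v)^S with v =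
  n - P - S. In terms of the common base \<open>\<alpha> / \<beta>\<close>, which exceeds 1, this
  yields \<open>\<alpha> ^ P dvd S\<close> and \<open>\<beta> ^ S dvd P\<close>; size considerations
  leave only \<open>\<alpha> = 2\<close>, \<open>\<beta> = 1\<close>.\<close>

lemma rational_root_unique:
  fixes u :: real
  assumes PS: "coprime P S" "P > 0" "S > 0" and u: "u > real (P + S)" "u \<in> \<rat>"
    and eq: "u ^ P * (u - real (P + S)) ^ S = real P ^ P * real S ^ S"
  shows "P = 1 \<and> S = 2 \<and> u = 4"
proof -
  obtain F where F: "lead_coeff F = 1"
    "\<And>z. poly (map_poly real_of_int F) z = z ^ P * (z - real (P + S)) ^ S - real (P ^ P * S ^ S)"
    using monic_int_poly[OF PS(2), of "P + S" S "P ^ P * S ^ S"] by blast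
  have "algebraic_int u"
    unfolding algebraic_int_altdef_ipoly using F eq by (intro exI[of _ F]) auto
  then have "u \<in> \<int>" using u by (simp add: rational_algebraic_int_is_int)
  then obtain m where m: "u = of_int m" by (auto elim: Ints_cases)
  define n where "n = nat m"
  have n: "u = real n" using m u by (simp add: n_def)
  define v where "v = n - (P + S)"
  have v: "v > 0" "n = v + P + S" using u unfolding v_def n by auto
  have vu: "u - real (P + S) = real v" using v n by simp
  have e: "(u / P) ^ P = (real S / v) ^ S"
    using eq v PS unfolding vu by (simp add: field_simps)
  have "u / P > 0" "real S / v > 0" "u / P \<in> \<rat>" "real S / v \<in> \<rat>"
    using v PS n by auto
  then obtain \<alpha> \<beta> where ab: "\<alpha> > 0" "\<beta> > 0" "coprime \<alpha> \<beta>"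
    "(u / P) * real \<beta> ^ S = real \<alpha> ^ S" "(S / v) * real \<beta> ^ P = real \<alpha> ^ P"
    using rational_common_base[OF PS(1) _ _ _ _ e] by metis
  have "real (n * \<beta> ^ S) = real (P * \<alpha> ^ S)" "real (S * \<beta> ^ P) = real (v * \<alpha> ^ P)"
    using ab PS v n by (auto simp: field_simps)
  then have eqs: "n * \<beta> ^ S = P * \<alpha> ^ S" "S * \<beta> ^ P = v * \<alpha> ^ P"
    using of_nat_eq_iff by blast+
  have "P * \<beta> ^ S < P * \<alpha> ^ S"
    unfolding eqs[symmetric] using v ab by (simp add: PS)
  then have "\<beta> < \<alpha>" using power_less_imp_less_base by auto
  then have a2: "\<alpha> \<ge> 2" using ab by simp
  have "\<alpha> ^ P dvd S * \<beta> ^ P" by (simp add: eqs)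
  then have aS: "\<alpha> ^ P dvd S" using ab by (simp add: coprime_dvd_mult_left_iff)
  have bP: "\<beta> ^ S dvd P" using ab eqs
    by (metis coprime_commute coprime_dvd_mult_left_iff coprime_power_left_iff coprime_power_right_iff dvd_triv_right)
  have "2 ^ P \<le> \<alpha> ^ P" using a2 by (rule power_mono) simp
  also have "\<alpha> ^ P \<le> S" using aS PS by (simp add: dvd_imp_le)
  finally have PltS: "P < S" using less_exp[of P] by linarith
  have b1: "\<beta> = 1"
  proof (rule ccontr)
    assume "\<beta> \<noteq> 1"
    then have "2 ^ S \<le> \<beta> ^ S" using ab by (intro power_mono) auto
    also have "\<dots> \<le> P" using bP PS by (simp add: dvd_imp_le)
    finally show False using less_exp[of S] PltS by linarith
  qed
  have nS: "n = P * \<alpha> ^ S" "S = v * \<alpha> ^ P" using eqs b1 by auto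
  have "v * 2 \<le> v * \<alpha> ^ P"
    using self_le_power[of \<alpha> P] a2 PS by (intro mult_left_mono) auto
  then have v2: "2 * v \<le> S" using nS by simp
  \<comment> \<open>Here \<open>P * \<alpha> ^ S\<close> is n = v + P + S with 2 v at most S, so an
    exponential in S gets a linear bound, which fails from S = 3 on.\<close>
  have "P * 2 ^ S \<le> P * \<alpha> ^ S" using a2 by (intro mult_left_mono power_mono) auto
  then have le: "2 * P * 2 ^ S \<le> 2 * P + 3 * S" using v2 v nS by linarith
  have "S < 3"
  proof (rule ccontr)
    assume "\<not> S < 3"
    then have "2 * S + 1 \<le> 2 ^ S" using double_less_two_power[of S] by simp
    then have "2 * P * (2 * S + 1) \<le> 2 * P * 2 ^ S" by (rule mult_left_mono) simp
    then have "2 * P * (2 * S + 1) \<le> 2 * P + 3 * S" using le by linarith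
    then have "4 * (P * S) \<le> 3 * S" by (simp add: algebra_simps)
    moreover have "S \<le> P * S" using PS by simp
    ultimately show False using PS by linarith
  qed
  then have "S = 2" "P = 1" using PltS PS by auto
  moreover have "\<alpha> = 2" using aS a2 dvd_imp_le[of \<alpha> 2] calculation by auto
  ultimately show ?thesis using nS n by simp
qed

section \<open>Quadratic irrational roots\<close>

lemma arsinh_le_self: "y \<ge> 0 \<Longrightarrow> arsinh y \<le> (y::real)"
proof -
  assume y: "y \<ge> 0"
  have "sqrt (y\<^sup>2 + 1) \<le> sqrt ((1 + y\<^sup>2 / 2)\<^sup>2)"
    by (intro real_sqrt_le_mono) (simp add: power2_sum)
  also have "\<dots> = 1 + y\<^sup>2 / 2" by (simp add: add_nonneg_nonneg)
  finally have "y + sqrt (y\<^sup>2 + 1) \<le> exp y"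
    using exp_lower_Taylor_quadratic[OF y] by simp
  moreover have "y + sqrt (y\<^sup>2 + 1) > 0" using y by (simp add: add_nonneg_pos add_pos_pos)
  ultimately have "ln (y + sqrt (y\<^sup>2 + 1)) \<le> ln (exp y)" by (subst ln_le_cancel_iff) auto
  then show ?thesis by (simp add: arsinh_real_def)
qed

text \<open>The difference of the two sides vanishes at 1 and has derivative 2 / sqrt(s^2 + 1) -
  arsinh(1 / s), which is positive because arsinh(1 / s) is at most 1 / s. Applied to S / P and to P
  / S, it separates unequal exponents in \<open>quadratic_root_unique\<close>.\<close>

lemma arsinh_asym:
  fixes s :: real
  assumes "s > 1"
  shows "s * arsinh (1 / s) < arsinh s"
proof -
  let ?D = "\<lambda>s::real. arsinh s - s * arsinh (1 / s)"
  have "?D 1 < ?D s"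
  proof (rule DERIV_pos_imp_increasing_open[OF assms])
    fix z :: real assume z: "1 < z" "z < s"
    have sq: "sqrt ((1/z)\<^sup>2 + 1) = sqrt (z\<^sup>2 + 1) / z"
      using z by (simp add: real_sqrt_divide field_simps flip: real_sqrt_divide)
         (simp add: real_sqrt_divide power_divide field_simps)
    have "(?D has_real_derivative (1 / sqrt (z\<^sup>2 + 1) - (arsinh (1 / z) + z * (- 1 / z\<^sup>2 / sqrt ((1/z)\<^sup>2 + 1))))) (at z)"
    proof -
      have "((\<lambda>z. 1 / z) has_real_derivative - 1 / z\<^sup>2) (at z)"
        using z by (auto intro!: derivative_eq_intros simp: power2_eq_square)
      from DERIV_chain2[OF arsinh_real_has_field_derivative this]
      have "((\<lambda>z. arsinh (1 / z)) has_real_derivative 1 / sqrt ((1/z)\<^sup>2 + 1) * (- 1 / z\<^sup>2)) (at z)"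
        by simp
      from DERIV_diff[OF arsinh_real_has_field_derivative[of z UNIV] DERIV_mult[OF DERIV_ident this]]
      show ?thesis by (simp add: algebra_simps)
    qed
    then have 1: "(?D has_real_derivative (2 / sqrt (z\<^sup>2 + 1) - arsinh (1 / z))) (at z)"
      unfolding sq using z by (simp add: power2_eq_square)
    have "z\<^sup>2 > 1" using z by (simp add: one_less_power)
    then have "z\<^sup>2 + 1 < (2 * z)\<^sup>2" by (simp add: power_mult_distrib)
    then have "sqrt (z\<^sup>2 + 1) < 2 * z" using z by (intro real_less_lsqrt) auto
    then have "1 / z < 2 / sqrt (z\<^sup>2 + 1)" using z by (simp add: field_simps add_pos_pos)
    moreover have "arsinh (1 / z) \<le> 1 / z" using z by (intro arsinh_le_self) auto
    ultimately show "\<exists>y. (?D has_real_derivative y) (at z) \<and> 0 < y"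
      using 1 by (intro exI[of _ "2 / sqrt (z\<^sup>2 + 1) - arsinh (1 / z)"]) auto
  next
    show "continuous_on {1..s} ?D" by (intro continuous_intros) auto
  qed
  then show ?thesis by simp
qed

text \<open>A and B stand for the absolute norms of u and u - (P + S). If A exceeded P^2, the common
  base \<open>\<alpha> / \<beta>\<close> of A / P^2 and S^2 / B would exceed 1, with
  \<open>\<alpha> ^ P\<close> dividing S^2 and \<open>\<beta> ^ S\<close> dividing P^2. The
  hypotheses are symmetric enough that exchanging P and S bounds B as well.\<close>

lemma norm_bound_half:
  fixes A B :: nat
  assumes PS: "coprime P S" "odd P" "odd S" and AB: "A > 0" "B > 0"
    and eq: "A ^ P * B ^ S = P ^ (2 * P) * S ^ (2 * S)"
    and A: "A < P * (2 * S + P)"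
  shows "A \<le> P\<^sup>2"
proof (rule ccontr)
  assume "\<not> A \<le> P\<^sup>2"
  have pos: "P > 0" "S > 0" using PS by (auto intro: odd_pos)
  have "real A ^ P * real B ^ S = real P ^ (2 * P) * real S ^ (2 * S)"
    using eq by (metis of_nat_mult of_nat_power)
  then have e: "(real A / real (P\<^sup>2)) ^ P = (real (S\<^sup>2) / real B) ^ S"
    using AB pos by (simp add: field_simps power_divide flip: power_mult)
  have "real A / real (P\<^sup>2) > 0" "real (S\<^sup>2) / real B > 0"
    "real A / real (P\<^sup>2) \<in> \<rat>" "real (S\<^sup>2) / real B \<in> \<rat>"
    using AB pos by auto
  then obtain \<alpha> \<beta> where ab: "\<alpha> > 0" "\<beta> > 0" "coprime \<alpha> \<beta>"
    "real A / real (P\<^sup>2) * real \<beta> ^ S = real \<alpha> ^ S" "real (S\<^sup>2) / real B * real \<beta> ^ P = real \<alpha> ^ P"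
    using rational_common_base[OF PS(1) _ _ _ _ e] by metis
  have "real (A * \<beta> ^ S) = real (P\<^sup>2 * \<alpha> ^ S)" "real (S\<^sup>2 * \<beta> ^ P) = real (B * \<alpha> ^ P)"
    using ab AB pos by (auto simp: field_simps)
  then have eqs: "A * \<beta> ^ S = P\<^sup>2 * \<alpha> ^ S" "S\<^sup>2 * \<beta> ^ P = B * \<alpha> ^ P"
    using of_nat_eq_iff by blast+
  have "P\<^sup>2 * \<beta> ^ S < P\<^sup>2 * \<alpha> ^ S"
    unfolding eqs[symmetric] using \<open>\<not> A \<le> P\<^sup>2\<close> ab by simp
  then have "\<beta> < \<alpha>" using power_less_imp_less_base by auto
  then have a2: "\<alpha> \<ge> 2" using ab by simp
  have "\<alpha> ^ P dvd S\<^sup>2 * \<beta> ^ P" by (simp add: eqs)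
  then have "\<alpha> ^ P dvd S\<^sup>2" using ab by (simp add: coprime_dvd_mult_left_iff)
  then have "\<alpha> ^ P \<le> S\<^sup>2" using pos by (simp add: dvd_imp_le)
  then have PS1: "2 ^ P \<le> S\<^sup>2" using power_mono[OF a2, of P] by linarith
  show False
  proof (cases "\<beta> = 1")
    case True
    then have "A = P\<^sup>2 * \<alpha> ^ S" using eqs by simp
    moreover have "P\<^sup>2 * 2 ^ S \<le> P\<^sup>2 * \<alpha> ^ S" using a2 by (intro mult_left_mono power_mono) auto
    ultimately have "P\<^sup>2 * 2 ^ S < P * (2 * S + P)" using A by linarith
    then have "P * (P * 2 ^ S) < P * (2 * S + P)" by (simp add: power2_eq_square mult.assoc)
    then have le: "P * 2 ^ S < 2 * S + P" by simp
    show False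
    proof (cases "S \<ge> 3")
      case True
      then have "2 * S + 1 \<le> 2 ^ S" using double_less_two_power[of S] by simp
      then have "P * (2 * S + 1) \<le> P * 2 ^ S" by (rule mult_left_mono) simp
      moreover have "P * (2 * S + 1) = P * (2 * S) + P" by (simp add: algebra_simps)
      ultimately have "P * (2 * S) < 2 * S" using le by linarith
      moreover have "1 * (2 * S) \<le> P * (2 * S)" using pos by (intro mult_right_mono) auto
      ultimately show False by simp
    next
      case False
      then have "S = 1" using PS by (metis One_nat_def Suc_1 even_numeral linorder_not_le numeral_3_eq_3 less_Suc_eq less_one odd_pos not_less_eq zero_less_iff_neq_zero)
      then have "P = 1" using le pos by simp
      then show False using \<open>S = 1\<close> PS1 by simp
    qed
  next
    case False
    have "\<beta> ^ S dvd P\<^sup>2 * \<alpha> ^ S" by (simp flip: eqs)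
    then have "\<beta> ^ S dvd P\<^sup>2" using ab by (simp add: coprime_dvd_mult_left_iff coprime_commute)
    then have "\<beta> ^ S \<le> P\<^sup>2" using pos by (simp add: dvd_imp_le)
    then have PS2: "2 ^ S \<le> P\<^sup>2" using power_mono[of 2 \<beta> S] False ab by linarith
    \<comment> \<open>The larger of the two odd exponents has its power of two bounded by the square
      of the smaller one. This fails from 5 on, and the only odd pair below is 3, 1.\<close>
    have lem: False if "odd s" "odd t" "2 ^ s \<le> t\<^sup>2" "t < s" for s t :: nat
    proof -
      have "t\<^sup>2 < s\<^sup>2" using that by (simp add: power_strict_mono)
      then have "s < 5" using square_less_two_power[of s] that by linarith
      moreover have "s \<noteq> 2" "s \<noteq> 4" "t \<noteq> 0" "t \<noteq> 2" using that(1,2) by (auto elim: oddE)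
      ultimately have "s = 3" "t = 1" using that by linarith+
      then show False using that by simp
    qed
    have "P \<noteq> S"
    proof
      assume "P = S"
      then have "P = 1" "S = 1" using PS by auto
      then show False using PS1 by simp
    qed
    then show False using lem[of S P] lem[of P S] PS PS1 PS2 by linarith
  qed
qed

text \<open>Gauss's lemma: a primitive integer quadratic q vanishing at the irrational u divides the
  monic F over the integers, so its leading coefficient is 1 or -1. The second conclusion transfers
  the equation to the conjugate of u.\<close>

lemma quadratic_integral:
  fixes u :: real and F :: "int poly"
  assumes u: "u \<notin> \<rat>" "A \<noteq> 0" "of_int A * u\<^sup>2 + of_int B * u + of_int C = 0"
    and F: "lead_coeff F = 1" "poly (map_poly of_int F) u = 0"
  obtains T N :: int where "u\<^sup>2 = of_int T * u - of_int N"
    "\<And>z::real. z\<^sup>2 = of_int T * z - of_int N \<Longrightarrow> poly (map_poly of_int F) z = 0"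
proof -
  let ?R = "map_poly real_of_int"
  define q0 where "q0 = [:C, B, A:]"
  define q where "q = primitive_part q0"
  have q0: "q0 \<noteq> 0" "degree q0 = 2" using u by (auto simp: q0_def)
  have q0q: "q0 = smult (content q0) q" by (simp add: q_def)
  have q: "q \<noteq> 0" "degree q = 2" "content q = 1" using q0 by (auto simp: q_def)
  have ev0: "poly (?R q0) z = of_int A * z\<^sup>2 + of_int B * z + of_int C" for z
    by (simp add: q0_def map_poly_pCons power2_eq_square algebra_simps)
  have evs: "poly (?R (smult c p)) z = of_int c * poly (?R p) z" for c p z
    by (simp add: map_poly_smult)
  have qu: "poly (?R q) u = 0"
    using ev0[of u] u(3) q0q evs[of "content q0" q u] q0 by (metis content_eq_zero_iff mult_eq_0_iff of_int_eq_0_iff)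
  obtain h r where hr: "pseudo_divmod F q = (h, r)" by (cases "pseudo_divmod F q") auto
  note pd = pseudo_divmod[OF q(1) hr]
  define c where "c = coeff q (degree q) ^ (Suc (degree F) - degree q)"
  have c: "c \<noteq> 0" unfolding c_def using q(1) by (simp only: power_not_zero leading_coeff_0_iff simp_thms)
  have Fe: "smult c F = q * h + r" and r: "r = 0 \<or> degree r < 2"
    using pd q by (auto simp: c_def)
  have "of_int c * poly (?R F) u = poly (?R q) u * poly (?R h) u + poly (?R r) u"
    by (simp flip: evs add: Fe map_poly_of_int_add map_poly_of_int_mult)
  then have ru: "poly (?R r) u = 0" using qu F by simp
  have "r = 0"
  proof -
    have "degree r \<le> 1" using r by auto
    then have "r = [:coeff r 0, coeff r 1:]"
      by (intro poly_eqI) (auto simp: coeff_pCons coeff_eq_0 split: nat.split)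
    then obtain a b where r': "r = [:a, b:]" by metis
    then have "of_int a + of_int b * u = 0" using ru by (simp add: map_poly_pCons algebra_simps)
    moreover have "b = 0"
    proof (rule ccontr)
      assume "b \<noteq> 0"
      then have "u = - of_int a / of_int b" using calculation by (simp add: field_simps)
      then have "u \<in> \<rat>" by simp
      then show False using u by simp
    qed
    ultimately show ?thesis using r' by simp
  qed
  then have Fe: "smult c F = q * h" using Fe by simp
  \<comment> \<open>Contents multiply. As F and q are primitive, the content of the quotient h is
    that of the constant c, so c can be divided out of the pseudo-division identity.\<close>
  have "content F dvd 1" using content_dvd_coeff[of F "degree F"] F by simp
  then have cF: "content F = 1" using is_unit_normalize[of "content F"] normalize_content[of F] by metis
  have "normalize c = content h" using arg_cong[OF Fe, of content] cF q by (simp add: content_mult)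
  then have "c dvd content h" by (metis dvd_refl dvd_normalize_iff normalize_dvd_iff)
  then have "[:c:] dvd h" by (simp add: const_poly_dvd_iff_dvd_content)
  then obtain h' where h': "h = smult c h'" by (auto elim!: dvdE)
  have "smult c F = smult c (q * h')" using Fe h' by simp
  then have Fq: "F = q * h'" using c by (metis smult_eq_iff smult_cancel)
  have "lead_coeff q * lead_coeff h' = 1" using F Fq by (simp add: lead_coeff_mult)
  then have lq: "lead_coeff q = 1 \<or> lead_coeff q = -1" unfolding zmult_eq_1_iff by blast
  define e where "e = lead_coeff q"
  have e: "e * e = 1" "coeff q 2 = e" using lq q by (auto simp: e_def)
  have qe: "q = [:coeff q 0, coeff q 1, e:]"
    using q e by (intro poly_eqI) (auto simp: coeff_pCons numeral_2_eq_2 coeff_eq_0 split: nat.split)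
  have evq: "poly (?R q) z = of_int (coeff q 0) + of_int (coeff q 1) * z + of_int e * z\<^sup>2" for z
    by (subst qe) (simp add: map_poly_pCons power2_eq_square algebra_simps)
  have ee: "real_of_int e * real_of_int e = 1" using e by (metis of_int_1 of_int_mult)
  have iff: "poly (?R q) z = 0 \<longleftrightarrow> z\<^sup>2 = of_int (- e * coeff q 1) * z - of_int (e * coeff q 0)" for z
  proof -
    have "poly (?R q) z = 0 \<longleftrightarrow> of_int e * poly (?R q) z = 0" using ee by auto
    also have "of_int e * poly (?R q) z = of_int e * of_int (coeff q 0) + of_int e * of_int (coeff q 1) * z + (of_int e * of_int e) * z\<^sup>2"
      unfolding evq by (simp add: algebra_simps)
    finally show ?thesis unfolding ee by auto
  qed
  have "poly (?R F) z = 0" if "poly (?R q) z = 0" for z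
    unfolding Fq using that by (simp add: map_poly_of_int_mult)
  then show ?thesis using that qu iff by blast
qed

text \<open>Weighted AM-GM in logarithmic form: ln z is at most z - 1, with equality only at z = 1.
  The maximum on the open interval from 0 to P + S is thus attained at t = P only, and no irrational
  root can lie there.\<close>

lemma weighted_power_less:
  fixes t :: real
  assumes "P > 0" "S > 0" "0 < t" "t < real (P + S)" "t \<noteq> real P"
  shows "t ^ P * (real (P + S) - t) ^ S < real P ^ P * real S ^ S"
proof -
  define y where "y = real (P + S) - t"
  have y: "y > 0" "y = S + P - t" using assms by (auto simp: y_def)
  have "ln (t / P) < t / P - 1"
    using ln_le_minus_one[of "t / P"] ln_eq_minus_one[of "t / P"] assms by force
  then have "P * ln (t / P) < t - P" using assms by (simp add: field_simps)
  moreover have "ln (y / S) \<le> y / S - 1" using ln_le_minus_one[of "y / S"] assms y by simp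
  then have "S * ln (y / S) \<le> y - S" using assms by (simp add: field_simps)
  ultimately have "P * ln (t / P) + S * ln (y / S) < 0" using y by simp
  then have "P * ln t + S * ln y < P * ln P + S * ln S"
    using assms y(1) by (simp add: ln_div algebra_simps)
  then have "ln (t ^ P * y ^ S) < ln (real P ^ P * real S ^ S)"
    using assms y(1) by (simp add: ln_mult ln_realpow)
  then show ?thesis using assms y(1) by (simp add: y_def)
qed

text \<open>The conjugate \<open>u'\<close> of \<open>u\<close> is another real root, and it must be negative; the norms of
  \<open>u\<close> and \<open>u - (P + S)\<close> then turn out to be those of \<open>P\<close> and \<open>S\<close>.\<close>
lemma quadratic_root_unique:
  fixes u :: real
  assumes PS: "coprime P S" "P > 0" "S > 0" and u: "u > real (P + S)"
    and eq: "u ^ P * (u - real (P + S)) ^ S = real P ^ P * real S ^ S"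
    and quad: "u \<notin> \<rat>" "A \<noteq> 0" "of_int A * u\<^sup>2 + of_int B * u + of_int C = 0"
  shows "P = 1 \<and> S = 1 \<and> u = 1 + sqrt 2"
proof -
  define k where "k = P + S"
  have kr: "real k = real P + real S" by (simp add: k_def)
  obtain F where F: "lead_coeff F = 1"
    "\<And>z. poly (map_poly real_of_int F) z = z ^ P * (z - real k) ^ S - real (P ^ P * S ^ S)"
    using monic_int_poly[OF PS(2), of k S "P ^ P * S ^ S"] by blast
  have "poly (map_poly of_int F) u = 0" unfolding F(2) using eq by (simp add: k_def)
  then obtain T N where TN: "u\<^sup>2 = of_int T * u - of_int N"
    "\<And>z::real. z\<^sup>2 = of_int T * z - of_int N \<Longrightarrow> poly (map_poly of_int F) z = 0"
    using quadratic_integral[OF quad F(1)] by metis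
  define u' where "u' = of_int T - u"
  have sumT: "u + u' = of_int T" and prodN: "u * u' = of_int N"
    using TN(1) by (auto simp: u'_def algebra_simps power2_eq_square)
  have "u'\<^sup>2 = of_int T * u' - of_int N"
    using sumT prodN by (simp add: algebra_simps power2_eq_square flip: sumT prodN)
  from TN(2)[OF this] have eq': "u' ^ P * (u' - real k) ^ S = real P ^ P * real S ^ S"
    unfolding F(2) by simp
  have nr: "u' \<notin> \<rat>"
  proof
    assume "u' \<in> \<rat>"
    then have "of_int T - u' \<in> \<rat>" by simp
    then show False using quad by (simp add: u'_def)
  qed
  have neq: "u \<noteq> u'"
  proof
    assume "u = u'"
    then have uT: "u = of_int T / 2" using sumT by simp
    have "u \<in> \<rat>" unfolding uT by simp
    then show False using quad by simp
  qed
  have uk: "u > k" using u by (simp add: k_def)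
  have eqk: "u ^ P * (u - real k) ^ S = real P ^ P * real S ^ S" using eq by (simp add: k_def)
  \<comment> \<open>To the right of k the left side of the equation is strictly increasing, so u is
    the only root there.\<close>
  have mono: "z ^ P * (z - real k) ^ S < t ^ P * (t - real k) ^ S" if "real k < z" "z < t" for z t
    using that PS by (intro mult_strict_mono power_strict_mono) (auto simp: zero_less_power)
  have "\<not> u' > k" using mono[of u u'] mono[of u' u] eqk eq' uk neq by (cases "u < u'") auto
  moreover have "u' \<noteq> real k" "u' \<noteq> 0" "u' \<noteq> real P" using nr by auto
  moreover have "\<not> (0 < u' \<and> u' < k)"
  proof
    assume a: "0 < u' \<and> u' < k"
    have "\<bar>u' ^ P * (u' - real k) ^ S\<bar> = u' ^ P * (real k - u') ^ S"
      using a by (simp add: abs_mult power_abs)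
    then have "u' ^ P * (real k - u') ^ S = real P ^ P * real S ^ S" unfolding eq' by simp
    then show False using weighted_power_less[of P S u'] a PS \<open>u' \<noteq> real P\<close> by (simp add: k_def)
  qed
  ultimately have neg: "u' < 0" by linarith
  define w where "w = - u'"
  have w: "w > 0" using neg by (simp add: w_def)
  \<comment> \<open>At a negative root both bases are negative, so the sign of the left side is
    (-1)^(P + S). Positivity of the right side makes P + S even, and coprimality then makes both
    exponents odd.\<close>
  have "u' ^ P * (u' - real k) ^ S = (-1) ^ P * w ^ P * ((-1) ^ S * (w + real k) ^ S)"
    unfolding w_def by (simp flip: power_mult_distrib)
  then have eqw: "(-1) ^ (P + S) * (w ^ P * (w + real k) ^ S) = real P ^ P * real S ^ S"
    using eq' by (simp add: power_add mult_ac)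
  have "even (P + S)"
  proof (rule ccontr)
    assume "odd (P + S)"
    then have "- (w ^ P * (w + real k) ^ S) = real P ^ P * real S ^ S" using eqw by simp
    moreover have "w ^ P * (w + real k) ^ S > 0" "real P ^ P * real S ^ S > 0" using w PS by auto
    ultimately show False by linarith
  qed
  then have odd: "odd P" "odd S" using PS(1) by (auto simp: coprime_common_divisor)
  have eqw: "w ^ P * (w + real k) ^ S = real P ^ P * real S ^ S"
    using eqw \<open>even (P + S)\<close> by simp
  have wP: "w < P"
  proof (rule ccontr)
    assume "\<not> w < P"
    then have "real P ^ P * real S ^ S < w ^ P * (w + real k) ^ S"
      using w PS by (intro mult_le_less_imp_less power_mono power_strict_mono) (auto simp: kr)
    then show False using eqw by simp
  qed
  define v where "v = u - k"
  have v: "v > 0" "u = v + k" using uk by (auto simp: v_def)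
  have vS: "v < S"
  proof (rule ccontr)
    assume "\<not> v < S"
    then have "real P ^ P * real S ^ S < u ^ P * v ^ S"
      using v PS by (intro mult_less_le_imp_less power_mono power_strict_mono) (auto simp: kr)
    then show False using eqk by (simp add: v_def)
  qed
  \<comment> \<open>The absolute norms of u and of u - k. Both norms are negative because u > k > 0
    while the conjugate -w is negative.\<close>
  define A' where "A' = nat (- N)"
  define B' where "B' = nat (- N + int k * T - int k * int k)"
  have uw: "u * w = - of_int N" using prodN by (simp add: w_def)
  then have "- N > 0" using w v PS by (metis add_pos_nonneg mult_pos_pos of_int_0_less_iff of_int_minus of_nat_0_le_iff)
  then have A': "real A' = u * w" using uw by (simp add: A'_def)
  have vw: "v * (w + k) = of_int (- N + int k * T - int k * int k)"
    using uw sumT by (simp add: v_def w_def u'_def algebra_simps)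
  then have "of_int (- N + int k * T - int k * int k) > (0::real)" using v w
    by (metis add_pos_nonneg mult_pos_pos of_nat_0_le_iff)
  then have "- N + int k * T - int k * int k > 0" by (simp only: of_int_0_less_iff)
  then have B': "real B' = v * (w + k)" using vw by (simp add: B'_def)
  have pos: "A' > 0" "B' > 0" using A' B' v w
    by (metis add_pos_nonneg mult_pos_pos of_nat_0_le_iff of_nat_0_less_iff)+
  have "real (A' ^ P * B' ^ S) = (u ^ P * v ^ S) * (w ^ P * (w + k) ^ S)"
    by (simp add: A' B' power_mult_distrib mult_ac)
  also have "\<dots> = real (P ^ (2 * P) * S ^ (2 * S))"
    unfolding v_def eqk eqw by (simp add: mult_2 power_add)
  finally have AB: "A' ^ P * B' ^ S = P ^ (2 * P) * S ^ (2 * S)" using of_nat_eq_iff by blast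
  have "u * w < real (2 * S + P) * real P" using vS wP v w by (intro mult_strict_mono) (auto simp: kr)
  then have Alt: "A' < P * (2 * S + P)"
    unfolding A'[symmetric] by (simp only: of_nat_less_iff mult.commute flip: of_nat_mult)
  have "v * (w + k) < real S * real (2 * P + S)" using vS wP v w by (intro mult_strict_mono) (auto simp: kr)
  then have Blt: "B' < S * (2 * P + S)"
    unfolding B'[symmetric] by (simp only: flip: of_nat_mult)
  have Ale: "A' \<le> P\<^sup>2" using norm_bound_half[OF PS(1) odd pos AB Alt] .
  have Ble: "B' \<le> S\<^sup>2"
    using norm_bound_half[of S P B' A'] PS odd pos AB Blt by (simp add: coprime_commute mult.commute)
  \<comment> \<open>Each norm is bounded by the corresponding square, and the product relation holds
    with equality; neither bound can be strict.\<close>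
  have BS: "B' = S\<^sup>2"
  proof (rule ccontr)
    assume "B' \<noteq> S\<^sup>2"
    then have "A' ^ P * B' ^ S < (P\<^sup>2) ^ P * (S\<^sup>2) ^ S"
      using Ale Ble PS pos by (intro mult_le_less_imp_less power_mono power_strict_mono) auto
    then show False using AB by (simp add: power_mult)
  qed
  then have "A' ^ P = (P\<^sup>2) ^ P" using AB PS by (simp add: power_mult)
  then have AP: "A' = P\<^sup>2" using PS by (simp add: power_eq_iff_eq_base)
  define s where "s = sqrt (real P ^ 2 + real S ^ 2)"
  have s2: "s\<^sup>2 = real P ^ 2 + real S ^ 2" by (simp add: s_def)
  have s0: "s > 0" using PS by (simp add: s_def add_pos_pos)
  have uwP: "u * w = real P ^ 2" and vwS: "v * (w + k) = real S ^ 2"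
    using A' B' AP BS by simp_all
  \<comment> \<open>Subtracting the two norm equations gives the trace u - w, and with u w = P^2 the
    root is determined as S + sqrt(P^2 + S^2).\<close>
  have "real k * (u - w) = real k * (2 * real S)"
    using uwP vwS by (simp add: v_def kr algebra_simps power2_eq_square)
  then have "u - w = 2 * S" using PS by (simp add: k_def)
  then have "(u - S)\<^sup>2 = s\<^sup>2" unfolding s2 using uwP by (simp add: power2_eq_square algebra_simps)
  moreover have "u - S > 0" using v by (simp add: kr)
  ultimately have us: "u = s + S" using s0 by (simp add: power2_eq_iff_nonneg)
  have vs: "v = s - P" using us by (simp add: v_def kr)
  have "v * (s + P) = real S ^ 2" using s2 by (simp add: vs power2_eq_square algebra_simps)
  then have Sv: "S / v = (s + P) / S" using v PS by (simp add: field_simps power2_eq_square)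
  have 1: "arsinh (real S / real P) = ln (u / P)"
  proof -
    have "(real S / real P)\<^sup>2 + 1 = (s / P)\<^sup>2" using PS by (simp add: power_divide s2 field_simps)
    then show ?thesis using PS s0 by (simp add: arsinh_real_def us add_divide_distrib add.commute)
  qed
  have 2: "arsinh (real P / real S) = ln (S / v)"
  proof -
    have "(real P / real S)\<^sup>2 + 1 = (s / S)\<^sup>2" using PS by (simp add: power_divide s2 field_simps)
    then show ?thesis unfolding Sv using PS s0 by (simp add: arsinh_real_def add_divide_distrib add.commute)
  qed
  \<comment> \<open>The norm equations have used only the product of the equations for u and for its
    conjugate. The equation for u itself becomes, after taking logarithms, the relation that
    \<open>arsinh_asym\<close> decides.\<close>
  have "(u / P) ^ P = (S / v) ^ S" using eqk v PS unfolding v_def[symmetric] by (simp add: field_simps)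
  then have "ln ((u / P) ^ P) = ln ((S / v) ^ S)" by simp
  then have main: "P * arsinh (real S / real P) = S * arsinh (real P / real S)"
    unfolding 1 2 using v PS by (simp add: ln_realpow)
  have "\<not> S > P" using arsinh_asym[of "real S / real P"] main PS by (auto simp: field_simps)
  moreover have "\<not> S < P" using arsinh_asym[of "real P / real S"] main PS by (auto simp: field_simps)
  ultimately have "S = P" by simp
  then have "P = 1" "S = 1" using PS by auto
  then show ?thesis using us by (simp add: s_def)
qed

subsection \<open>Euler's transformation\<close>

definition hcoef :: "'a \<Rightarrow> 'a \<Rightarrow> 'a \<Rightarrow> nat \<Rightarrow> 'a :: field_char_0" where
  "hcoef a b c n = pochhammer a n * pochhammer b n / (pochhammer c n * fact n)"

definition rhyp :: "real \<Rightarrow> real \<Rightarrow> real \<Rightarrow> real \<Rightarrow> real" where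
  "rhyp a b c x = (\<Sum>n. hcoef a b c n * x ^ n)"

lemma hcoef_0 [simp]: "hcoef a b c 0 = 1"
  by (simp add: hcoef_def)

lemma hcoef_Suc: "hcoef a b c (Suc n) = hcoef a b c n * ((a + of_nat n) * (b + of_nat n) / ((c + of_nat n) * (1 + of_nat n)))"
  by (simp add: hcoef_def pochhammer_Suc mult_ac)

lemma not_nonpos_Int_add_nat:
  "c \<notin> \<int>\<^sub>\<le>\<^sub>0 \<Longrightarrow> c + of_nat n \<noteq> (0 :: 'a :: field_char_0)"
  by (metis add_eq_0_iff2 minus_of_nat_in_nonpos_Ints)

lemma hcoef_rec:
  assumes "c \<notin> \<int>\<^sub>\<le>\<^sub>0"
  shows "of_nat (Suc n) * (c + of_nat n) * hcoef a b c (Suc n) = (a + of_nat n) * (b + of_nat n) * hcoef a b c n"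
proof -
  have "c + of_nat n \<noteq> 0" "1 + of_nat n \<noteq> (0::'a)"
    using not_nonpos_Int_add_nat[OF assms] by (auto simp flip: of_nat_Suc)
  then show ?thesis by (simp add: hcoef_Suc)
qed

text \<open>Ratio test: the quotient of consecutive terms tends to x. If c is a nonpositive integer,
  division by zero makes the terms eventually 0, so that case converges too.\<close>

lemma summable_hcoef:
  fixes x :: real
  assumes "\<bar>x\<bar> < 1"
  shows "summable (\<lambda>n. \<bar>hcoef a b c n * x ^ n\<bar>)"
proof -
  define g where "g n = (a + real n) * (b + real n) / ((c + real n) * (1 + real n)) * x" for n
  have "(\<lambda>n. (a + real n) * (b + real n) / ((c + real n) * (1 + real n))) \<longlonglongrightarrow> 1"
    by real_asymp
  then have "g \<longlonglongrightarrow> 1 * x" unfolding g_def by (intro tendsto_intros)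
  then have "(\<lambda>n. \<bar>g n\<bar>) \<longlonglongrightarrow> \<bar>x\<bar>" using tendsto_rabs by force
  then have "eventually (\<lambda>n. \<bar>g n\<bar> < (1 + \<bar>x\<bar>) / 2) sequentially"
    by (rule order_tendstoD) (use assms in auto)
  then obtain N where N: "\<And>n. n \<ge> N \<Longrightarrow> \<bar>g n\<bar> < (1 + \<bar>x\<bar>) / 2"
    by (auto simp: eventually_sequentially)
  show ?thesis
  proof (rule summable_ratio_test)
    show "(1 + \<bar>x\<bar>) / 2 < 1" using assms by simp
    fix n assume "n \<ge> N"
    have "hcoef a b c (Suc n) * x ^ Suc n = g n * (hcoef a b c n * x ^ n)"
      by (simp add: hcoef_Suc g_def)
    then have "norm \<bar>hcoef a b c (Suc n) * x ^ Suc n\<bar> = \<bar>g n\<bar> * norm \<bar>hcoef a b c n * x ^ n\<bar>"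
      by (simp only: abs_mult real_norm_def abs_abs)
    also have "\<dots> \<le> (1 + \<bar>x\<bar>) / 2 * norm \<bar>hcoef a b c n * x ^ n\<bar>"
      using N[OF \<open>n \<ge> N\<close>] by (intro mult_right_mono) auto
    finally show "norm \<bar>hcoef a b c (Suc n) * x ^ Suc n\<bar> \<le> (1 + \<bar>x\<bar>) / 2 * norm \<bar>hcoef a b c n * x ^ n\<bar>" .
  qed
qed

lemma rhyp_sums:
  assumes "\<bar>x\<bar> < 1"
  shows "(\<lambda>n. hcoef a b c n * x ^ n) sums rhyp a b c x"
  unfolding rhyp_def by (rule summable_sums[OF summable_rabs_cancel[OF summable_hcoef[OF assms]]])

lemma hypergeometric_fps_ode:
  assumes "c \<notin> \<int>\<^sub>\<le>\<^sub>0" and y: "y = Abs_fps (hcoef a b c)"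
  shows "fps_X * (1 - fps_X) * fps_deriv (fps_deriv y) + (fps_const c - fps_const (a + b + 1) * fps_X) * fps_deriv y
    = fps_const (a * b) * (y :: real fps)"
proof (rule fps_ext)
  fix n
  show "(fps_X * (1 - fps_X) * fps_deriv (fps_deriv y) + (fps_const c - fps_const (a + b + 1) * fps_X) * fps_deriv y) $ n
    = (fps_const (a * b) * y) $ n"
  proof (cases n)
    case 0
    then show ?thesis using hcoef_rec[OF assms(1), of 0 a b] by (simp add: y algebra_simps)
  next
    case (Suc m)
    then show ?thesis using hcoef_rec[OF assms(1), of n a b]
      by (cases m) (simp_all add: y algebra_simps)
  qed
qed

lemma hypergeometric_fps_ode_unique:
  fixes z :: "real fps"
  assumes "c \<notin> \<int>\<^sub>\<le>\<^sub>0" "z $ 0 = 1"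
   and ode: "fps_X * (1 - fps_X) * fps_deriv (fps_deriv z) + (fps_const c - fps_const (a + b + 1) * fps_X) * fps_deriv z
    = fps_const (a * b) * z"
  shows "z $ n = hcoef a b c n"
proof (induction n)
  case (Suc n)
  have "real (Suc n) * (c + real n) * z $ Suc n = (a + real n) * (b + real n) * z $ n"
    using arg_cong[OF ode, of "\<lambda>f. f $ n"]
    by (cases n; cases "n - 1") (simp_all add: algebra_simps)
  then have "real (Suc n) * (c + real n) * z $ Suc n = real (Suc n) * (c + real n) * hcoef a b c (Suc n)"
    using hcoef_rec[OF assms(1), of n a b] Suc by simp
  then show ?case using not_nonpos_Int_add_nat[OF assms(1), of n] by simp
qed (simp add: assms)

text \<open>Here g stands for (1 - X)^(a + b - c), with derivatives g1 and g2, and y for a solution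
  of the hypergeometric equation; g y solves the equation with a, b replaced by c - a, c - b. The
  extra factor 1 - X is present because the derivatives of g are only known after multiplication by
  it. The proof writes the difference of the two sides as an explicit combination of the three
  hypotheses.\<close>

lemma gauge_ode_identity:
  fixes X a b c g g1 g2 y y1 y2 :: "'a :: comm_ring_1"
  assumes g1: "(1 - X) * g1 = - (a + b - c) * g" and g2: "(1 - X) * g2 = (1 - (a + b - c)) * g1"
    and y: "X * (1 - X) * y2 + (c - (a + b + 1) * X) * y1 = a * b * y"
  shows "(1 - X) * (X * (1 - X) * (g2 * y + 2 * g1 * y1 + g * y2)
     + (c - (2 * c - a - b + 1) * X) * (g1 * y + g * y1)) = (1 - X) * ((c - a) * (c - b) * (g * y))"
proof -
  have "(1 - X) * (X * (1 - X) * (g2 * y + 2 * g1 * y1 + g * y2)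
     + (c - (2 * c - a - b + 1) * X) * (g1 * y + g * y1)) - (1 - X) * ((c - a) * (c - b) * (g * y))
     = X * (1 - X) * y * ((1 - X) * g2 - (1 - (a + b - c)) * g1)
     + (X * (1 - (a + b - c)) * y + 2 * X * (1 - X) * y1 + (c - (2 * c - a - b + 1) * X) * y)
        * ((1 - X) * g1 + (a + b - c) * g)
     + g * (1 - X) * (X * (1 - X) * y2 + (c - (a + b + 1) * X) * y1 - a * b * y)"
    by (simp add: algebra_simps)
  also have "\<dots> = 0" unfolding g1 g2 y by (simp only: minus_mult_left[symmetric] left_minus diff_self mult_zero_right add_0_right)
  finally show ?thesis by simp
qed

text \<open>The formal power series z of the left side satisfies the hypergeometric equation with
  parameters c - a, c - b and starts with 1, which determines it. The identity of formal series
  becomes one of numbers through the Cauchy product of two absolutely convergent series.\<close>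

lemma euler_transformation:
  fixes x :: real
  assumes c: "c \<notin> \<int>\<^sub>\<le>\<^sub>0" and x: "\<bar>x\<bar> < 1"
  shows "(1 - x) powr (a + b - c) * rhyp a b c x = rhyp (c - a) (c - b) c x"
proof -
  define s where "s = a + b - c"
  define y where "y = Abs_fps (hcoef a b c)"
  define g where "g = Abs_fps (\<lambda>n. (s gchoose n) * (-1) ^ n)"
  define z where "z = g * y"
  have g1: "(1 - fps_X) * fps_deriv g = - fps_const s * g"
  proof (rule fps_ext)
    fix n
    have "(s gchoose Suc n) * real (Suc n) = (s - real n) * (s gchoose n)"
      using gbinomial_absorb_comp[of s n] gbinomial_absorption[of n s] by (metis mult.commute)
    from arg_cong[OF this, of "\<lambda>t. t * (-1) ^ n"]
    show "((1 - fps_X) * fps_deriv g) $ n = (- fps_const s * g) $ n"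
      by (cases n) (simp_all add: g_def algebra_simps)
  qed
  have g2: "(1 - fps_X) * fps_deriv (fps_deriv g) = (1 - fps_const s) * fps_deriv g"
    using arg_cong[OF g1, of fps_deriv] by (simp add: algebra_simps del: fps_const_neg)
  note yo = hypergeometric_fps_ode[OF c y_def]
  let ?X = "fps_X :: real fps"
  have cc: "fps_const (a + b + 1) = fps_const a + fps_const b + 1" "fps_const (a * b) = fps_const a * fps_const b"
    "fps_const s = fps_const a + fps_const b - fps_const c"
    "fps_const ((c - a) + (c - b) + 1) = 2 * fps_const c - fps_const a - fps_const b + 1"
    "fps_const ((c - a) * (c - b)) = (fps_const c - fps_const a) * (fps_const c - fps_const b)"
    by (simp_all add: s_def algebra_simps numeral_fps_const)
  have z1: "fps_deriv z = fps_deriv g * y + g * fps_deriv y"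
    by (simp add: z_def algebra_simps)
  have z2: "fps_deriv (fps_deriv z) = fps_deriv (fps_deriv g) * y + 2 * fps_deriv g * fps_deriv y + g * fps_deriv (fps_deriv y)"
    by (simp add: z1 algebra_simps)
  have "(1 - ?X) * (?X * (1 - ?X) * fps_deriv (fps_deriv z)
      + (fps_const c - fps_const ((c - a) + (c - b) + 1) * ?X) * fps_deriv z)
      = (1 - ?X) * (fps_const ((c - a) * (c - b)) * z)"
    using gauge_ode_identity[OF g1[unfolded cc] g2[unfolded cc] yo[unfolded cc]]
    unfolding z2 unfolding z1 cc unfolding z_def .
  then have zo: "?X * (1 - ?X) * fps_deriv (fps_deriv z)
      + (fps_const c - fps_const ((c - a) + (c - b) + 1) * ?X) * fps_deriv z
      = fps_const ((c - a) * (c - b)) * z"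
    by (metis fps_X_neq_one eq_iff_diff_eq_0 mult_left_cancel)
  have "z $ 0 = 1" by (simp add: z_def g_def y_def)
  then have zn: "z $ n = hcoef (c - a) (c - b) c n" for n
    using hypergeometric_fps_ode_unique[OF c _ zo] by simp
  have gs: "(\<lambda>n. g $ n * x ^ n) sums (1 - x) powr s"
    using gen_binomial_real[of "- x" s] x by (simp add: g_def power_minus[of x] mult_ac)
  have gabs: "summable (\<lambda>n. norm (g $ n * x ^ n))"
  proof -
    \<comment> \<open>The binomial series is itself hypergeometric, with the two parameters 1
      cancelling, so its absolute convergence is already available.\<close>
    have "g $ n = hcoef (- s) 1 1 n" for n
      by (simp add: g_def hcoef_def gbinomial_pochhammer pochhammer_fact[symmetric] flip: power_mult_distrib)
    then show ?thesis using summable_hcoef[OF x, of "- s" 1 1] by simp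
  qed
  have yabs: "summable (\<lambda>n. norm (y $ n * x ^ n))"
    using summable_hcoef[OF x, of a b c] by (simp add: y_def)
  have "(\<lambda>k. \<Sum>i\<le>k. (g $ i * x ^ i) * (y $ (k - i) * x ^ (k - i))) sums
     ((\<Sum>n. g $ n * x ^ n) * (\<Sum>n. y $ n * x ^ n))"
    by (rule Cauchy_product_sums[OF gabs yabs])
  also have "(\<lambda>k. \<Sum>i\<le>k. (g $ i * x ^ i) * (y $ (k - i) * x ^ (k - i))) = (\<lambda>k. z $ k * x ^ k)"
    unfolding z_def fps_mult_nth sum_distrib_right atLeast0AtMost
    by (intro ext sum.cong) (auto simp: mult_ac simp flip: power_add)
  finally have "(\<Sum>n. z $ n * x ^ n) = (1 - x) powr s * (\<Sum>n. y $ n * x ^ n)"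
    using gs by (simp add: sums_iff)
  then show ?thesis by (simp add: zn rhyp_def y_def s_def)
qed

subsection \<open>First-order asymptotics of the hypergeometric function\<close>

lemma negative_binomial_sums:
  fixes y :: real
  assumes "\<bar>y\<bar> < 1"
  shows "(\<lambda>n. pochhammer b n / fact n * y ^ n) sums (1 - y) powr (- b)"
proof -
  have "((- b) gchoose n) * (- y) ^ n = pochhammer b n / fact n * y ^ n" for n
    by (simp add: gbinomial_pochhammer mult_ac flip: power_mult_distrib)
  then show ?thesis using gen_binomial_real[of "- y" "- b"] assms by simp
qed

text \<open>Absorbing n into the coefficient raises b to b + 1 and shifts the index. This factorial
  moment and the second one evaluate the first-order term in \<open>hyp_first_order\<close>.\<close>

lemma negative_binomial_moment1:
  fixes y :: real
  assumes "\<bar>y\<bar> < 1"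
  shows "(\<lambda>n. real n * (pochhammer b n / fact n * y ^ n)) sums (b * y * (1 - y) powr (- b - 1))"
proof -
  have e: "- b - 1 = - (b + 1)" by simp
  have "(\<lambda>n. b * y * (pochhammer (b + 1) n / fact n * y ^ n)) sums (b * y * (1 - y) powr (- b - 1))"
    unfolding e by (intro sums_mult negative_binomial_sums assms)
  also have "(\<lambda>n. b * y * (pochhammer (b + 1) n / fact n * y ^ n))
     = (\<lambda>n. real (Suc n) * (pochhammer b (Suc n) / fact (Suc n) * y ^ Suc n))"
    by (intro ext) (simp add: pochhammer_rec field_simps del: of_nat_Suc)
  finally show ?thesis by (subst (asm) sums_Suc_iff) (simp add: algebra_simps)
qed

lemma negative_binomial_moment2:
  fixes y :: real
  assumes "\<bar>y\<bar> < 1"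
  shows "(\<lambda>n. real n * (real n - 1) * (pochhammer b n / fact n * y ^ n)) sums
    (b * (b + 1) * y\<^sup>2 * (1 - y) powr (- b - 2))"
proof -
  have e: "- b - 2 = - (b + 1) - 1" by simp
  have "(\<lambda>n. b * y * (real n * (pochhammer (b + 1) n / fact n * y ^ n))) sums
     (b * y * ((b + 1) * y * (1 - y) powr (- b - 2)))"
    unfolding e by (intro sums_mult negative_binomial_moment1 assms)
  also have "(\<lambda>n. b * y * (real n * (pochhammer (b + 1) n / fact n * y ^ n)))
     = (\<lambda>n. real (Suc n) * (real (Suc n) - 1) * (pochhammer b (Suc n) / fact (Suc n) * y ^ Suc n))"
    by (intro ext) (simp add: pochhammer_rec field_simps del: of_nat_Suc, simp add: algebra_simps)
  finally show ?thesis by (subst (asm) sums_Suc_iff) (simp add: algebra_simps power2_eq_square)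
qed

lemma pochhammer_half_le: "\<bar>pochhammer (1/2) n / fact n :: real\<bar> \<le> 1"
proof (induction n)
  case (Suc n)
  have "pochhammer (1/2) (Suc n) / fact (Suc n) = (pochhammer (1/2) n / fact n :: real) * ((1/2 + real n) / (1 + real n))"
    by (simp add: pochhammer_Suc field_simps)
  then have "\<bar>pochhammer (1/2) (Suc n) / fact (Suc n) :: real\<bar> = \<bar>pochhammer (1/2) n / fact n :: real\<bar> * ((1/2 + real n) / (1 + real n))"
    by (simp only: abs_mult) simp
  also have "\<dots> \<le> 1 * 1" by (intro mult_mono Suc) (auto simp: field_simps)
  finally show ?case by simp
qed simp

text \<open>Used as a majorant: it lets \<open>summable_hcoef\<close> supply the convergence of the
  series of (n + 1)(n + 2) x^n.\<close>

lemma hcoef_311: "hcoef 3 1 1 n = (real n + 1) * (real n + 2) / 2"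
proof (induction n)
  case (Suc n)
  have "1 + real n \<noteq> 0" by linarith
  then have "hcoef 3 1 1 (Suc n) = hcoef 3 1 1 n * ((real n + 3) / (real n + 1))"
    by (simp add: hcoef_Suc add.commute)
  also have "\<dots> = (real n + 2) * (real n + 3) / 2"
    unfolding Suc.IH using \<open>1 + real n \<noteq> 0\<close> by (simp add: divide_simps) (simp add: algebra_simps)
  finally show ?case by (simp add: algebra_simps)
qed simp

lemma pochhammer_conv_prod: "pochhammer a n = (\<Prod>j<n. a + of_nat j)"
  by (simp add: pochhammer_prod lessThan_atLeast0)

text \<open>The j-th factor is p / r times 1 + ((\<open>\<alpha>\<close> + j) / p -
  (\<open>\<gamma>\<close> + j) / r) / W up to o(1 / W), and first-order coefficients add under
  multiplication.\<close>

lemma pochhammer_quotient_first_order: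
  fixes p r \<alpha> \<gamma> :: real
  assumes "p > 0" "r > 0"
  shows "((\<lambda>W. W * (pochhammer (p * W + \<alpha>) n / pochhammer (r * W + \<gamma>) n - (p / r) ^ n)) \<longlongrightarrow>
    (p / r) ^ n * (\<Sum>j<n. (\<alpha> + real j) / p - (\<gamma> + real j) / r)) at_top"
proof (induction n)
  case (Suc n)
  define X where "X n W = pochhammer (p * W + \<alpha>) n / pochhammer (r * W + \<gamma>) n" for n W
  define \<xi> where "\<xi> W = (p * W + \<alpha> + n) / (r * W + \<gamma> + n)" for W
  have 1: "(\<xi> \<longlongrightarrow> p / r) at_top"
    unfolding \<xi>_def using assms by (real_asymp simp: field_simps)
  have "((\<lambda>W. W * ((\<alpha> + n) - p / r * (\<gamma> + n)) / (r * W + \<gamma> + n)) \<longlongrightarrow> ((\<alpha> + n) - p / r * (\<gamma> + n)) / r) at_top"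
    using assms by (real_asymp simp: field_simps)
  moreover have "eventually (\<lambda>W. r * W + \<gamma> + n > 0) at_top"
    using assms by real_asymp
  then have "eventually (\<lambda>W. W * ((\<alpha> + n) - p / r * (\<gamma> + n)) / (r * W + \<gamma> + n) = W * (\<xi> W - p / r)) at_top"
    by eventually_elim (use assms in \<open>simp add: \<xi>_def field_simps\<close>)
  ultimately have 2: "((\<lambda>W. W * (\<xi> W - p / r)) \<longlongrightarrow> p / r * ((\<alpha> + n) / p - (\<gamma> + n) / r)) at_top"
    by (rule Lim_transform_eventually[THEN back_subst[of "\<lambda>l. (_ \<longlongrightarrow> l) at_top"]])
      (use assms in \<open>simp add: field_simps\<close>)
  have eq: "W * (X (Suc n) W - (p / r) ^ Suc n) = \<xi> W * (W * (X n W - (p / r) ^ n)) + (p / r) ^ n * (W * (\<xi> W - p / r))" for W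
  proof -
    have "X (Suc n) W = X n W * \<xi> W" by (simp add: X_def \<xi>_def pochhammer_Suc add.assoc)
    then show ?thesis by (simp add: algebra_simps)
  qed
  have "((\<lambda>W. W * (X (Suc n) W - (p / r) ^ Suc n)) \<longlongrightarrow>
     (p / r) * ((p / r) ^ n * (\<Sum>j<n. (\<alpha> + real j) / p - (\<gamma> + real j) / r)) + (p / r) ^ n * (p / r * ((\<alpha> + n) / p - (\<gamma> + n) / r))) at_top"
    unfolding eq by (rule tendsto_add[OF tendsto_mult[OF 1 Suc.IH[folded X_def]] tendsto_mult[OF tendsto_const 2]])
  also have "(p / r) * ((p / r) ^ n * (\<Sum>j<n. (\<alpha> + real j) / p - (\<gamma> + real j) / r)) + (p / r) ^ n * (p / r * ((\<alpha> + n) / p - (\<gamma> + n) / r))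
    = (p / r) ^ Suc n * (\<Sum>j<Suc n. (\<alpha> + real j) / p - (\<gamma> + real j) / r)"
    by (simp only: sum.lessThan_Suc power_Suc distrib_left mult_ac)
  finally show ?case unfolding X_def .
qed simp

text \<open>The limit is taken termwise by Tannery's theorem. The leading terms sum to a binomial
  series, which gives (1 - y)^(-1/2); the corrections are factorial moments of that series. The
  constant 3/8 is b (b + 1) / 2 at b = 1/2.\<close>

lemma hyp_first_order:
  fixes p r x \<alpha> \<gamma> :: real
  assumes p: "0 < p" "p < r" and x: "0 < x" "x < 1"
  defines "y \<equiv> p * x / r"
  defines "t \<equiv> y / (1 - y)"
  shows "((\<lambda>W. W * (rhyp (p * W + \<alpha>) (1/2) (r * W + \<gamma>) x / (1 - y) powr (-1/2) - 1)) \<longlongrightarrow>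
    (\<alpha> / p - \<gamma> / r) * t / 2 + (1 / p - 1 / r) * (3 / 8) * t\<^sup>2) at_top"
proof -
  define \<beta> where "\<beta> n = pochhammer (1/2) n / (fact n :: real)" for n
  define X where "X n W = pochhammer (p * W + \<alpha>) n / pochhammer (r * W + \<gamma>) n" for n W
  \<comment> \<open>The factor 2 / r bounds W / (r W + \<open>\<gamma>\<close> + j) as soon as r W /
    2 + \<open>\<gamma>\<close> is positive; the bracket, times 1 + j, bounds the numerator of the
    j-th factor minus p / r.\<close>
  define K where "K = 2 / r * (\<bar>\<alpha>\<bar> + \<bar>\<gamma>\<bar> + 1)"
  define s where "s n = (\<Sum>j<n. (\<alpha> + real j) / p - (\<gamma> + real j) / r)" for n
  have r: "r > 0" using p by simp
  have y: "0 < y" "y < 1" using p x r mult_strict_mono[of p r x 1] by (auto simp: y_def field_simps)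
  have ay: "\<bar>y\<bar> < 1" using y by simp
  have c0: "(1 - y) powr (-1/2) > 0" using y by simp
  have ev: "eventually (\<lambda>W. W > 0 \<and> p * W + \<alpha> \<ge> 0 \<and> p * W + \<alpha> \<le> r * W + \<gamma> \<and> r * W / 2 + \<gamma> > 0) at_top"
  proof (intro eventually_conj)
    have "filterlim (\<lambda>W. (r - p) * W + (\<gamma> - \<alpha>)) at_top at_top" using p by real_asymp
    then have "eventually (\<lambda>W. (r - p) * W + (\<gamma> - \<alpha>) \<ge> 0) at_top" by (simp add: filterlim_at_top)
    then show "eventually (\<lambda>W. p * W + \<alpha> \<le> r * W + \<gamma>) at_top"
      by eventually_elim (simp add: algebra_simps)
  qed (use p r in real_asymp)+
  \<comment> \<open>For large W every factor of \<open>X n W\<close> lies between 0 and 1, as does p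
    / r. The difference of two such products is at most the sum of the differences of the factors,
    so the bound is polynomial in n and x^n makes it summable.\<close>
  have bd: "\<bar>W * (X n W - (p / r) ^ n)\<bar> \<le> K * (real n * (1 + real n))"
    if W: "W > 0 \<and> p * W + \<alpha> \<ge> 0 \<and> p * W + \<alpha> \<le> r * W + \<gamma> \<and> r * W / 2 + \<gamma> > 0" for n W
  proof -
    define \<xi> where "\<xi> j = (p * W + \<alpha> + real j) / (r * W + \<gamma> + real j)" for j
    have rW: "r * W > 0" using W r by simp
    have den: "r * W + \<gamma> + real j \<ge> r * W / 2" "r * W + \<gamma> + real j > 0" for j
    proof -
      have "real j \<ge> 0" by simp
      then show "r * W + \<gamma> + real j \<ge> r * W / 2" using W by linarith
      then show "r * W + \<gamma> + real j > 0" using rW by linarith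
    qed
    have X: "X n W = (\<Prod>j<n. \<xi> j)" by (simp add: X_def \<xi>_def pochhammer_conv_prod prod_dividef)
    have \<xi>1: "norm (\<xi> j) \<le> 1" for j
      using W den[of j] unfolding \<xi>_def by (auto simp: field_simps)
    have \<xi>2: "W * norm (\<xi> j - p / r) \<le> K * (1 + real j)" for j
    proof -
      have "\<xi> j - p / r = ((\<alpha> + j) - p / r * (\<gamma> + j)) / (r * W + \<gamma> + j)"
        using den[of j] r by (simp add: \<xi>_def field_simps)
      then have "W * norm (\<xi> j - p / r) = \<bar>(\<alpha> + j) - p / r * (\<gamma> + j)\<bar> * (W / (r * W + \<gamma> + j))"
        using den[of j] by (simp add: abs_mult)
      also have "\<dots> \<le> ((\<bar>\<alpha>\<bar> + \<bar>\<gamma>\<bar> + 1) * (1 + real j)) * (2 / r)"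
      proof (intro mult_mono)
        have le: "c \<le> (\<bar>\<alpha>\<bar> + \<bar>\<gamma>\<bar> + 1) * (1 + real j)" if "c \<le> \<bar>\<alpha>\<bar> + \<bar>\<gamma>\<bar> + j" for c
        proof -
          have "(\<bar>\<alpha>\<bar> + \<bar>\<gamma>\<bar> + 1) * (1 + real j) = \<bar>\<alpha>\<bar> + \<bar>\<gamma>\<bar> + j + 1 + (\<bar>\<alpha>\<bar> + \<bar>\<gamma>\<bar>) * j"
            by (simp add: algebra_simps)
          then show ?thesis using that by (smt (verit) mult_nonneg_nonneg of_nat_0_le_iff)
        qed
        have pr: "0 \<le> p / r" "p / r \<le> 1" using p r by auto
        have "(\<alpha> + j) - p / r * (\<gamma> + j) = \<alpha> - p / r * \<gamma> + (1 - p / r) * j" by (simp add: algebra_simps)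
        moreover have "\<bar>p / r * \<gamma>\<bar> \<le> 1 * \<bar>\<gamma>\<bar>" using pr by (simp only: abs_mult) (intro mult_right_mono, auto)
        moreover have "(1 - p / r) * real j \<le> 1 * real j" using pr by (intro mult_right_mono) auto
        moreover have "0 \<le> (1 - p / r) * real j" using pr by (intro mult_nonneg_nonneg) auto
        ultimately show "\<bar>(\<alpha> + j) - p / r * (\<gamma> + j)\<bar> \<le> (\<bar>\<alpha>\<bar> + \<bar>\<gamma>\<bar> + 1) * (1 + real j)"
          by (intro le) linarith
        show "W / (r * W + \<gamma> + j) \<le> 2 / r" using den[of j] rW r W by (simp add: field_simps)
      qed (use W den[of j] in auto)
      also have "\<dots> = K * (1 + real j)" by (simp add: K_def)
      finally show ?thesis .
    qed
    have "norm ((\<Prod>j<n. \<xi> j) - (\<Prod>j<n. p / r)) \<le> (\<Sum>j<n. norm (\<xi> j - p / r))"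
      by (rule norm_prod_diff) (use \<xi>1 p r in auto)
    then have "W * norm (X n W - (p / r) ^ n) \<le> W * (\<Sum>j<n. norm (\<xi> j - p / r))"
      using W unfolding X by (intro mult_left_mono) auto
    also have "\<dots> \<le> (\<Sum>j<n. K * (1 + real j))"
      unfolding sum_distrib_left by (intro sum_mono \<xi>2)
    also have "\<dots> \<le> (\<Sum>j<n. K * (1 + real n))"
      by (intro sum_mono mult_left_mono) (use r in \<open>auto simp: K_def\<close>)
    also have "\<dots> = K * (real n * (1 + real n))" by simp
    also have "W * norm (X n W - (p / r) ^ n) = \<bar>W * (X n W - (p / r) ^ n)\<bar>"
      using W by (simp only: abs_mult real_norm_def) simp
    finally show ?thesis .
  qed
  define a where "a n W = W * (X n W - (p / r) ^ n) * (\<beta> n * x ^ n)" for n W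
  have sumK: "summable (\<lambda>n. 2 * K * \<bar>hcoef 3 1 1 n * x ^ n\<bar>)"
    by (intro summable_mult summable_hcoef) (use x in auto)
  have "((\<lambda>W. \<Sum>n. a n W) \<longlongrightarrow> (\<Sum>n. (p / r) ^ n * s n * (\<beta> n * x ^ n))) at_top"
  proof (rule tannerys_theorem[THEN conjunct2, THEN conjunct2])
    show "(a k \<longlongrightarrow> (p / r) ^ k * s k * (\<beta> k * x ^ k)) at_top" for k
      unfolding a_def X_def s_def
      by (intro tendsto_intros pochhammer_quotient_first_order p r)
    have "eventually (\<lambda>W. \<forall>n. norm (a n W) \<le> 2 * K * \<bar>hcoef 3 1 1 n * x ^ n\<bar>) at_top"
      using ev
    proof eventually_elim
      case (elim W)
      show ?case
      proof
        fix n
        have "norm (a n W) = \<bar>W * (X n W - (p / r) ^ n)\<bar> * (\<bar>\<beta> n\<bar> * x ^ n)"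
          using x by (simp add: a_def abs_mult)
        also have "\<dots> \<le> (K * (real n * (1 + real n))) * (1 * x ^ n)"
          using bd[OF elim, of n] pochhammer_half_le[of n] x unfolding \<beta>_def
          by (intro mult_mono) auto
        also have "\<dots> \<le> (K * ((real n + 2) * (real n + 1))) * x ^ n"
        proof -
          have "K \<ge> 0" using r by (simp add: K_def)
          moreover have "real n * (1 + real n) \<le> (real n + 2) * (real n + 1)" by (intro mult_mono) auto
          ultimately show ?thesis unfolding mult_1 using x by (intro mult_right_mono mult_left_mono) auto
        qed
        also have "\<dots> = 2 * K * \<bar>hcoef 3 1 1 n * x ^ n\<bar>"
          using x by (simp add: hcoef_311 abs_mult)
        finally show "norm (a n W) \<le> 2 * K * \<bar>hcoef 3 1 1 n * x ^ n\<bar>" .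
      qed
    qed
    then show "eventually (\<lambda>(n, W). norm (a n W) \<le> 2 * K * \<bar>hcoef 3 1 1 n * x ^ n\<bar>) (at_top \<times>\<^sub>F at_top)"
      unfolding eventually_prod_filter by (intro exI[of _ "\<lambda>_. True"] exI[of _ "\<lambda>W. \<forall>n. norm (a n W) \<le> 2 * K * \<bar>hcoef 3 1 1 n * x ^ n\<bar>"]) auto
  qed (use sumK in auto)
  also have "(\<Sum>n. (p / r) ^ n * s n * (\<beta> n * x ^ n)) =
     (\<alpha> / p - \<gamma> / r) * (1 / 2 * y * (1 - y) powr (- (1 / 2) - 1)) +
     ((1 / p - 1 / r) / 2) * (1 / 2 * (1 / 2 + 1) * y\<^sup>2 * (1 - y) powr (- (1 / 2) - 2))"
  proof (rule sums_unique[symmetric])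
    \<comment> \<open>The coefficient is rewritten in the basis n, n (n - 1), for which the sums are
      known.\<close>
    have "2 * s n = 2 * (\<alpha> / p - \<gamma> / r) * n + (1 / p - 1 / r) * (real n * (real n - 1))" for n
    proof (induction n)
      case (Suc n)
      have "2 * s (Suc n) = 2 * s n + 2 * ((\<alpha> + real n) / p - (\<gamma> + real n) / r)" by (simp add: s_def)
      then show ?case unfolding Suc.IH by (simp add: divide_inverse algebra_simps)
    qed (simp add: s_def)
    then have s: "s n = (\<alpha> / p - \<gamma> / r) * n + ((1 / p - 1 / r) / 2) * (real n * (real n - 1))" for n
      by (metis (no_types, opaque_lifting) mult.assoc nonzero_mult_div_cancel_left add_divide_distrib times_divide_eq_left zero_neq_numeral)
    have "(p / r) ^ n * s n * (\<beta> n * x ^ n) = (\<alpha> / p - \<gamma> / r) * (real n * (\<beta> n * y ^ n)) +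
      ((1 / p - 1 / r) / 2) * (real n * (real n - 1) * (\<beta> n * y ^ n))" for n
    proof -
      have "y ^ n = (p / r) ^ n * x ^ n" by (simp add: y_def flip: power_mult_distrib)
      then have "(p / r) ^ n * s n * (\<beta> n * x ^ n) = s n * (\<beta> n * y ^ n)" by simp
      then show ?thesis by (simp only: s distrib_right mult.assoc)
    qed
    then show "(\<lambda>n. (p / r) ^ n * s n * (\<beta> n * x ^ n)) sums
     ((\<alpha> / p - \<gamma> / r) * (1 / 2 * y * (1 - y) powr (- (1 / 2) - 1)) +
     ((1 / p - 1 / r) / 2) * (1 / 2 * (1 / 2 + 1) * y\<^sup>2 * (1 - y) powr (- (1 / 2) - 2)))"
      unfolding \<beta>_def
      by (simp only:) (intro sums_add sums_mult negative_binomial_moment1 negative_binomial_moment2 ay)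
  qed
  also have "\<dots> = (1 - y) powr (-1/2) * ((\<alpha> / p - \<gamma> / r) * t / 2 + (1 / p - 1 / r) * (3 / 8) * t\<^sup>2)"
  proof -
    have "(1 - y) powr (- (1 / 2) - 1) = (1 - y) powr (-1/2) / (1 - y)"
      using powr_diff[of "1 - y" "-1/2" 1] y by simp
    then have 1: "1 / 2 * y * (1 - y) powr (- (1 / 2) - 1) = (1 - y) powr (-1/2) * (t / 2)"
      unfolding t_def by (simp only:) (simp only: divide_inverse mult_ac)
    have "(1 - y) powr (- (1 / 2) - 2) = (1 - y) powr (-1/2) / (1 - y)\<^sup>2"
      using powr_diff[of "1 - y" "-1/2" 2] y by simp
    then have 2: "1 / 2 * (1 / 2 + 1) * y\<^sup>2 * (1 - y) powr (- (1 / 2) - 2) = (1 - y) powr (-1/2) * (3 / 4 * t\<^sup>2)"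
      by (simp add: t_def power_divide)
    have alg: "A * (Q * (t / 2)) + B / 2 * (Q * (3 / 4 * t2)) = Q * (A * t / 2 + B * (3 / 8) * t2)" for A B Q t2 :: real
      by (simp add: field_simps)
    show ?thesis unfolding 1 2 by (rule alg)
  qed
  finally have "((\<lambda>W. (\<Sum>n. a n W) / (1 - y) powr (-1/2)) \<longlongrightarrow>
     (1 - y) powr (-1/2) * ((\<alpha> / p - \<gamma> / r) * t / 2 + (1 / p - 1 / r) * (3 / 8) * t\<^sup>2) / (1 - y) powr (-1/2)) at_top"
    by (rule tendsto_divide[OF _ tendsto_const]) (use c0 in simp)
  moreover have eqW: "(\<Sum>n. a n W) / (1 - y) powr (-1/2) = W * (rhyp (p * W + \<alpha>) (1/2) (r * W + \<gamma>) x / (1 - y) powr (-1/2) - 1)" for W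
  proof -
    have "(\<lambda>n. hcoef (p * W + \<alpha>) (1/2) (r * W + \<gamma>) n * x ^ n) sums rhyp (p * W + \<alpha>) (1/2) (r * W + \<gamma>) x"
      by (rule rhyp_sums) (use x in simp)
    moreover have "(\<lambda>n. \<beta> n * y ^ n) sums (1 - y) powr (-1/2)"
      using negative_binomial_sums[OF ay, of "1/2"] by (simp add: \<beta>_def)
    ultimately have "(\<lambda>n. W * (hcoef (p * W + \<alpha>) (1/2) (r * W + \<gamma>) n * x ^ n - \<beta> n * y ^ n)) sums
       (W * (rhyp (p * W + \<alpha>) (1/2) (r * W + \<gamma>) x - (1 - y) powr (-1/2)))"
      by (intro sums_mult sums_diff)
    also have "(\<lambda>n. W * (hcoef (p * W + \<alpha>) (1/2) (r * W + \<gamma>) n * x ^ n - \<beta> n * y ^ n)) = (\<lambda>n. a n W)"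
    proof
      fix n
      have "hcoef (p * W + \<alpha>) (1/2) (r * W + \<gamma>) n = X n W * \<beta> n" by (simp add: hcoef_def X_def \<beta>_def)
      moreover have "y ^ n = (p / r) ^ n * x ^ n" by (simp add: y_def flip: power_mult_distrib)
      ultimately show "W * (hcoef (p * W + \<alpha>) (1/2) (r * W + \<gamma>) n * x ^ n - \<beta> n * y ^ n) = a n W"
        unfolding a_def by (simp only:) (simp add: algebra_simps)
    qed
    finally show ?thesis using c0 by (simp add: sums_iff field_simps)
  qed
  ultimately show ?thesis using c0 by (simp only: eqW nonzero_mult_div_cancel_left less_imp_neq[THEN not_sym] simp_thms)
qed

subsection \<open>Second-order expansions and slowly varying sequences\<close>

text \<open>\<open>g W = exp (a / W + b / W\<^sup>2 + o(1 / W\<^sup>2))\<close> as \<open>W\<close> tends to infinity; taking logarithmic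
  coordinates makes \<open>(a, b)\<close> additive under multiplication.\<close>
definition log_expansion :: "(real \<Rightarrow> 'a :: real_normed_field) \<Rightarrow> 'a \<Rightarrow> 'a \<Rightarrow> bool" where
  "log_expansion g a b \<longleftrightarrow>
     ((\<lambda>W. of_real W ^ 2 * (g W - 1 - a / of_real W)) \<longlongrightarrow> b + a ^ 2 / 2) at_top"

lemma tendsto_inverse_of_real_at_top:
  "((\<lambda>W. inverse (of_real W :: 'a :: real_normed_field)) \<longlongrightarrow> 0) at_top"
  using tendsto_of_real[OF tendsto_inverse_0_at_top[OF filterlim_ident], where 'a = 'a] by simp

lemma eventually_of_real_neq_0: "eventually (\<lambda>W. of_real W \<noteq> (0 :: 'a :: real_normed_field)) at_top"
  using eventually_gt_at_top[of 0] by eventually_elim simp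

lemma log_expansion_first:
  fixes g :: "real \<Rightarrow> 'a :: real_normed_field"
  assumes "log_expansion g a b"
  shows "((\<lambda>W. of_real W * (g W - 1)) \<longlongrightarrow> a) at_top"
proof -
  have "((\<lambda>W. inverse (of_real W) * (of_real W ^ 2 * (g W - 1 - a / of_real W)) + a) \<longlongrightarrow> 0 * (b + a ^ 2 / 2) + a) at_top"
    using assms unfolding log_expansion_def
    by (intro tendsto_add tendsto_mult tendsto_inverse_of_real_at_top tendsto_const)
  moreover have "eventually (\<lambda>W. inverse (of_real W) * (of_real W ^ 2 * (g W - 1 - a / of_real W)) + a = of_real W * (g W - 1)) at_top"
    using eventually_of_real_neq_0 by eventually_elim (simp add: power2_eq_square field_simps)
  ultimately show ?thesis by (simp add: Lim_transform_eventually)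
qed

lemma log_expansion_tendsto:
  fixes g :: "real \<Rightarrow> 'a :: real_normed_field"
  assumes "log_expansion g a b"
  shows "(g \<longlongrightarrow> 1) at_top"
proof -
  have "((\<lambda>W. inverse (of_real W) * (of_real W * (g W - 1)) + 1) \<longlongrightarrow> 0 * a + 1) at_top"
    by (intro tendsto_add tendsto_mult tendsto_inverse_of_real_at_top tendsto_const log_expansion_first[OF assms])
  moreover have "eventually (\<lambda>W. inverse (of_real W) * (of_real W * (g W - 1)) + 1 = g W) at_top"
    using eventually_of_real_neq_0 by eventually_elim (simp add: field_simps)
  ultimately show ?thesis by (simp add: Lim_transform_eventually)
qed

lemma log_expansion_second:
  fixes g :: "real \<Rightarrow> 'a :: real_normed_field"
  assumes "log_expansion g 0 b"
  shows "((\<lambda>W. of_real W ^ 2 * (g W - 1)) \<longlongrightarrow> b) at_top"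
  using assms by (simp add: log_expansion_def)

lemma log_expansion_cong:
  assumes "log_expansion g a b" "eventually (\<lambda>W. g W = h W) at_top" "a = a'" "b = b'"
  shows "log_expansion h a' b'"
  using assms(1) unfolding log_expansion_def assms(3,4)[symmetric]
  by (rule Lim_transform_eventually) (use assms(2) in \<open>eventually_elim, simp\<close>)

lemma log_expansion_1: "log_expansion (\<lambda>_. 1) 0 0"
  by (simp add: log_expansion_def)

lemma log_expansion_linear:
  "log_expansion (\<lambda>W. (of_real W + A) / of_real W :: 'a :: real_normed_field) A (- (A ^ 2) / 2)"
proof -
  have "eventually (\<lambda>W. 0 = of_real W ^ 2 * ((of_real W + A) / of_real W - 1 - A / of_real W)) at_top"
    using eventually_of_real_neq_0[where 'a = 'a] by eventually_elim (simp add: field_simps)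
  from Lim_transform_eventually[OF tendsto_const this] show ?thesis
    by (simp add: log_expansion_def)
qed

lemma log_expansion_mult:
  fixes g h :: "real \<Rightarrow> 'a :: real_normed_field"
  assumes "log_expansion g a b" "log_expansion h c d"
  shows "log_expansion (\<lambda>W. g W * h W) (a + c) (b + d)"
proof -
  have lim: "((\<lambda>W. (of_real W ^ 2 * (g W - 1 - a / of_real W)) * h W
     + (1 + a * inverse (of_real W)) * (of_real W ^ 2 * (h W - 1 - c / of_real W)) + a * c)
     \<longlongrightarrow> (b + a ^ 2 / 2) * 1 + (1 + a * 0) * (d + c ^ 2 / 2) + a * c) at_top"
    using assms log_expansion_tendsto[OF assms(2)] unfolding log_expansion_def
    by (intro tendsto_add tendsto_mult tendsto_inverse_of_real_at_top tendsto_const)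
  have eq: "(b + a ^ 2 / 2) * 1 + (1 + a * 0) * (d + c ^ 2 / 2) + a * c = (b + d) + (a + c) ^ 2 / 2"
    by (simp add: power2_sum field_simps)
  have ev: "eventually (\<lambda>W. (of_real W ^ 2 * (g W - 1 - a / of_real W)) * h W
     + (1 + a * inverse (of_real W)) * (of_real W ^ 2 * (h W - 1 - c / of_real W)) + a * c
     = of_real W ^ 2 * (g W * h W - 1 - (a + c) / of_real W)) at_top"
    using eventually_of_real_neq_0[where 'a = 'a]
    by eventually_elim (simp add: power2_eq_square field_simps)
  from Lim_transform_eventually[OF lim ev] show ?thesis unfolding log_expansion_def eq .
qed

lemma log_expansion_inverse:
  fixes g :: "real \<Rightarrow> 'a :: real_normed_field"
  assumes "log_expansion g a b"
  shows "log_expansion (\<lambda>W. inverse (g W)) (- a) (- b)"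
proof -
  have lim: "((\<lambda>W. (- (of_real W ^ 2 * (g W - 1 - a / of_real W)) + a * (of_real W * (g W - 1))) / g W)
     \<longlongrightarrow> (- (b + a ^ 2 / 2) + a * a) / 1) at_top"
    using assms log_expansion_tendsto[OF assms] log_expansion_first[OF assms] unfolding log_expansion_def
    by (intro tendsto_add tendsto_mult tendsto_divide tendsto_minus tendsto_const) auto
  have eq: "(- (b + a ^ 2 / 2) + a * a) / 1 = - b + (- a) ^ 2 / 2"
    by (simp add: power2_eq_square field_simps)
  have "eventually (\<lambda>W. g W \<noteq> 0) at_top"
    using log_expansion_tendsto[OF assms] by (rule tendsto_imp_eventually_ne) simp
  then have ev: "eventually (\<lambda>W. (- (of_real W ^ 2 * (g W - 1 - a / of_real W)) + a * (of_real W * (g W - 1))) / g W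
     = of_real W ^ 2 * (inverse (g W) - 1 - (- a) / of_real W)) at_top"
    using eventually_of_real_neq_0[where 'a = 'a]
    by eventually_elim (simp add: power2_eq_square field_simps)
  from Lim_transform_eventually[OF lim ev] show ?thesis unfolding log_expansion_def eq .
qed

lemma log_expansion_divide:
  fixes g h :: "real \<Rightarrow> 'a :: real_normed_field"
  assumes "log_expansion g a b" "log_expansion h c d"
  shows "log_expansion (\<lambda>W. g W / h W) (a - c) (b - d)"
  using log_expansion_mult[OF assms(1) log_expansion_inverse[OF assms(2)]] by (simp add: divide_inverse)

lemma log_expansion_prod:
  fixes g :: "'i \<Rightarrow> real \<Rightarrow> 'a :: real_normed_field"
  assumes "\<And>i. i \<in> I \<Longrightarrow> log_expansion (g i) (a i) (b i)"
  shows "log_expansion (\<lambda>W. \<Prod>i\<in>I. g i W) (\<Sum>i\<in>I. a i) (\<Sum>i\<in>I. b i)"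
  using assms
  by (induction I rule: infinite_finite_induct) (auto intro: log_expansion_1 log_expansion_mult)

lemma log_expansion_prod_linear:
  fixes A :: "nat \<Rightarrow> 'a :: real_normed_field"
  shows "log_expansion (\<lambda>W. (\<Prod>i<n. of_real W + A i) / of_real W ^ n) (\<Sum>i<n. A i) (- (\<Sum>i<n. A i ^ 2) / 2)"
  using log_expansion_prod[where I = "{..<n}" and a = A, OF log_expansion_linear]
  by (simp add: prod_dividef sum_negf flip: sum_divide_distrib)

text \<open>Half the sum of the squares of the N shifts (\<open>\<beta>\<close> + i) / N for i from
  1 to N, in closed form. Its negative is the 1/W^2 coefficient of the logarithm of the product of
  the factors 1 + (\<open>\<beta>\<close> + i) / (N W).\<close>

definition arith_prod_coeff :: "nat \<Rightarrow> real \<Rightarrow> real" where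
  "arith_prod_coeff N \<beta> = (\<beta>\<^sup>2 + \<beta> * (real N + 1) + (real N + 1) * (2 * real N + 1) / 6) / (2 * real N)"

lemma log_expansion_arith_prod:
  assumes "N > 0"
  shows "log_expansion (\<lambda>W. (\<Prod>i<N. real N * W + \<beta> + (real i + 1)) / (real N * W) ^ N)
    (\<beta> + (real N + 1) / 2) (- arith_prod_coeff N \<beta>)"
proof (rule log_expansion_cong[OF log_expansion_prod_linear[where n = N and A = "\<lambda>i. (\<beta> + (real i + 1)) / real N"]])
  have N: "real N > 0" using assms by simp
  have "(\<Prod>i<N. real N * W + \<beta> + (real i + 1)) = real N ^ N * (\<Prod>i<N. W + (\<beta> + (real i + 1)) / N)" for W
  proof -
    have "(\<Prod>i<N. real N * W + \<beta> + (real i + 1)) = (\<Prod>i<N. real N * (W + (\<beta> + (real i + 1)) / N))"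
      using N by (intro prod.cong refl) (simp add: field_simps)
    then show ?thesis by (simp add: prod.distrib)
  qed
  then show "\<forall>\<^sub>F W in at_top. (\<Prod>i<N. of_real W + (\<beta> + (real i + 1)) / N) / of_real W ^ N =
    (\<Prod>i<N. real N * W + \<beta> + (real i + 1)) / (real N * W) ^ N"
    using N by (simp add: power_mult_distrib)
  have s1: "(\<Sum>i<n. real i + 1) = real n * (real n + 1) / 2" for n
    by (induction n) (auto simp: field_simps)
  have s2: "(\<Sum>i<n. (real i + 1) ^ 2) = real n * (real n + 1) * (2 * real n + 1) / 6" for n
    by (induction n) (auto simp: field_simps power2_eq_square)
  show "(\<Sum>i<N. (\<beta> + (real i + 1)) / N) = \<beta> + (real N + 1) / 2"
  proof -
    have "(\<Sum>i<N. (\<beta> + (real i + 1)) / N) = (N * \<beta> + (\<Sum>i<N. real i + 1)) / N"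
      by (simp only: sum.distrib sum_constant card_lessThan flip: sum_divide_distrib)
    also have "\<dots> = \<beta> + (real N + 1) / 2" unfolding s1 using N by (simp add: add_divide_distrib)
    finally show ?thesis .
  qed
  have "(\<Sum>i<N. (\<beta> + (real i + 1)) ^ 2) = (\<Sum>i<N. \<beta>\<^sup>2 + 2 * \<beta> * (real i + 1) + (real i + 1) ^ 2)"
    by (intro sum.cong refl) (simp add: power2_eq_square algebra_simps)
  also have "\<dots> = N * \<beta>\<^sup>2 + 2 * \<beta> * (\<Sum>i<N. real i + 1) + (\<Sum>i<N. (real i + 1) ^ 2)"
  proof -
    have "(\<Sum>i<N. \<beta>\<^sup>2 + 2 * \<beta> * g i + g i ^ 2) = N * \<beta>\<^sup>2 + 2 * \<beta> * (\<Sum>i<N. g i) + (\<Sum>i<N. g i ^ 2)"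
      for g :: "nat \<Rightarrow> real"
      by (simp add: sum.distrib sum_distrib_left)
    then show ?thesis .
  qed
  also have "\<dots> = 2 * N\<^sup>2 * arith_prod_coeff N \<beta>"
    unfolding s1 s2 arith_prod_coeff_def using N by (simp add: power2_eq_square field_simps)
  finally have s3: "(\<Sum>i<N. (\<beta> + (real i + 1)) ^ 2) = 2 * (real N)\<^sup>2 * arith_prod_coeff N \<beta>" by simp
  show "- (\<Sum>i<N. ((\<beta> + (real i + 1)) / N)\<^sup>2) / 2 = - arith_prod_coeff N \<beta>"
    unfolding power_divide sum_divide_distrib[symmetric] s3 using N by simp
qed

text \<open>Divergence of the harmonic series excludes steps of exact order \<open>1 / k\<close>.\<close>
lemma convergent_step_limit_real:
  fixes E :: "nat \<Rightarrow> real"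
  assumes "convergent E" and lim: "(\<lambda>k. (u + real k) * (E (Suc k) - E k)) \<longlonglongrightarrow> l"
  shows "l = 0"
proof (rule ccontr)
  assume "l \<noteq> 0"
  have sm: "summable (\<lambda>k. E (Suc k) - E k)"
    using assms(1) by (auto simp: convergent_def intro: telescope_summable)
  have "(\<lambda>k. sgn l * ((u + real k) * (E (Suc k) - E k))) \<longlonglongrightarrow> sgn l * l" by (intro tendsto_intros lim)
  then have "eventually (\<lambda>k. sgn l * ((u + real k) * (E (Suc k) - E k)) > \<bar>l\<bar> / 2) sequentially"
    by (rule order_tendstoD) (use \<open>l \<noteq> 0\<close> in \<open>simp add: sgn_mult_self_eq abs_sgn[symmetric] mult.commute\<close>)
  moreover have "eventually (\<lambda>k. u + real k > 0) sequentially" by real_asymp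
  moreover have "eventually (\<lambda>k. u + real k \<le> 2 * real (Suc k)) sequentially" by real_asymp
  ultimately have "eventually (\<lambda>k. norm (inverse (real (Suc k))) \<le> 4 / \<bar>l\<bar> * (sgn l * (E (Suc k) - E k))) sequentially"
  proof eventually_elim
    case (elim k)
    have *: "\<bar>l\<bar> / 2 < (u + real k) * (sgn l * (E (Suc k) - E k))" using elim by (simp add: mult_ac)
    then have "0 < (u + real k) * (sgn l * (E (Suc k) - E k))" using \<open>l \<noteq> 0\<close> by (smt (verit) half_gt_zero zero_less_abs_iff)
    then have "sgn l * (E (Suc k) - E k) > 0" using elim by (simp add: zero_less_mult_iff)
    then have "(u + real k) * (sgn l * (E (Suc k) - E k)) \<le> 2 * real (Suc k) * (sgn l * (E (Suc k) - E k))"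
      using elim by (intro mult_right_mono) auto
    then have "\<bar>l\<bar> / 2 \<le> 2 * real (Suc k) * (sgn l * (E (Suc k) - E k))" using * by linarith
    then show ?case using \<open>l \<noteq> 0\<close> by (simp add: field_simps del: of_nat_Suc)
  qed
  moreover have "summable (\<lambda>k. 4 / \<bar>l\<bar> * (sgn l * (E (Suc k) - E k)))"
    by (intro summable_mult sm)
  ultimately have "summable (\<lambda>k. inverse (real (Suc k)))"
    by (rule summable_comparison_test_ev)
  then show False using not_summable_harmonic[where 'a = real] summable_Suc_iff[of "\<lambda>k. inverse (real k)"] by simp
qed

lemma convergent_step_limit:
  fixes E :: "nat \<Rightarrow> complex"
  assumes "convergent E" and lim: "(\<lambda>k. of_real (u + real k) * (E (Suc k) - E k)) \<longlonglongrightarrow> l"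
  shows "l = 0"
proof (rule complex_eqI)
  obtain L where "E \<longlonglongrightarrow> L" using assms(1) by (auto simp: convergent_def)
  then have c: "convergent (\<lambda>k. Re (E k))" "convergent (\<lambda>k. Im (E k))"
    by (auto simp: convergent_def intro!: tendsto_Re tendsto_Im)
  show "Re l = Re 0" using convergent_step_limit_real[OF c(1), of u "Re l"] tendsto_Re[OF lim] by simp
  show "Im l = Im 0" using convergent_step_limit_real[OF c(2), of u "Im l"] tendsto_Im[OF lim] by simp
qed

text \<open>Formally, Z = c + h / W has steps of size -h / W^2, but an asymptotic relation cannot be
  differenced. Instead E = W (Z - c) converges to h, and W times its step tends to l + h, which must
  vanish by \<open>convergent_step_limit_real\<close>.\<close>

lemma first_order_from_ratio:
  fixes Z :: "nat \<Rightarrow> real"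
  assumes lim: "(\<lambda>k. (u + real k) * (Z k - c)) \<longlonglongrightarrow> h"
    and step: "(\<lambda>k. (u + real k)\<^sup>2 * (Z (Suc k) - Z k)) \<longlonglongrightarrow> l"
  shows "h = - l"
proof -
  define E where "E k = (u + real k) * (Z k - c)" for k
  have E: "E \<longlonglongrightarrow> h" using lim by (simp add: E_def [abs_def])
  have q: "(\<lambda>k. (u + real k + 1) / (u + real k)) \<longlonglongrightarrow> 1" by real_asymp
  have "(\<lambda>k. (u + real k + 1) / (u + real k) * ((u + real k)\<^sup>2 * (Z (Suc k) - Z k)) + E k) \<longlonglongrightarrow> 1 * l + h"
    by (intro tendsto_add tendsto_mult q step E)
  moreover have "eventually (\<lambda>k. u + real k > 0) sequentially" by real_asymp
  then have "eventually (\<lambda>k. (u + real k + 1) / (u + real k) * ((u + real k)\<^sup>2 * (Z (Suc k) - Z k)) + E k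
     = (u + real k) * (E (Suc k) - E k)) sequentially"
  proof eventually_elim
    case (elim k)
    have alg: "(w + 1) / w * (w\<^sup>2 * (z' - z)) + w * (z - c) = w * ((w + 1) * (z' - c) - w * (z - c))"
      if "w > 0" for w z z' :: real
    proof -
      have "(w + 1) / w * (w\<^sup>2 * (z' - z)) = (w + 1) * w * (z' - z)"
        using that by (simp add: power2_eq_square)
      then show ?thesis by (simp add: algebra_simps)
    qed
    show ?case using alg[OF elim, of "Z (Suc k)" "Z k"] by (simp add: E_def add_ac)
  qed
  ultimately have "(\<lambda>k. (u + real k) * (E (Suc k) - E k)) \<longlonglongrightarrow> 1 * l + h"
    by (rule Lim_transform_eventually)
  from convergent_step_limit_real[OF convergentI[OF E] this] show ?thesis by simp
qed

text \<open>Consecutive sines satisfy a linear recurrence with middle coefficient 2 cos(pi p).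
  Dividing by the middle term and passing to the limit gives l + 1/l = 2 cos(pi p); a real l
  satisfies this only if sin(pi p) = 0.\<close>

lemma sin_ratio_limit_imp_Ints:
  fixes p \<theta> l :: real
  assumes lim: "(\<lambda>k. sin (\<theta> + pi * p * real (Suc k)) / sin (\<theta> + pi * p * real k)) \<longlonglongrightarrow> l"
    and "l \<noteq> 0" and nz: "eventually (\<lambda>k. sin (\<theta> + pi * p * real k) \<noteq> 0) sequentially"
  shows "p \<in> \<int>"
proof -
  define s where "s k = sin (\<theta> + pi * p * real k)" for k
  have rec: "s (Suc (Suc k)) + s k = 2 * cos (pi * p) * s (Suc k)" for k
  proof -
    have "\<theta> + pi * p * real (Suc (Suc k)) = (\<theta> + pi * p * real (Suc k)) + pi * p"
      "\<theta> + pi * p * real k = (\<theta> + pi * p * real (Suc k)) - pi * p" by (simp_all add: algebra_simps)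
    then show ?thesis unfolding s_def by (simp only: sin_add sin_diff) simp
  qed
  have lim': "(\<lambda>k. s (Suc k) / s k) \<longlonglongrightarrow> l" using lim by (simp add: s_def)
  have "(\<lambda>k. s (Suc (Suc k)) / s (Suc k) + inverse (s (Suc k) / s k)) \<longlonglongrightarrow> l + inverse l"
    using lim' \<open>l \<noteq> 0\<close> by (intro tendsto_intros LIMSEQ_Suc[OF lim']) auto
  moreover have nz': "eventually (\<lambda>k. s k \<noteq> 0) sequentially" using nz by (simp add: s_def)
  then have "eventually (\<lambda>k. s (Suc k) \<noteq> 0) sequentially" by (subst eventually_sequentially_Suc[of "\<lambda>k. s k \<noteq> 0"])
  then have "eventually (\<lambda>k. s (Suc (Suc k)) / s (Suc k) + inverse (s (Suc k) / s k) = 2 * cos (pi * p)) sequentially"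
    by eventually_elim (use rec in \<open>simp add: field_simps\<close>)
  ultimately have "(\<lambda>k. 2 * cos (pi * p)) \<longlonglongrightarrow> l + inverse l"
    by (rule Lim_transform_eventually)
  then have e: "l + inverse l = 2 * cos (pi * p)" by (simp add: LIMSEQ_const_iff)
  have "l\<^sup>2 + 1 = 2 * cos (pi * p) * l" using arg_cong[OF e, of "\<lambda>t. t * l"] \<open>l \<noteq> 0\<close>
    by (simp add: algebra_simps power2_eq_square)
  then have "(l - cos (pi * p))\<^sup>2 + sin (pi * p) ^ 2 = 0"
    using sin_cos_squared_add[of "pi * p"] unfolding power2_diff mult.assoc mult.commute[of l] by linarith
  then have "sin (pi * p) = 0" by (simp add: sum_power2_eq_zero_iff)
  then show ?thesis by (auto simp: sin_zero_iff_int2 mult.commute)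
qed

section \<open>Growth of the gamma function under a fixed real shift\<close>

lemma Gamma_real_plus1: "W > 0 \<Longrightarrow> Gamma (W + 1) = W * Gamma (W :: real)"
  using nonpos_Ints_nonpos[of W] by (intro Gamma_plus1) auto

lemma Gamma_shift_le:
  fixes W s :: real
  assumes "W > 0" "0 \<le> s" "s \<le> 1"
  shows "Gamma (W + s) \<le> Gamma W * W powr s"
proof -
  have "(ln \<circ> Gamma) ((1 - s) *\<^sub>R W + s *\<^sub>R (W + 1)) \<le> (1 - s) * (ln \<circ> Gamma) W + s * (ln \<circ> Gamma) (W + 1)"
    by (rule convex_onD[OF log_convex_Gamma_real]) (use assms in auto)
  also have "(1 - s) *\<^sub>R W + s *\<^sub>R (W + 1) = W + s" by (simp add: algebra_simps)
  also have "(1 - s) * (ln \<circ> Gamma) W + s * (ln \<circ> Gamma) (W + 1) = ln (Gamma W * W powr s)"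
  proof -
    have "Gamma (W + 1) = W * Gamma W" "Gamma W \<noteq> 0"
      using assms Gamma_real_pos[of W] by (simp_all add: Gamma_real_plus1 less_imp_neq[THEN not_sym])
    then show ?thesis using assms unfolding o_def by (simp only:) (simp add: ln_mult ln_powr algebra_simps)
  qed
  finally have "ln (Gamma (W + s)) \<le> ln (Gamma W * W powr s)" by simp
  then show ?thesis using assms Gamma_real_pos[of W] Gamma_real_pos[of "W + s"] by simp
qed

text \<open>For shifts s between 0 and 1, log-convexity gives the upper bound at W, and the lower
  bound by the same inequality from W + s to W + 1. The functional equation adds the integer part of
  the shift.\<close>

lemma Gamma_shift_asymp:
  fixes p :: real
  assumes "p \<ge> 0"
  shows "((\<lambda>W. Gamma (W + p) / (Gamma W * W powr p)) \<longlongrightarrow> 1) at_top"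
proof -
  have small: "((\<lambda>W. Gamma (W + s) / (Gamma W * W powr s)) \<longlongrightarrow> 1) at_top" if s: "0 \<le> s" "s \<le> 1" for s :: real
  proof (rule tendsto_sandwich)
    show "((\<lambda>W. (W / (W + s)) powr (1 - s)) \<longlongrightarrow> 1) at_top"
    proof -
      have "((\<lambda>W. W / (W + s)) \<longlongrightarrow> 1) at_top" by real_asymp
      from tendsto_powr[OF this tendsto_const, of "1 - s"] show ?thesis by simp
    qed
    show "eventually (\<lambda>W. Gamma (W + s) / (Gamma W * W powr s) \<le> 1) at_top"
      using eventually_gt_at_top[of 0]
      by eventually_elim (use Gamma_shift_le s Gamma_real_pos in \<open>simp add: divide_le_eq_1\<close>)
    show "eventually (\<lambda>W. (W / (W + s)) powr (1 - s) \<le> Gamma (W + s) / (Gamma W * W powr s)) at_top"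
      using eventually_gt_at_top[of 0]
    proof eventually_elim
      case (elim W)
      have "W * Gamma W = Gamma (W + 1)" using elim by (simp add: Gamma_real_plus1)
      also have "\<dots> = Gamma ((W + s) + (1 - s))" by simp
      also have "\<dots> \<le> Gamma (W + s) * (W + s) powr (1 - s)"
        by (rule Gamma_shift_le) (use elim s in auto)
      finally have 1: "W * Gamma W \<le> Gamma (W + s) * (W + s) powr (1 - s)" .
      have 2: "W powr (1 - s) * W powr s = W" using elim by (simp flip: powr_add)
      have pos: "Gamma W > 0" "W powr s > 0" "(W + s) powr (1 - s) > 0"
        using elim s Gamma_real_pos[of W] by auto
      have "W powr (1 - s) * (Gamma W * W powr s) \<le> Gamma (W + s) * (W + s) powr (1 - s)"
        using 1 2 by (metis mult.assoc mult.commute)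
      then show ?case using pos elim s by (simp add: powr_divide field_simps)
    qed
  qed simp
  have step: "((\<lambda>W. Gamma (W + (q + 1)) / (Gamma W * W powr (q + 1))) \<longlongrightarrow> 1) at_top"
    if IH: "((\<lambda>W. Gamma (W + q) / (Gamma W * W powr q)) \<longlongrightarrow> 1) at_top" and "q \<ge> 0" for q :: real
  proof -
    have "((\<lambda>W. (W + q) / W) \<longlongrightarrow> 1) at_top" by real_asymp
    from tendsto_mult[OF this IH]
    have "((\<lambda>W. (W + q) / W * (Gamma (W + q) / (Gamma W * W powr q))) \<longlongrightarrow> 1) at_top" by simp
    then show ?thesis
    proof (rule Lim_transform_eventually)
      show "eventually (\<lambda>W. (W + q) / W * (Gamma (W + q) / (Gamma W * W powr q)) = Gamma (W + (q + 1)) / (Gamma W * W powr (q + 1))) at_top"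
        using eventually_gt_at_top[of 0]
      proof eventually_elim
        case (elim W)
        have "Gamma (W + q + 1) = (W + q) * Gamma (W + q)"
          using elim \<open>q \<ge> 0\<close> by (intro Gamma_real_plus1) auto
        then show ?case using elim by (simp add: powr_add add.assoc)
      qed
    qed
  qed
  have "((\<lambda>W. Gamma (W + (s + real n)) / (Gamma W * W powr (s + real n))) \<longlongrightarrow> 1) at_top"
    if s: "0 \<le> s" "s \<le> 1" for s n
  proof (induction n)
    case (Suc n)
    then show ?case using step[of "s + real n"] s by (simp add: add_ac)
  qed (use small s in simp)
  from this[of "frac p" "nat \<lfloor>p\<rfloor>"] show ?thesis
    using assms frac_lt_1[of p] by (simp add: frac_def)
qed

subsection \<open>Poles and residues\<close>

text \<open>The entire function \<open>f(w) / \<Gamma>(r w)\<close>, with \<open>rGamma\<close> absorbing the zeros of the denominators.\<close>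
definition regularised :: "real \<Rightarrow> real \<Rightarrow> real \<Rightarrow> real \<Rightarrow> complex \<Rightarrow> complex" where
  "regularised p r a x w = (\<Sum>n. pochhammer (of_real p * w + of_real a) n * rGamma (of_real r * w + of_nat n)
     * (pochhammer (1/2) n / fact n * of_real x ^ n))"

lemma norm_pochhammer_half_le: "norm (pochhammer (1/2) n / fact n :: complex) \<le> 1"
proof -
  have "(pochhammer (1/2) n / fact n :: complex) = of_real (pochhammer (1/2) n / fact n)"
    by (simp add: pochhammer_of_real[symmetric])
  then show ?thesis using pochhammer_half_le[of n] by (simp only: norm_of_real)
qed

text \<open>The quotient of consecutive terms, apart from the last bracket, is (p w + a + n) / (r w
  + n), which tends to 1 uniformly on the disc. The terms are therefore O((\<open>\<theta>\<close>
  x)^n) for any \<open>\<theta>\<close> > 1, and the Weierstrass test applies once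
  \<open>\<theta>\<close> x < 1.\<close>

lemma regularised_uniform_limit:
  assumes x: "0 < x" "x < 1"
  shows "uniform_limit (cball z 1) (\<lambda>n w. \<Sum>j<n. pochhammer (of_real p * w + of_real a) j * rGamma (of_real r * w + of_nat j)
     * (pochhammer (1/2) j / fact j * of_real x ^ j)) (regularised p r a x) sequentially"
proof -
  define g where "g n w = pochhammer (of_real p * w + of_real a) n * rGamma (of_real r * w + of_nat n)" for n and w :: complex
  define M where "M = (\<bar>p\<bar> + \<bar>r\<bar>) * (norm z + 1) + \<bar>a\<bar>"
  \<comment> \<open>The midpoint of 1 and 1 / x, so that \<open>\<theta>\<close> exceeds 1 and
    \<open>\<theta>\<close> x stays below 1.\<close>
  define \<theta> where "\<theta> = (1 + 1 / x) / 2"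
  have \<theta>: "\<theta> > 1" "\<theta> * x < 1" using x by (auto simp: \<theta>_def field_simps)
  have "((\<lambda>i. (M + real i) / (real i - M)) \<longlongrightarrow> 1) sequentially" by real_asymp
  then have "eventually (\<lambda>i. (M + real i) / (real i - M) < \<theta>) sequentially"
    by (rule order_tendstoD) (use \<theta> in auto)
  moreover have "eventually (\<lambda>i. real i > M) sequentially" by real_asymp
  ultimately have "eventually (\<lambda>i. (M + real i) / (real i - M) < \<theta> \<and> real i > M) sequentially"
    by eventually_elim auto
  then obtain J where J: "\<And>i. i \<ge> J \<Longrightarrow> (M + real i) / (real i - M) < \<theta>" "\<And>i. i \<ge> J \<Longrightarrow> real i > M"
    by (auto simp: eventually_sequentially)
  have nw: "norm w \<le> norm z + 1" if "w \<in> cball z 1" for w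
    using that norm_triangle_sub[of w z] by (simp add: dist_norm norm_minus_commute)
  have M1: "norm (of_real p * w + of_real a) \<le> M" "norm (of_real r * w) \<le> M" if "w \<in> cball z 1" for w
  proof -
    have 1: "\<bar>p\<bar> * norm w \<le> \<bar>p\<bar> * (norm z + 1)" "\<bar>r\<bar> * norm w \<le> \<bar>r\<bar> * (norm z + 1)"
      using nw[OF that] by (intro mult_left_mono; simp)+
    have 2: "0 \<le> \<bar>p\<bar> * (norm z + 1)" "0 \<le> \<bar>r\<bar> * (norm z + 1)" by simp_all
    have "norm (of_real p * w + of_real a) \<le> \<bar>p\<bar> * norm w + \<bar>a\<bar>"
      using norm_triangle_ineq[of "of_real p * w" "of_real a"] by (simp add: norm_mult)
    then show "norm (of_real p * w + of_real a) \<le> M" using 1 2 unfolding M_def distrib_right by linarith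
    have "norm (of_real r * w) = \<bar>r\<bar> * norm w" by (simp add: norm_mult)
    then show "norm (of_real r * w) \<le> M" using 1 2 unfolding M_def distrib_right by linarith
  qed
  have step: "norm (g (Suc n) w) \<le> \<theta> * norm (g n w)" if "w \<in> cball z 1" "n \<ge> J" for n w
  proof -
    let ?C = "of_real r * w + of_nat n"
    have "norm (of_nat n :: complex) \<le> norm ?C + norm (of_real r * w)"
      using norm_triangle_ineq4[of ?C "of_real r * w"] by simp
    then have C: "norm ?C \<ge> real n - M" using M1(2)[OF that(1)] by simp
    then have Cp: "norm ?C > 0" using J(2)[OF that(2)] by linarith
    have A: "norm (of_real p * w + of_real a + of_nat n) \<le> M + real n"
      using norm_triangle_ineq[of "of_real p * w + of_real a" "of_nat n"] M1(1)[OF that(1)] by simp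
    have "?C * g (Suc n) w = (of_real p * w + of_real a + of_nat n) * g n w"
      using rGamma_plus1[of ?C] by (simp add: g_def pochhammer_Suc add_ac mult_ac)
    then have "norm ?C * norm (g (Suc n) w) = norm (of_real p * w + of_real a + of_nat n) * norm (g n w)"
      by (metis norm_mult)
    then have "norm (g (Suc n) w) = norm (of_real p * w + of_real a + of_nat n) / norm ?C * norm (g n w)"
      using Cp by (simp add: field_simps)
    also have "\<dots> \<le> (M + real n) / (real n - M) * norm (g n w)"
      using A C J(2)[OF that(2)] order_trans[OF norm_ge_zero A] by (intro mult_right_mono frac_le) auto
    also have "\<dots> \<le> \<theta> * norm (g n w)" using J(1)[OF that(2)] by (intro mult_right_mono) auto
    finally show ?thesis .
  qed
  have "compact (g J ` cball z 1)" unfolding g_def pochhammer_conv_prod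
    by (intro compact_continuous_image holomorphic_on_imp_continuous_on holomorphic_intros) auto
  then obtain B where B: "\<And>w. w \<in> cball z 1 \<Longrightarrow> norm (g J w) \<le> B"
    using compact_imp_bounded bounded_iff by (metis imageI)
  have bd: "norm (g (J + n) w) \<le> \<theta> ^ n * B" if "w \<in> cball z 1" for n w
  proof (induction n)
    case (Suc n)
    have "norm (g (J + Suc n) w) \<le> \<theta> * norm (g (J + n) w)" using step[OF that, of "J + n"] by simp
    also have "\<dots> \<le> \<theta> * (\<theta> ^ n * B)" using Suc \<theta> by (intro mult_left_mono) auto
    finally show ?case by (simp add: mult_ac)
  qed (use B that in simp)
  have bd': "norm (g n w) \<le> B / \<theta> ^ J * \<theta> ^ n" if "w \<in> cball z 1" "n \<ge> J" for n w
  proof -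
    have "norm (g n w) \<le> \<theta> ^ (n - J) * B" using bd[OF that(1), of "n - J"] that by simp
    also have "\<dots> = B / \<theta> ^ J * \<theta> ^ n" using \<theta> that by (simp add: power_diff field_simps)
    finally show ?thesis .
  qed
  show ?thesis
    unfolding regularised_def g_def[symmetric]
  proof (rule Weierstrass_m_test_ev)
    show "summable (\<lambda>n. B / \<theta> ^ J * (\<theta> * x) ^ n)"
      using \<theta> x by (intro summable_mult summable_geometric) (auto simp: abs_mult)
    show "eventually (\<lambda>n. \<forall>w\<in>cball z 1. norm (g n w * (pochhammer (1/2) n / fact n * of_real x ^ n)) \<le> B / \<theta> ^ J * (\<theta> * x) ^ n) sequentially"
      using eventually_ge_at_top[of J]
    proof eventually_elim
      case (elim n)
      show ?case
      proof
        fix w assume w: "w \<in> cball z 1"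
        have "norm (g n w * (pochhammer (1/2) n / fact n * of_real x ^ n))
           = norm (g n w) * (norm (pochhammer (1/2) n / fact n :: complex) * x ^ n)"
          by (simp only: norm_mult norm_power norm_of_real abs_of_pos[OF x(1)])
        also have "\<dots> \<le> (B / \<theta> ^ J * \<theta> ^ n) * (1 * x ^ n)"
          using bd'[OF w elim] norm_pochhammer_half_le x order_trans[OF norm_ge_zero bd'[OF w elim]] by (intro mult_mono) auto
        finally show "norm (g n w * (pochhammer (1/2) n / fact n * of_real x ^ n)) \<le> B / \<theta> ^ J * (\<theta> * x) ^ n"
          by (simp add: power_mult_distrib mult_ac)
      qed
    qed
  qed
qed

lemma regularised_sums:
  assumes "0 < x" "x < 1"
  shows "(\<lambda>n. pochhammer (of_real p * w + of_real a) n * rGamma (of_real r * w + of_nat n)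
     * (pochhammer (1/2) n / fact n * of_real x ^ n)) sums regularised p r a x w"
  unfolding sums_def
  by (rule tendsto_uniform_limitI[OF regularised_uniform_limit[OF assms, where z = w]]) simp

lemma regularised_holomorphic:
  assumes "0 < x" "x < 1"
  shows "regularised p r a x holomorphic_on UNIV"
proof (rule holomorphic_uniform_sequence)
  show "(\<lambda>w. \<Sum>j<n. pochhammer (of_real p * w + of_real a) j * rGamma (of_real r * w + of_nat j)
     * (pochhammer (1/2) j / fact j * of_real x ^ j)) holomorphic_on UNIV" for n
    unfolding pochhammer_conv_prod by (intro holomorphic_intros) auto
qed (use regularised_uniform_limit[OF assms] in \<open>auto intro!: exI[of _ 1]\<close>)

lemma fHyp_eq_regularised:
  assumes x: "0 < x" "x < 1" and w: "of_real r * w \<notin> \<int>\<^sub>\<le>\<^sub>0"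
  shows "fHyp p 0 r a (1/2) x w = Gamma (of_real r * w) * regularised p r a x w"
proof -
  let ?A = "of_real p * w + of_real a" and ?C = "of_real r * w"
  have "(\<lambda>n. Gamma ?C * (pochhammer ?A n * rGamma (?C + of_nat n) * (pochhammer (1/2) n / fact n * of_real x ^ n)))
     sums (Gamma ?C * regularised p r a x w)"
    by (intro sums_mult regularised_sums x)
  moreover have "Gamma ?C * (pochhammer ?A n * rGamma (?C + of_nat n) * (pochhammer (1/2) n / fact n * of_real x ^ n))
     = pochhammer ?A n * pochhammer (1/2) n / (pochhammer ?C n * fact n) * of_real x ^ n" for n
  proof -
    have nz: "pochhammer ?C n \<noteq> 0" using w by (auto simp: pochhammer_eq_0_iff)
    have "Gamma ?C * rGamma ?C = 1" using w by (simp add: rGamma_inverse_Gamma Gamma_eq_zero_iff)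
    then have "Gamma ?C * (pochhammer ?C n * rGamma (?C + of_nat n)) = 1"
      by (simp flip: pochhammer_rGamma)
    then have "Gamma ?C * rGamma (?C + of_nat n) = 1 / pochhammer ?C n" using nz by (simp add: field_simps)
    moreover have "Gamma ?C * (pochhammer ?A n * rGamma (?C + of_nat n) * (pochhammer (1/2) n / fact n * of_real x ^ n))
       = Gamma ?C * rGamma (?C + of_nat n) * (pochhammer ?A n * (pochhammer (1/2) n / fact n * of_real x ^ n))"
      by (simp only: mult_ac)
    ultimately show ?thesis by simp
  qed
  ultimately show ?thesis by (simp add: fHyp_def hyp2F1_def sums_iff)
qed

lemma eventually_not_nonpos_Int:
  fixes w0 :: complex
  assumes "r \<noteq> 0"
  shows "eventually (\<lambda>w. of_real r * w + u \<notin> \<int>\<^sub>\<le>\<^sub>0) (at w0)"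
proof -
  have "eventually (\<lambda>z. z \<notin> \<int>\<^sub>\<le>\<^sub>0 - {of_real r * w0 + u}) (nhds (of_real r * w0 + u))"
  proof -
    have "closed (\<int>\<^sub>\<le>\<^sub>0 - {of_real r * w0 + u} :: complex set)"
      using closed_subset_Ints[of "\<int>\<^sub>\<le>\<^sub>0 - {of_real r * w0 + u}"] nonpos_Ints_subset_Ints by blast
    then have "eventually (\<lambda>z. z \<in> - (\<int>\<^sub>\<le>\<^sub>0 - {of_real r * w0 + u})) (nhds (of_real r * w0 + u))"
      by (intro eventually_nhds_in_open) (auto simp only: open_Compl Compl_iff DiffE singleton_iff)
    then show ?thesis by eventually_elim auto
  qed
  moreover have "filterlim (\<lambda>w. of_real r * w + u) (nhds (of_real r * w0 + u)) (at w0)"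
    by (intro tendsto_intros)
  ultimately have "eventually (\<lambda>w. of_real r * w + u \<notin> \<int>\<^sub>\<le>\<^sub>0 - {of_real r * w0 + u}) (at w0)"
    by (rule eventually_compose_filterlim)
  moreover have "eventually (\<lambda>w. w \<noteq> w0) (at w0)" by (simp add: eventually_at_filter)
  ultimately show ?thesis by eventually_elim (use assms in auto)
qed

lemma eventually_fHyp_eq:
  assumes "0 < x" "x < 1" "r \<noteq> 0"
  shows "eventually (\<lambda>w. fHyp p 0 r a (1/2) x w = Gamma (of_real r * w) * regularised p r a x w) (at w0)"
  using eventually_not_nonpos_Int[OF assms(3), of 0 w0]
  by eventually_elim (simp add: fHyp_eq_regularised assms)

lemma fHyp_tendsto_regular:
  assumes x: "0 < x" "x < 1" "r \<noteq> 0" and w: "of_real r * w0 \<notin> \<int>\<^sub>\<le>\<^sub>0"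
  shows "(fHyp p 0 r a (1/2) x \<longlongrightarrow> Gamma (of_real r * w0) * regularised p r a x w0) (at w0)"
proof -
  have "isCont (regularised p r a x) w0"
    using regularised_holomorphic[OF x(1,2)] holomorphic_on_imp_continuous_on continuous_on_eq_continuous_at open_UNIV by blast
  then have "((\<lambda>w. Gamma (of_real r * w) * regularised p r a x w) \<longlongrightarrow> Gamma (of_real r * w0) * regularised p r a x w0) (at w0)"
    using w by (intro tendsto_intros) (auto simp: isCont_def)
  then show ?thesis by (rule Lim_transform_eventually) (rule eventually_mono[OF eventually_fHyp_eq[OF x, of p a w0]], simp)
qed

text \<open>The simple pole of Gamma at -n, with residue (-1)^n / n!, is scaled by r. If the entire
  factor vanishes at the point it cancels this simple pole, so f has a pole exactly where the entire
  factor is non-zero.\<close>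

lemma fHyp_residue_tendsto:
  assumes x: "0 < x" "x < 1" "r \<noteq> 0" and w: "of_real r * w0 = - of_nat n"
  shows "((\<lambda>w. (w - w0) * fHyp p 0 r a (1/2) x w) \<longlongrightarrow> (-1) ^ n / fact n / of_real r * regularised p r a x w0) (at w0)"
    and "regularised p r a x w0 = 0 \<Longrightarrow> \<exists>l. (fHyp p 0 r a (1/2) x \<longlongrightarrow> l) (at w0)"
proof -
  have fl: "filterlim (\<lambda>w. of_real r * w) (at (- of_nat n)) (at w0)"
    unfolding w[symmetric] using x
    by (intro filterlim_atI tendsto_intros) (auto simp: eventually_at_filter)
  have G: "((\<lambda>w. Gamma (of_real r * w) * (of_real r * w + of_nat n)) \<longlongrightarrow> (-1) ^ n / fact n) (at w0)"
    by (rule filterlim_compose[OF Gamma_residues fl])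
  have rw: "of_real r * w + of_nat n = of_real r * (w - w0)" for w
    using w by (simp add: algebra_simps)
  have G': "((\<lambda>w. Gamma (of_real r * w) * (w - w0)) \<longlongrightarrow> (-1) ^ n / fact n / of_real r) (at w0)"
    using tendsto_divide[OF G tendsto_const[of "of_real r"]] x(3) unfolding rw by (simp add: mult_ac)
  have cont: "isCont (regularised p r a x) w0"
    using regularised_holomorphic[OF x(1,2)] holomorphic_on_imp_continuous_on continuous_on_eq_continuous_at open_UNIV by blast
  have "((\<lambda>w. Gamma (of_real r * w) * (w - w0) * regularised p r a x w) \<longlongrightarrow> (-1) ^ n / fact n / of_real r * regularised p r a x w0) (at w0)"
    using cont by (intro tendsto_mult G') (auto simp: isCont_def)
  then show "((\<lambda>w. (w - w0) * fHyp p 0 r a (1/2) x w) \<longlongrightarrow> (-1) ^ n / fact n / of_real r * regularised p r a x w0) (at w0)"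
    by (rule Lim_transform_eventually) (rule eventually_mono[OF eventually_fHyp_eq[OF x, of p a w0]], simp)
  assume z: "regularised p r a x w0 = 0"
  obtain D where "(regularised p r a x has_field_derivative D) (at w0)"
    using regularised_holomorphic[OF x(1,2)] by (metis UNIV_I field_differentiable_def holomorphic_on_imp_differentiable_at open_UNIV)
  then have "((\<lambda>w. regularised p r a x w / (w - w0)) \<longlongrightarrow> D) (at w0)"
    using z by (simp add: has_field_derivative_iff)
  then have "((\<lambda>w. Gamma (of_real r * w) * (w - w0) * (regularised p r a x w / (w - w0))) \<longlongrightarrow> (-1) ^ n / fact n / of_real r * D) (at w0)"
    by (intro tendsto_mult G')
  moreover have "eventually (\<lambda>w. w \<noteq> w0) (at w0)" by (simp add: eventually_at_filter)
  then have "eventually (\<lambda>w. Gamma (of_real r * w) * (w - w0) * (regularised p r a x w / (w - w0)) = fHyp p 0 r a (1/2) x w) (at w0)"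
    using eventually_fHyp_eq[OF x, of p a w0] by eventually_elim simp
  ultimately show "\<exists>l. (fHyp p 0 r a (1/2) x \<longlongrightarrow> l) (at w0)" using Lim_transform_eventually by blast
qed

lemma fHyp_pole:
  assumes x: "0 < x" "x < 1" "r \<noteq> 0" and pole: "is_pole (fHyp p 0 r a (1/2) x) w0"
  obtains n where "of_real r * w0 = - of_nat n" "regularised p r a x w0 \<noteq> 0"
proof -
  have no: "\<not> (fHyp p 0 r a (1/2) x \<longlongrightarrow> l) (at w0)" for l
    using pole not_tendsto_and_filterlim_at_infinity[of "at w0"] unfolding is_pole_def by auto
  then have "of_real r * w0 \<in> \<int>\<^sub>\<le>\<^sub>0" using fHyp_tendsto_regular[OF x] by blast
  then obtain n where n: "of_real r * w0 = - of_nat n" by (auto elim: nonpos_Ints_cases')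
  then show ?thesis using that fHyp_residue_tendsto(2)[OF x n] no by blast
qed

text \<open>At w = -n / r the reciprocal gamma factors vanish for all indices up to n; re-indexing
  the rest gives a hypergeometric series with parameters \<open>\<alpha>\<close> + n + 1, n + 3/2, n
  + 2. There both upper parameters vary with n. Euler's transformation extracts a power of 1 - x and
  leaves one upper parameter fixed at 1/2, the form covered by
  \<open>hyp_first_order\<close>.\<close>

lemma regularised_at_pole:
  fixes p r a x :: real and n :: nat
  assumes x: "0 < x" "x < 1" "r \<noteq> 0"
  defines "\<alpha> \<equiv> a - p * real n / r"
  shows "regularised p r a x (- of_real (real n / r)) =
    of_real (pochhammer (\<alpha>) (Suc n) * pochhammer (1/2) (Suc n) / fact (Suc n) * x ^ Suc n
      * ((1 - x) powr (- \<alpha> - 1/2 - real n) * rhyp (1 - \<alpha>) (1/2) (real n + 2) x))"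
proof -
  define K where "K = pochhammer (\<alpha>) (Suc n) * pochhammer (1/2) (Suc n) / fact (Suc n) * x ^ Suc n"
  define T :: "nat \<Rightarrow> complex" where "T j = pochhammer (of_real p * (- of_real (real n / r)) + of_real a) j * rGamma (of_real r * (- of_real (real n / r)) + of_nat j)
     * (pochhammer (1/2) j / fact j * of_real x ^ j)" for j
  have T: "T sums regularised p r a x (- of_real (real n / r))"
    unfolding T_def by (rule regularised_sums) (use x in auto)
  have arg: "of_real p * (- of_real (real n / r)) + of_real a = (of_real (\<alpha>) :: complex)"
    "of_real r * (- of_real (real n / r)) = (- of_nat n :: complex)"
    using x by (simp_all add: \<alpha>_def)
  have T0: "T j = 0" if "j < Suc n" for j
  proof -
    have "- of_nat n + of_nat j = (- of_nat (n - j) :: complex)" using that by (simp add: of_nat_diff)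
    then show ?thesis unfolding T_def arg by (simp del: of_nat_diff add: rGamma_eq_zero_iff)
  qed
  have T1: "T (m + Suc n) = of_real (K * (hcoef (\<alpha> + real n + 1) (real n + 3/2) (real n + 2) m * x ^ m))" for m
  proof -
    have "- of_nat n + of_nat (m + Suc n) = (of_nat (Suc m) :: complex)" by simp
    then have G: "rGamma (- of_nat n + of_nat (m + Suc n)) = (of_real (1 / fact m) :: complex)"
      using Gamma_fact[of m, where 'a = complex] by (simp add: rGamma_inverse_Gamma inverse_eq_divide add.commute)
    have f: "fact (Suc n + m) = (fact (Suc n) * pochhammer (real n + 2) m :: real)"
      using pochhammer_product'[of "1::real" "Suc n" m] by (simp add: pochhammer_fact[symmetric] add_ac)
    have "T (m + Suc n) = of_real (pochhammer (\<alpha>) (Suc n + m) * (1 / fact m) * (pochhammer (1/2) (Suc n + m) / fact (Suc n + m) * x ^ (Suc n + m)))"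
      unfolding T_def arg G by (simp add: pochhammer_of_real[symmetric] add.commute)
    also have "pochhammer (\<alpha>) (Suc n + m) * (1 / fact m) * (pochhammer (1/2) (Suc n + m) / fact (Suc n + m) * x ^ (Suc n + m))
      = K * (hcoef (\<alpha> + real n + 1) (real n + 3/2) (real n + 2) m * x ^ m)"
    proof -
      have alg: "(A1 * A2) * (1 / g) * ((B1 * B2) / (F1 * F2) * (X1 * X2)) = (A1 * B1 / F1 * X1) * ((A2 * B2 / (F2 * g)) * X2)"
        for A1 A2 B1 B2 F1 F2 X1 X2 g :: real by (simp add: mult_ac)
      have "\<alpha> + real n + 1 = \<alpha> + real (Suc n)" "real n + 3/2 = 1/2 + real (Suc n)" by simp_all
      then show ?thesis unfolding pochhammer_product' f power_add K_def hcoef_def by (simp only: alg)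
    qed
    finally show ?thesis .
  qed
  have "(\<lambda>m. hcoef (\<alpha> + real n + 1) (real n + 3/2) (real n + 2) m * x ^ m) sums rhyp (\<alpha> + real n + 1) (real n + 3/2) (real n + 2) x"
    by (rule rhyp_sums) (use x in simp)
  from sums_of_real[OF sums_mult[OF this, of K], where 'a = complex]
  have "(\<lambda>m. T (m + Suc n)) sums of_real (K * rhyp (\<alpha> + real n + 1) (real n + 3/2) (real n + 2) x)"
    unfolding T1 .
  then have "T sums of_real (K * rhyp (\<alpha> + real n + 1) (real n + 3/2) (real n + 2) x)"
    using T0 by (subst (asm) sums_iff_shift) simp
  then have reg: "regularised p r a x (- of_real (real n / r)) = of_real (K * rhyp (\<alpha> + real n + 1) (real n + 3/2) (real n + 2) x)"
    using T sums_unique2 by blast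
  have "real n + 2 \<notin> \<int>\<^sub>\<le>\<^sub>0" using nonpos_Ints_nonpos[of "real n + 2"] by auto
  from euler_transformation[OF this, of x "\<alpha> + real n + 1" "real n + 3/2"]
  have E: "(1 - x) powr (\<alpha> + 1/2 + real n) * rhyp (\<alpha> + real n + 1) (real n + 3/2) (real n + 2) x = rhyp (1 - \<alpha>) (1/2) (real n + 2) x"
    using x by (simp add: algebra_simps)
  have "(1 - x) powr (- \<alpha> - 1/2 - real n) * (1 - x) powr (\<alpha> + 1/2 + real n) = 1"
    using x by (subst powr_add[symmetric]) simp
  then have "rhyp (\<alpha> + real n + 1) (real n + 3/2) (real n + 2) x = (1 - x) powr (- \<alpha> - 1/2 - real n) * rhyp (1 - \<alpha>) (1/2) (real n + 2) x"
    unfolding E[symmetric] mult.assoc[symmetric] by simp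
  then show ?thesis unfolding reg K_def by simp
qed

lemma fHyp_of_real:
  assumes "0 < x" "x < 1"
  shows "fHyp p 0 r a (1/2) x (of_real W) = of_real (rhyp (p * W + a) (1/2) (r * W) x)"
proof -
  have "(\<lambda>n. hcoef (p * W + a) (1/2) (r * W) n * x ^ n) sums rhyp (p * W + a) (1/2) (r * W) x"
    by (rule rhyp_sums) (use assms in simp)
  from sums_of_real[OF this, where 'a = complex] show ?thesis
    by (simp add: fHyp_def hyp2F1_def hcoef_def sums_iff pochhammer_of_real[symmetric])
qed

section \<open>The functional equation and its progression of poles\<close>

text \<open>The equation is stated without quotients, so zeros of f and of the factors w + v j are
  allowed. At the points where w + v j is a nonpositive integer the reciprocal of Gamma is
  \<open>rGamma\<close>, with value 0, and the shift rule for \<open>rGamma\<close> holds there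
  too.\<close>

lemma solution_I_functional_equation:
  assumes "solution_I p q r a b x"
  obtains m n :: nat and u v :: "nat \<Rightarrow> complex" and d :: complex
  where "d \<noteq> 0" "\<And>w. of_real r * w \<notin> \<int>\<^sub>\<le>\<^sub>0 \<Longrightarrow> of_real r * (w + 1) \<notin> \<int>\<^sub>\<le>\<^sub>0 \<Longrightarrow> (\<And>i. i < m \<Longrightarrow> w + u i \<notin> \<int>\<^sub>\<le>\<^sub>0) \<Longrightarrow>
    fHyp p q r a b x (w + 1) * (\<Prod>j<n. w + v j) = d * (\<Prod>i<m. w + u i) * fHyp p q r a b x w"
proof -
  obtain C \<delta> :: complex and m n :: nat and u v :: "nat \<Rightarrow> complex" where "\<forall>w. of_real r * w \<notin> \<int>\<^sub>\<le>\<^sub>0 \<and> (\<forall>i<m. w + u i \<notin> \<int>\<^sub>\<le>\<^sub>0) \<longrightarrow>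
     fHyp p q r a b x w = C * exp (\<delta> * w) * (\<Prod>i<m. Gamma (w + u i)) / (\<Prod>j<n. Gamma (w + v j))"
    using assms unfolding solution_I_def by (elim exE conjE) (rule that)
  note sol = this[rule_format, OF conjI]
  show ?thesis
  proof (rule that[where d = "exp \<delta>" and m = m and n = n and u = u and v = v])
    fix w assume w: "of_real r * w \<notin> \<int>\<^sub>\<le>\<^sub>0" "of_real r * (w + 1) \<notin> \<int>\<^sub>\<le>\<^sub>0" "\<And>i. i < m \<Longrightarrow> w + u i \<notin> \<int>\<^sub>\<le>\<^sub>0"
    have w1: "w + 1 + u i \<notin> \<int>\<^sub>\<le>\<^sub>0" if "i < m" for i
      using w(3)[OF that] plus_one_in_nonpos_Ints_imp[of "w + u i"] by (auto simp: add_ac)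
    have e: "exp (\<delta> * (w + 1)) = exp \<delta> * exp (\<delta> * w)" by (simp add: algebra_simps flip: exp_add)
    have g: "(\<Prod>i<m. Gamma (w + 1 + u i)) = (\<Prod>i<m. w + u i) * (\<Prod>i<m. Gamma (w + u i))"
      unfolding prod.distrib[symmetric]
      by (intro prod.cong refl) (use w(3) Gamma_plus1 in \<open>force simp: add_ac\<close>)
    have h: "(\<Prod>j<n. inverse (Gamma (w + 1 + v j))) * (\<Prod>j<n. w + v j) = (\<Prod>j<n. inverse (Gamma (w + v j)))"
      unfolding prod.distrib[symmetric]
      by (intro prod.cong refl) (use rGamma_plus1 in \<open>metis rGamma_inverse_Gamma mult.commute add.commute add.left_commute\<close>)
    have s: "fHyp p q r a b x w = C * exp (\<delta> * w) * (\<Prod>i<m. Gamma (w + u i)) * (\<Prod>j<n. inverse (Gamma (w + v j)))"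
      using sol[of w] w by (simp add: divide_inverse prod_inversef[symmetric] o_def)
    have "fHyp p q r a b x (w + 1) = C * exp (\<delta> * (w + 1)) * (\<Prod>i<m. Gamma (w + 1 + u i)) * (\<Prod>j<n. inverse (Gamma (w + 1 + v j)))"
      using sol[of "w + 1"] w w1 by (simp add: divide_inverse prod_inversef[symmetric] o_def)
    then show "fHyp p q r a b x (w + 1) * (\<Prod>j<n. w + v j) = exp \<delta> * (\<Prod>i<m. w + u i) * fHyp p q r a b x w"
      unfolding s h[symmetric] e g by (simp add: mult_ac)
  qed simp
qed

lemma rhyp_tendsto:
  fixes p r x \<alpha> \<gamma> :: real
  assumes "0 < p" "p < r" "0 < x" "x < 1"
  shows "((\<lambda>W. rhyp (p * W + \<alpha>) (1/2) (r * W + \<gamma>) x / (1 - p * x / r) powr (-1/2)) \<longlongrightarrow> 1) at_top"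
proof -
  let ?g = "\<lambda>W. rhyp (p * W + \<alpha>) (1/2) (r * W + \<gamma>) x / (1 - p * x / r) powr (-1/2)"
  obtain h where h: "((\<lambda>W. W * (?g W - 1)) \<longlongrightarrow> h) at_top" using hyp_first_order[OF assms] by blast
  have "((\<lambda>W. inverse W * (W * (?g W - 1)) + 1) \<longlongrightarrow> 0 * h + 1) at_top"
    by (intro tendsto_add tendsto_mult tendsto_const h tendsto_inverse_0_at_top filterlim_ident)
  moreover have "eventually (\<lambda>W. inverse W * (W * (?g W - 1)) + 1 = ?g W) at_top"
    using eventually_gt_at_top[of 0] by eventually_elim (simp add: right_diff_distrib)
  ultimately show ?thesis by (simp add: Lim_transform_eventually)
qed

lemma nonpos_Ints_Re_le_0: "z \<in> \<int>\<^sub>\<le>\<^sub>0 \<Longrightarrow> Re z \<le> 0"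
  by (auto elim!: nonpos_Ints_cases)

lemma eventually_linear_not_nonpos_Int:
  fixes A :: "nat \<Rightarrow> complex"
  shows "eventually (\<lambda>W::real. \<forall>i<n. of_real W + A i \<notin> \<int>\<^sub>\<le>\<^sub>0 \<and> - of_real W + A i \<noteq> 0) at_top"
proof (induction n)
  case (Suc n)
  have "eventually (\<lambda>W::real. W > norm (A n)) at_top" by (rule eventually_gt_at_top)
  then have "eventually (\<lambda>W::real. of_real W + A n \<notin> \<int>\<^sub>\<le>\<^sub>0 \<and> - of_real W + A n \<noteq> 0) at_top"
  proof eventually_elim
    case (elim W)
    have "\<bar>Re (A n)\<bar> < W" using elim abs_Re_le_cmod[of "A n"] by linarith
    then show ?case using nonpos_Ints_Re_le_0[of "of_real W + A n"] by (auto simp: complex_eq_iff)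
  qed
  with Suc.IH show ?case by eventually_elim (auto simp: less_Suc_eq)
qed simp

lemma eventually_generic:
  fixes u :: "nat \<Rightarrow> complex"
  assumes "r > 0"
  shows "eventually (\<lambda>W::real. of_real r * of_real W \<notin> (\<int>\<^sub>\<le>\<^sub>0 :: complex set) \<and> of_real r * (of_real W + 1) \<notin> (\<int>\<^sub>\<le>\<^sub>0 :: complex set) \<and>
    (\<forall>i<n. of_real W + u i \<notin> \<int>\<^sub>\<le>\<^sub>0)) at_top"
  using eventually_linear_not_nonpos_Int[of n u] eventually_gt_at_top[of 0]
proof eventually_elim
  case (elim W)
  have rW: "r * W > 0" "r * (W + 1) > 0" using assms elim by auto
  have "of_real r * of_real W \<notin> (\<int>\<^sub>\<le>\<^sub>0 :: complex set)"
  proof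
    assume "of_real r * of_real W \<in> (\<int>\<^sub>\<le>\<^sub>0 :: complex set)"
    from nonpos_Ints_Re_le_0[OF this] have "r * W \<le> 0" by simp
    then show False using rW by linarith
  qed
  moreover have "of_real r * (of_real W + 1) \<notin> (\<int>\<^sub>\<le>\<^sub>0 :: complex set)"
  proof
    assume "of_real r * (of_real W + 1) \<in> (\<int>\<^sub>\<le>\<^sub>0 :: complex set)"
    from nonpos_Ints_Re_le_0[OF this] have "r * (W + 1) \<le> 0" by simp
    then show False using rW by linarith
  qed
  ultimately show ?case using elim by blast
qed

text \<open>Since \<open>f\<close> has a finite non-zero limit at infinity with an error of order \<open>1 / w\<close>,
  the rational function \<open>f(w + 1) / f(w)\<close> is \<open>1 + O(1 / w\<^sup>2)\<close>.\<close>
lemma balanced_functional_equation: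
  assumes par: "0 < p" "p < r" "0 < x" "x < 1" and sol: "solution_I p 0 r a (1/2) x"
  obtains n :: nat and u v :: "nat \<Rightarrow> complex" where "(\<Sum>i<n. u i) = (\<Sum>i<n. v i)"
    "\<And>w. of_real r * w \<notin> \<int>\<^sub>\<le>\<^sub>0 \<Longrightarrow> of_real r * (w + 1) \<notin> \<int>\<^sub>\<le>\<^sub>0 \<Longrightarrow> \<forall>i<n. w + u i \<notin> \<int>\<^sub>\<le>\<^sub>0 \<Longrightarrow>
    fHyp p 0 r a (1/2) x (w + 1) * (\<Prod>j<n. w + v j) = (\<Prod>i<n. w + u i) * fHyp p 0 r a (1/2) x w"
proof -
  obtain m n :: nat and u v :: "nat \<Rightarrow> complex" and d :: complex
    where d: "d \<noteq> 0" and fe: "\<And>w. of_real r * w \<notin> \<int>\<^sub>\<le>\<^sub>0 \<Longrightarrow> of_real r * (w + 1) \<notin> \<int>\<^sub>\<le>\<^sub>0 \<Longrightarrow> (\<And>i. i < m \<Longrightarrow> w + u i \<notin> \<int>\<^sub>\<le>\<^sub>0) \<Longrightarrow>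
    fHyp p 0 r a (1/2) x (w + 1) * (\<Prod>j<n. w + v j) = d * (\<Prod>i<m. w + u i) * fHyp p 0 r a (1/2) x w"
    using solution_I_functional_equation[OF sol] by metis
  have r: "r > 0" using par by simp
  define c where "c = (1 - p * x / r) powr (-1/2)"
  have "p * x < r" using par mult_strict_mono[of p r x 1] by simp
  then have c: "c > 0" unfolding c_def using par by simp
  define F where "F W = rhyp (p * W + a) (1/2) (r * W) x / c" for W
  have F1: "(F \<longlongrightarrow> 1) at_top" using rhyp_tendsto[OF par, of a 0] by (simp add: F_def [abs_def] c_def)
  have F1': "((\<lambda>W. F (W + 1)) \<longlongrightarrow> 1) at_top"
    by (rule filterlim_compose[OF F1]) (rule filterlim_tendsto_add_at_top[OF tendsto_const filterlim_ident, of 1, simplified add.commute])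
  have fF: "fHyp p 0 r a (1/2) x (of_real W) = of_real (c * F W)" for W
    using fHyp_of_real[OF par(3,4)] c by (simp add: F_def)
  have ev: "eventually (\<lambda>W. of_real (F (W + 1)) * (\<Prod>j<n. of_real W + v j) = d * (\<Prod>i<m. of_real W + u i) * of_real (F W)) at_top"
    using eventually_generic[OF r, of m u]
  proof eventually_elim
    case (elim W)
    have f1: "fHyp p 0 r a (1/2) x (of_real W + 1) = of_real c * of_real (F (W + 1))"
      using fF[of "W + 1"] by (simp only: of_real_add of_real_1 of_real_mult)
    have f0: "fHyp p 0 r a (1/2) x (of_real W) = of_real c * of_real (F W)"
      using fF[of W] by (simp only: of_real_mult)
    have "fHyp p 0 r a (1/2) x (of_real W + 1) * (\<Prod>j<n. of_real W + v j) = d * (\<Prod>i<m. of_real W + u i) * fHyp p 0 r a (1/2) x (of_real W)"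
      by (rule fe) (use elim in blast)+
    then have "of_real c * (of_real (F (W + 1)) * (\<Prod>j<n. of_real W + v j)) = of_real c * (d * (\<Prod>i<m. of_real W + u i) * of_real (F W))"
      unfolding f1 f0 by (simp only: mult_ac)
    then show ?case using c by simp
  qed
  define P where "P W = (\<Prod>i<m. of_real W + u i) / of_real W ^ m" for W :: real
  define V where "V W = (\<Prod>i<n. of_real W + v i) / of_real W ^ n" for W :: real
  note expP = log_expansion_prod_linear[where n = m and A = u, folded P_def]
  note expV = log_expansion_prod_linear[where n = n and A = v, folded V_def]
  note P1 = log_expansion_tendsto[OF expP] and V1 = log_expansion_tendsto[OF expV]
  have ev2: "eventually (\<lambda>W. of_real (F (W + 1)) * V W * of_real W ^ n = d * P W * of_real W ^ m * of_real (F W)) at_top"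
    using ev eventually_gt_at_top[of 0] by eventually_elim (simp add: P_def V_def)
  have F1c: "((\<lambda>W. of_real (F W) :: complex) \<longlongrightarrow> 1) at_top" "((\<lambda>W. of_real (F (W + 1)) :: complex) \<longlongrightarrow> 1) at_top"
    using tendsto_of_real[OF F1, where 'a = complex] tendsto_of_real[OF F1', where 'a = complex] by simp_all
  \<comment> \<open>By the functional equation T(W) W^m = W^n for large W. As T tends to the
    non-zero d, the degrees agree and d = 1.\<close>
  define T where "T W = d * P W * of_real (F W) / (of_real (F (W + 1)) * V W)" for W
  have Tlim: "(T \<longlongrightarrow> d) at_top"
      proof -
    have "((\<lambda>W. d * P W * of_real (F W) / (of_real (F (W + 1)) * V W)) \<longlongrightarrow> d * 1 * 1 / (1 * 1)) at_top"
      by (intro tendsto_divide tendsto_mult tendsto_const F1c P1 V1) simp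
    then show ?thesis by (simp add: T_def [abs_def])
  qed
  have nz: "eventually (\<lambda>W. of_real (F (W + 1)) * V W \<noteq> 0) at_top"
    by (rule tendsto_imp_eventually_ne[of _ "1 * 1"]) (intro tendsto_mult F1c V1, simp)
  have ev3: "eventually (\<lambda>W. T W * of_real W ^ m = of_real W ^ n) at_top"
    using ev2 nz by eventually_elim (simp add: T_def field_simps)
  have "\<not> m < n"
  proof
    assume "m < n"
    then obtain e where e: "n = m + Suc e" by (auto dest: less_imp_Suc_add)
    have A: "eventually (\<lambda>W. T W * inverse (of_real W) ^ Suc e = 1) at_top"
      using ev3 eventually_gt_at_top[of 0] by eventually_elim (simp add: e power_add field_simps)
    have B: "((\<lambda>W. T W * inverse (of_real W) ^ Suc e) \<longlongrightarrow> d * 0 ^ Suc e) at_top"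
      by (intro tendsto_mult tendsto_power Tlim tendsto_inverse_of_real_at_top)
    have "((\<lambda>_::real. 1) \<longlongrightarrow> d * 0 ^ Suc e) at_top"
      by (rule Lim_transform_eventually[OF B A])
    then show False by (simp add: tendsto_const_iff)
  qed
  moreover have "\<not> n < m"
  proof
    assume "n < m"
    then obtain e where e: "m = n + Suc e" by (auto dest: less_imp_Suc_add)
    have A: "eventually (\<lambda>W. inverse (of_real W) ^ Suc e = T W) at_top"
      using ev3 eventually_gt_at_top[of 0] by eventually_elim (simp add: e power_add field_simps)
    have B: "((\<lambda>W. inverse (of_real W) ^ Suc e) \<longlongrightarrow> (0 :: complex) ^ Suc e) at_top"
      by (intro tendsto_power tendsto_inverse_of_real_at_top)
    have "(T \<longlongrightarrow> 0 ^ Suc e) at_top"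
      by (rule Lim_transform_eventually[OF B A])
    from tendsto_unique[OF _ this Tlim] show False using d by simp
  qed
  ultimately have mn: "m = n" by simp
  have T1: "eventually (\<lambda>W. T W = 1) at_top"
    using ev3 eventually_gt_at_top[of 0] by eventually_elim (simp add: mn)
  have "((\<lambda>_::real. 1) \<longlongrightarrow> d) at_top" by (rule Lim_transform_eventually[OF Tlim T1])
  then have d1: "d = 1" by (simp add: tendsto_const_iff)
  \<comment> \<open>W times the step of F tends to this difference of sums, while F itself
    converges; \<open>convergent_step_limit\<close> makes it 0.\<close>
  define \<sigma> where "\<sigma> = (\<Sum>i<n. u i) - (\<Sum>i<n. v i)"
  have "log_expansion (\<lambda>W. P W / V W) \<sigma> (- (\<Sum>i<n. u i ^ 2) / 2 - - (\<Sum>i<n. v i ^ 2) / 2)"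
    using log_expansion_divide[OF expP expV] by (simp add: mn \<sigma>_def)
  note PV = log_expansion_first[OF this]
  have "((\<lambda>W. of_real (F W) * (of_real W * (P W / V W - 1))) \<longlongrightarrow> 1 * \<sigma>) at_top"
    by (intro tendsto_mult F1c PV)
  moreover have "eventually (\<lambda>W. V W \<noteq> 0) at_top" by (rule tendsto_imp_eventually_ne[OF V1]) simp
  then have "eventually (\<lambda>W. of_real (F W) * (of_real W * (P W / V W - 1)) = of_real W * (of_real (F (W + 1)) - of_real (F W))) at_top"
    using ev2 eventually_gt_at_top[of 0] by eventually_elim (simp add: mn d1 field_simps)
  ultimately have "((\<lambda>W. of_real W * (of_real (F (W + 1)) - of_real (F W))) \<longlongrightarrow> 1 * \<sigma>) at_top"
    by (rule Lim_transform_eventually)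
  from filterlim_compose[OF this filterlim_real_sequentially]
  have "(\<lambda>k. of_real (0 + real k) * (of_real (F (real (Suc k))) - of_real (F (real k)))) \<longlonglongrightarrow> \<sigma>"
    by (simp add: add.commute)
  moreover have "convergent (\<lambda>k. of_real (F (real k)) :: complex)"
    using filterlim_compose[OF F1c(1) filterlim_real_sequentially] by (rule convergentI)
  ultimately have "\<sigma> = 0" by (rule convergent_step_limit[rotated])
  then show ?thesis using that[where n = n and u = u and v = v] fe unfolding \<sigma>_def mn d1 by simp
qed

text \<open>Every pole is of the form -n / r, and only finitely many of these points have n / r at
  most M, whereas a non-elementary f has infinitely many poles.\<close>

lemma far_left_pole:
  fixes M :: real
  assumes x: "0 < x" "x < 1" and r: "r > 0" and ne: "\<not> elementary p 0 r a (1/2) x"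
  shows "\<exists>n. real n / r > M \<and> regularised p r a x (- of_real (real n / r)) \<noteq> 0"
proof (rule ccontr)
  assume no': "\<not> ?thesis"
  have no: "real n / r \<le> M" if "regularised p r a x (- of_real (real n / r)) \<noteq> 0" for n
    using that no' by (auto simp: not_less)
  have "{w. is_pole (fHyp p 0 r a (1/2) x) w} \<subseteq> (\<lambda>n. - of_real (real n / r)) ` {n. real n \<le> M * r}"
  proof
    fix w assume "w \<in> {w. is_pole (fHyp p 0 r a (1/2) x) w}"
    then obtain n where n: "of_real r * w = - of_nat n" "regularised p r a x w \<noteq> 0"
      using fHyp_pole[OF x, of r p a w] r by auto
    then have w: "w = - of_real (real n / r)" using r by (simp add: field_simps)
    then have "real n / r \<le> M" using no n by simp
    then show "w \<in> (\<lambda>n. - of_real (real n / r)) ` {n. real n \<le> M * r}"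
      using w r by (auto simp: field_simps)
  qed
  moreover have "finite {n. real n \<le> M * r}"
    by (rule finite_subset[of _ "{..nat \<lfloor>M * r\<rfloor>}"]) (auto simp: le_nat_floor)
  ultimately show False using ne finite_subset unfolding elementary_def by blast
qed

definition residue_factor :: "real \<Rightarrow> real \<Rightarrow> real \<Rightarrow> real \<Rightarrow> nat \<Rightarrow> real" where
  "residue_factor p r a x n = (let \<alpha> = a - p * real n / r in
     (-1) ^ n / (fact n * r) * (pochhammer \<alpha> (Suc n) * pochhammer (1/2) (Suc n) / fact (Suc n) * x ^ Suc n)
     * (1 - x) powr (- \<alpha> - 1/2 - real n))"

text \<open>The residue of f at -n / r. Up to a constant, the second factor converges as n grows, so
  the growth of the residues is that of the explicit \<open>residue_factor\<close>.\<close>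

definition residue_value :: "real \<Rightarrow> real \<Rightarrow> real \<Rightarrow> real \<Rightarrow> nat \<Rightarrow> real" where
  "residue_value p r a x n = residue_factor p r a x n * rhyp (p * (real n / r) + (1 - a)) (1/2) (real n + 2) x"

lemma fHyp_residue:
  assumes x: "0 < x" "x < 1" "r > 0"
  shows "((\<lambda>w. (w - (- of_real (real n / r))) * fHyp p 0 r a (1/2) x w) \<longlongrightarrow> of_real (residue_value p r a x n)) (at (- of_real (real n / r)))"
proof -
  let ?w = "- of_real (real n / r) :: complex"
  have rw: "of_real r * ?w = - of_nat n" and r: "r \<noteq> 0" using x by auto
  have "(-1) ^ n / fact n / of_real r * regularised p r a x ?w = of_real (residue_value p r a x n)"
    unfolding regularised_at_pole[OF x(1,2) r] residue_value_def residue_factor_def Let_def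
    by (simp add: algebra_simps)
  then show ?thesis using fHyp_residue_tendsto(1)[OF x(1,2) r rw, of p a] by simp
qed

lemma regularised_residue_iff:
  assumes x: "0 < x" "x < 1" "r > 0"
  shows "regularised p r a x (- of_real (real n / r)) = 0 \<longleftrightarrow> residue_value p r a x n = 0"
proof -
  let ?w = "- of_real (real n / r) :: complex"
  have rw: "of_real r * ?w = - of_nat n" and r: "r \<noteq> 0" using x by auto
  have "(-1) ^ n / fact n / of_real r * regularised p r a x ?w = of_real (residue_value p r a x n)"
    using tendsto_unique[OF _ fHyp_residue_tendsto(1)[OF x(1,2) r rw, of p a] fHyp_residue[OF x, of n p a]] by simp
  then show ?thesis using r by (metis divide_eq_0_iff fact_nonzero mult_eq_0_iff of_real_eq_0_iff power_not_zero zero_neq_neg_one)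
qed

text \<open>The functional equation is multiplied by w - w1 and w tends to w1. Residues are
  expressed as limits so that the limit 0 also covers points where f is regular.\<close>

lemma residue_shift:
  fixes f :: "complex \<Rightarrow> complex" and u v :: "nat \<Rightarrow> complex"
  assumes r: "r > 0"
    and fe: "\<forall>w. of_real r * w \<notin> \<int>\<^sub>\<le>\<^sub>0 \<longrightarrow> of_real r * (w + 1) \<notin> \<int>\<^sub>\<le>\<^sub>0 \<longrightarrow> (\<forall>i<n. w + u i \<notin> \<int>\<^sub>\<le>\<^sub>0) \<longrightarrow>
      f (w + 1) * (\<Prod>j<n. w + v j) = (\<Prod>i<n. w + u i) * f w"
    and L0: "((\<lambda>w. (w - (w1 + 1)) * f w) \<longlongrightarrow> L0) (at (w1 + 1))"
    and L1: "((\<lambda>w. (w - w1) * f w) \<longlongrightarrow> L1) (at w1)"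
  shows "(\<Prod>j<n. w1 + v j) * L0 = (\<Prod>i<n. w1 + u i) * L1"
proof -
  have r0: "r \<noteq> 0" using r by simp
  have "eventually (\<lambda>w. \<forall>i<m. w + u i \<notin> \<int>\<^sub>\<le>\<^sub>0) (at w1)" for m
  proof (induction m)
    case (Suc m)
    have "eventually (\<lambda>w. w + u m \<notin> \<int>\<^sub>\<le>\<^sub>0) (at w1)"
      using eventually_not_nonpos_Int[of 1 "u m" w1] by simp
    with Suc show ?case by eventually_elim (auto simp: less_Suc_eq)
  qed simp
  note ev1 = this[of n]
  have ev2: "eventually (\<lambda>w. of_real r * w \<notin> \<int>\<^sub>\<le>\<^sub>0) (at w1)"
    using eventually_not_nonpos_Int[OF r0, of 0 w1] by simp
  have ev3: "eventually (\<lambda>w. of_real r * (w + 1) \<notin> \<int>\<^sub>\<le>\<^sub>0) (at w1)"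
    using eventually_not_nonpos_Int[OF r0, of "of_real r" w1] by (simp add: distrib_left)
  have ev: "eventually (\<lambda>w. (\<Prod>i<n. w + u i) * ((w - w1) * f w) = (\<Prod>j<n. w + v j) * ((w + 1 - (w1 + 1)) * f (w + 1))) (at w1)"
    using ev1 ev2 ev3
  proof eventually_elim
    case (elim w)
    have "f (w + 1) * (\<Prod>j<n. w + v j) = (\<Prod>i<n. w + u i) * f w"
      by (rule fe[rule_format]) (use elim in blast)+
    then show ?case by (simp add: mult_ac)
  qed
  have "filterlim (\<lambda>w. w + 1) (at (w1 + 1)) (at w1)"
    by (intro filterlim_atI tendsto_intros) (auto simp: eventually_at_filter)
  from filterlim_compose[OF L0 this]
  have "((\<lambda>w. (\<Prod>j<n. w + v j) * ((w + 1 - (w1 + 1)) * f (w + 1))) \<longlongrightarrow> (\<Prod>j<n. w1 + v j) * L0) (at w1)"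
    by (intro tendsto_intros)
  moreover have "((\<lambda>w. (\<Prod>i<n. w + u i) * ((w - w1) * f w)) \<longlongrightarrow> (\<Prod>i<n. w1 + u i) * L1) (at w1)"
    by (intro tendsto_intros L1)
  from Lim_transform_eventually[OF this ev]
  have "((\<lambda>w. (\<Prod>j<n. w + v j) * ((w + 1 - (w1 + 1)) * f (w + 1))) \<longlongrightarrow> (\<Prod>i<n. w1 + u i) * L1) (at w1)" .
  ultimately show ?thesis by (rule tendsto_unique[rotated]) simp
qed

text \<open>To the left of all zeros of the product with the \<open>v j\<close>, a non-zero residue
  at w1 + 1 forces one at w1. Hence one pole far to the left generates all its translates by
  negative integers; two successive ones lie in -N / r, so r is a difference of natural
  numbers.\<close>

lemma pole_progression:
  assumes par: "0 < p" "p < r" "0 < x" "x < 1" and sol: "solution_I p 0 r a (1/2) x"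
    and ne: "\<not> elementary p 0 r a (1/2) x"
  obtains R n0 n :: nat and u v :: "nat \<Rightarrow> complex" where "r = real R" "(\<Sum>i<n. u i) = (\<Sum>i<n. v i)"
    "eventually (\<lambda>W. of_real (rhyp (p * (W + 1) + a) (1/2) (r * (W + 1)) x) * (\<Prod>j<n. of_real W + v j)
       = (\<Prod>i<n. of_real W + u i) * of_real (rhyp (p * W + a) (1/2) (r * W) x)) at_top"
    "\<And>k. residue_value p r a x (n0 + R * k) \<noteq> 0"
    "\<And>k W. W = real n0 / real R + real k \<Longrightarrow>
       (\<Prod>j<n. - of_real (W + 1) + v j) * of_real (residue_value p r a x (n0 + R * k))
       = (\<Prod>i<n. - of_real (W + 1) + u i) * of_real (residue_value p r a x (n0 + R * Suc k))"
proof -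
  have r: "r > 0" using par by simp
  let ?f = "fHyp p 0 r a (1/2) x"
  obtain n :: nat and u v :: "nat \<Rightarrow> complex" where sum: "(\<Sum>i<n. u i) = (\<Sum>i<n. v i)"
    and fe: "\<And>w. of_real r * w \<notin> \<int>\<^sub>\<le>\<^sub>0 \<Longrightarrow> of_real r * (w + 1) \<notin> \<int>\<^sub>\<le>\<^sub>0 \<Longrightarrow> \<forall>i<n. w + u i \<notin> \<int>\<^sub>\<le>\<^sub>0 \<Longrightarrow>
      ?f (w + 1) * (\<Prod>j<n. w + v j) = (\<Prod>i<n. w + u i) * ?f w"
  proof (rule balanced_functional_equation[OF par sol])
    fix n :: nat and u v :: "nat \<Rightarrow> complex"
    assume *: "(\<Sum>i<n. u i) = (\<Sum>i<n. v i)"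
      "\<And>w. of_real r * w \<notin> \<int>\<^sub>\<le>\<^sub>0 \<Longrightarrow> of_real r * (w + 1) \<notin> \<int>\<^sub>\<le>\<^sub>0 \<Longrightarrow> \<forall>i<n. w + u i \<notin> \<int>\<^sub>\<le>\<^sub>0 \<Longrightarrow>
      ?f (w + 1) * (\<Prod>j<n. w + v j) = (\<Prod>i<n. w + u i) * ?f w"
    show thesis by (rule that[OF *(1)]) (rule *(2))
  qed
  have fe': "\<forall>w. of_real r * w \<notin> \<int>\<^sub>\<le>\<^sub>0 \<longrightarrow> of_real r * (w + 1) \<notin> \<int>\<^sub>\<le>\<^sub>0 \<longrightarrow> (\<forall>i<n. w + u i \<notin> \<int>\<^sub>\<le>\<^sub>0) \<longrightarrow>
      ?f (w + 1) * (\<Prod>j<n. w + v j) = (\<Prod>i<n. w + u i) * ?f w"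
    by (intro allI impI) (rule fe)
  have right: "eventually (\<lambda>W. of_real (rhyp (p * (W + 1) + a) (1/2) (r * (W + 1)) x) * (\<Prod>j<n. of_real W + v j)
       = (\<Prod>i<n. of_real W + u i) * of_real (rhyp (p * W + a) (1/2) (r * W) x)) at_top"
    using eventually_generic[OF r, of n u]
  proof eventually_elim
    case (elim W)
    have f1: "?f (of_real W + 1) = of_real (rhyp (p * (W + 1) + a) (1/2) (r * (W + 1)) x)"
      using fHyp_of_real[OF par(3,4), of p r a "W + 1"] by (simp only: of_real_add of_real_1)
    have "?f (of_real W + 1) * (\<Prod>j<n. of_real W + v j) = (\<Prod>i<n. of_real W + u i) * ?f (of_real W)"
      by (rule fe) (use elim in blast)+
    then show ?case unfolding f1 fHyp_of_real[OF par(3,4)] .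
  qed
  obtain M where M: "\<And>W i. W \<ge> M \<Longrightarrow> i < n \<Longrightarrow> - of_real W + v i \<noteq> 0"
    using eventually_linear_not_nonpos_Int[of n v] unfolding eventually_at_top_linorder by auto
  obtain n0 where n0: "real n0 / r > M" "regularised p r a x (- of_real (real n0 / r)) \<noteq> 0"
    using far_left_pole[OF par(3,4) r ne, of M] by auto
  have shift: "\<exists>n2. real n2 = real n1 + r \<and> residue_value p r a x n2 \<noteq> 0 \<and>
       (\<Prod>j<n. - of_real (real n1 / r + 1) + v j) * of_real (residue_value p r a x n1)
       = (\<Prod>i<n. - of_real (real n1 / r + 1) + u i) * of_real (residue_value p r a x n2)"
    if n1: "real n1 / r \<ge> M" "residue_value p r a x n1 \<noteq> 0" for n1
  proof -
    let ?w1 = "- of_real (real n1 / r + 1) :: complex"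
    have w1: "?w1 + 1 = - of_real (real n1 / r)" by simp
    have L0: "((\<lambda>w. (w - (?w1 + 1)) * ?f w) \<longlongrightarrow> of_real (residue_value p r a x n1)) (at (?w1 + 1))"
      unfolding w1 by (rule fHyp_residue[OF par(3,4) r])
    have nzV: "(\<Prod>j<n. ?w1 + v j) \<noteq> 0" using M[of "real n1 / r + 1"] n1 by (simp del: of_real_add of_real_divide)
    \<comment> \<open>Were f regular at w1, the limit \<open>L1\<close> would be 0, contradicting
      that the product with the \<open>v j\<close> and the residue at w1 + 1 are both
      non-zero.\<close>
    have "of_real r * ?w1 \<in> \<int>\<^sub>\<le>\<^sub>0"
    proof (rule ccontr)
      assume "of_real r * ?w1 \<notin> \<int>\<^sub>\<le>\<^sub>0"
      from fHyp_tendsto_regular[OF par(3,4) _ this, of p a] r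
      have "(?f \<longlongrightarrow> Gamma (of_real r * ?w1) * regularised p r a x ?w1) (at ?w1)" by simp
      then have "((\<lambda>w. (w - ?w1) * ?f w) \<longlongrightarrow> (?w1 - ?w1) * (Gamma (of_real r * ?w1) * regularised p r a x ?w1)) (at ?w1)"
        by (intro tendsto_intros)
      from residue_shift[OF r fe' L0 this]
      have "(\<Prod>j<n. ?w1 + v j) * of_real (residue_value p r a x n1) = 0" by (simp only: diff_self mult_zero_left mult_zero_right)
      then show False using nzV n1 by (simp only: mult_eq_0_iff of_real_eq_0_iff simp_thms)
    qed
    then obtain n2 where "of_real r * ?w1 = - of_nat n2" by (auto elim: nonpos_Ints_cases')
    moreover have "r * (real n1 / r + 1) = real n1 + r" using r by (simp add: distrib_left)
    then have "of_real r * ?w1 = - complex_of_real (real n1 + r)" by (metis mult_minus_right of_real_mult)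
    ultimately have "complex_of_real (real n1 + r) = of_real (real n2)" by (simp only: neg_equal_iff_equal of_real_of_nat_eq)
    then have n2: "real n2 = real n1 + r" by (simp only: of_real_eq_iff)
    then have w2: "?w1 = - of_real (real n2 / r)" using r by (simp add: add_divide_distrib)
    have "((\<lambda>w. (w - ?w1) * ?f w) \<longlongrightarrow> of_real (residue_value p r a x n2)) (at ?w1)"
      unfolding w2 by (rule fHyp_residue[OF par(3,4) r])
    from residue_shift[OF r fe' L0 this]
    have eq: "(\<Prod>j<n. ?w1 + v j) * of_real (residue_value p r a x n1) = (\<Prod>i<n. ?w1 + u i) * of_real (residue_value p r a x n2)"
      by simp
    then have "residue_value p r a x n2 \<noteq> 0" using nzV n1 by auto
    then show ?thesis using n2 eq by blast
  qed
  have nz0: "residue_value p r a x n0 \<noteq> 0" using n0(2) unfolding regularised_residue_iff[OF par(3,4) r] .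
  obtain n2 where "real n2 = real n0 + r" using shift[of n0] n0 nz0 by auto
  then have "r = real (n2 - n0)" using r by simp
  then obtain R where R: "r = real R" by blast
  have Rpos: "real R > 0" using r R by simp
  have ge: "real (n0 + R * k) / r \<ge> M" for k
  proof -
    have "real (n0 + R * k) / r = real n0 / r + real k" using Rpos by (simp add: R add_divide_distrib)
    then show ?thesis using n0 by simp
  qed
  have next_n: "n2 = n0 + R * Suc k" if "real n2 = real (n0 + R * k) + r" for n2 k
  proof -
    have "real n2 = real (n0 + R * Suc k)" using that by (simp add: R algebra_simps)
    then show ?thesis by (simp only: of_nat_eq_iff)
  qed
  have nz: "residue_value p r a x (n0 + R * k) \<noteq> 0" for k
  proof (induction k)
    case (Suc k)
    then show ?case using shift[OF ge[of k]] next_n by metis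
  qed (use nz0 in simp)
  show ?thesis
  proof (rule that[where R = R and ?n0.0 = n0 and n = n and u = u and v = v])
    fix k W assume W: "W = real n0 / real R + real k"
    have "real (n0 + R * k) / r = W" using Rpos by (simp add: R W add_divide_distrib)
    then show "(\<Prod>j<n. - of_real (W + 1) + v j) * of_real (residue_value p r a x (n0 + R * k))
       = (\<Prod>i<n. - of_real (W + 1) + u i) * of_real (residue_value p r a x (n0 + R * Suc k))"
      using shift[OF ge[of k] nz[of k]] next_n by metis
  qed (use R sum right nz in auto)
qed

subsection \<open>Arithmetic consequences of the gamma product formula\<close>

text \<open>The quotient is R(W) / R(-W-1). Up to signs that cancel, reflection replaces z by 1 - z
  in the factors. The equality of sums removes the 1/W term, and the sums of squares of the u i and
  of the v i then occur once with each sign.\<close>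

lemma log_expansion_reflected_quotient:
  fixes u v :: "nat \<Rightarrow> complex"
  assumes "(\<Sum>i<n. u i) = (\<Sum>i<n. v i)"
  shows "log_expansion (\<lambda>W. ((\<Prod>i<n. of_real W + u i) * (\<Prod>i<n. - of_real (W + 1) + v i)) /
      ((\<Prod>i<n. of_real W + v i) * (\<Prod>i<n. - of_real (W + 1) + u i))) 0 0"
proof -
  note E = log_expansion_prod_linear[where n = n]
  have refl: "(\<Prod>i<n. - of_real (W + 1) + A i) = (-1) ^ n * (\<Prod>i<n. of_real W + (1 - A i))" for W and A :: "nat \<Rightarrow> complex"
  proof -
    have "(\<Prod>i<n. - of_real (W + 1) + A i) = (\<Prod>i<n. (-1) * (of_real W + (1 - A i)))"
      by (intro prod.cong refl) (simp add: algebra_simps)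
    then show ?thesis unfolding prod.distrib by simp
  qed
  have s2: "(\<Sum>i<n. (1 - A i)\<^sup>2) = of_nat n - 2 * (\<Sum>i<n. A i) + (\<Sum>i<n. (A i)\<^sup>2)" for A :: "nat \<Rightarrow> complex"
    by (simp add: power2_diff sum.distrib sum_subtractf sum_distrib_left)
  show ?thesis
  proof (rule log_expansion_cong[OF log_expansion_divide[OF
        log_expansion_mult[OF E[of u] E[of "\<lambda>i. 1 - v i"]] log_expansion_mult[OF E[of v] E[of "\<lambda>i. 1 - u i"]]]])
    show "eventually (\<lambda>W. (\<Prod>i<n. of_real W + u i) / of_real W ^ n * ((\<Prod>i<n. of_real W + (1 - v i)) / of_real W ^ n) /
        ((\<Prod>i<n. of_real W + v i) / of_real W ^ n * ((\<Prod>i<n. of_real W + (1 - u i)) / of_real W ^ n)) =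
      ((\<Prod>i<n. of_real W + u i) * (\<Prod>i<n. - of_real (W + 1) + v i)) /
      ((\<Prod>i<n. of_real W + v i) * (\<Prod>i<n. - of_real (W + 1) + u i))) at_top"
      using eventually_gt_at_top[of 0] by eventually_elim (unfold refl, simp)
  qed (simp_all add: s2 assms sum_subtractf, simp add: field_simps)
qed

text \<open>The part of \<open>residue_factor\<close> that changes by an explicit rational function
  of W when n grows by R, for any real p. The remaining Pochhammer symbol starts at a - p n / r and
  does so only after p is known to be an integer.\<close>

definition residue_scale :: "real \<Rightarrow> real \<Rightarrow> real \<Rightarrow> real \<Rightarrow> nat \<Rightarrow> real" where
  "residue_scale p r a x n = (-1) ^ n / (fact n * r) * (pochhammer (1/2) (Suc n) / fact (Suc n) * x ^ Suc n)
     * (1 - x) powr (- (a - p * real n / r) - 1/2 - real n)"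

lemma residue_factor_eq:
  "residue_factor p r a x n = residue_scale p r a x n * pochhammer (a - p * real n / r) (Suc n)"
  by (simp add: residue_factor_def residue_scale_def Let_def)

text \<open>The change of \<open>pochhammer (1/2) (Suc n) / (fact n * fact (Suc n))\<close> when n =
  R W grows by R. The summands 0 and 1 are the values of \<open>\<beta>\<close> in
  \<open>log_expansion_arith_prod\<close>.\<close>

definition scale_ratio :: "nat \<Rightarrow> real \<Rightarrow> real" where
  "scale_ratio R W = (\<Prod>i<R. real R * W + 1/2 + (real i + 1)) /
    ((\<Prod>i<R. real R * W + 0 + (real i + 1)) * (\<Prod>i<R. real R * W + 1 + (real i + 1)))"

lemma residue_scale_nonzero:
  assumes "0 < x" "x < 1" "r > 0"
  shows "residue_scale p r a x n \<noteq> 0"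
proof -
  have "pochhammer (1/2 :: real) (Suc n) > 0" by (rule pochhammer_pos) simp
  then show ?thesis using assms by (simp add: residue_scale_def)
qed

lemma residue_scale_step:
  assumes x: "0 < x" "x < 1" and R: "R > 0"
  shows "residue_scale p (real R) a x (n + R) = residue_scale p (real R) a x n *
    ((-1) ^ R * x ^ R * (1 - x) powr (p - real R) * scale_ratio R (real n / real R))"
proof -
  have pc: "pochhammer b R = (\<Prod>i<R. real R * (real n / real R) + \<beta> + (real i + 1))" if "b = real n + \<beta> + 1" for b \<beta> :: real
    unfolding pochhammer_conv_prod using R that by (intro prod.cong refl) simp
  have 1: "pochhammer (1/2) (Suc (n + R)) = pochhammer (1/2) (Suc n) * (\<Prod>i<R. real R * (real n / real R) + 1/2 + (real i + 1))"
    using pochhammer_product'[of "1/2 :: real" "Suc n" R] pc[of "1/2 + real (Suc n)" "1/2"] by simp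
  have 2: "fact (n + R) = fact n * (\<Prod>i<R. real R * (real n / real R) + 0 + (real i + 1))"
    using pochhammer_product'[of "1 :: real" n R] pc[of "1 + real n" 0] unfolding pochhammer_fact[symmetric] by simp
  have 3: "fact (Suc (n + R)) = fact (Suc n) * (\<Prod>i<R. real R * (real n / real R) + 1 + (real i + 1))"
    using pochhammer_product'[of "1 :: real" "Suc n" R] pc[of "1 + real (Suc n)" 1]
    unfolding pochhammer_fact[symmetric] by (simp del: fact_Suc)
  have "- (a - p * real (n + R) / real R) - 1/2 - real (n + R) = (- (a - p * real n / real R) - 1/2 - real n) + (p - real R)"
    using R by (simp add: field_simps)
  then have 4: "(1 - x) powr (- (a - p * real (n + R) / real R) - 1/2 - real (n + R))
     = (1 - x) powr (- (a - p * real n / real R) - 1/2 - real n) * (1 - x) powr (p - real R)"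
    by (simp only: powr_add)
  have alg: "s * sR / ((f * F2) * r) * ((P * F1) / (G * F3) * (X * XR)) * (W1 * W2)
     = s / (f * r) * (P / G * X) * W1 * (sR * XR * W2 * (F1 / (F2 * F3)))" for s sR f F2 r P F1 G F3 X XR W1 W2 :: real
    by (simp add: mult_ac)
  have 5: "x ^ Suc (n + R) = x ^ Suc n * x ^ R" by (simp add: power_add)
  show ?thesis unfolding residue_scale_def scale_ratio_def 1 2 3 4 5 power_add[of "-1" n R] by (rule alg)
qed

lemma log_expansion_scale_ratio:
  assumes "R > 0"
  shows "log_expansion (\<lambda>W. scale_ratio R W * (real R * W) ^ R) (- 1/2 - (real R + 1) / 2)
     (- arith_prod_coeff R (1/2) + arith_prod_coeff R 0 + arith_prod_coeff R 1)"
proof -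
  note E = log_expansion_arith_prod[OF assms]
  show ?thesis
  proof (rule log_expansion_cong[OF log_expansion_divide[OF E[of "1/2"] log_expansion_mult[OF E[of 0] E[of 1]]]])
    show "eventually (\<lambda>W. (\<Prod>i<R. real R * W + 1/2 + (real i + 1)) / (real R * W) ^ R /
      ((\<Prod>i<R. real R * W + 0 + (real i + 1)) / (real R * W) ^ R * ((\<Prod>i<R. real R * W + 1 + (real i + 1)) / (real R * W) ^ R))
      = scale_ratio R W * (real R * W) ^ R) at_top"
      using eventually_gt_at_top[of 0]
    proof eventually_elim
      case (elim W)
      have "(real R * W) ^ R \<noteq> 0" using elim assms by simp
      moreover have "A / q / (B / q * (C / q)) = A / (B * C) * q" if "q \<noteq> 0" for A B C q :: real
        using that by (simp add: field_simps)
      ultimately show ?case unfolding scale_ratio_def by blast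
    qed
  qed (use assms in \<open>simp_all add: field_simps\<close>)
qed

text \<open>The reflection formula moves the oscillation of the symbol into one sine and leaves
  gamma values at positive arguments, whose growth is known as \<open>\<alpha>\<close> tends to
  minus infinity.\<close>

lemma pochhammer_reflection:
  fixes \<alpha> :: real
  assumes "\<alpha> + real m > 0" "1 - \<alpha> > 0"
  shows "pochhammer \<alpha> m = Gamma (\<alpha> + real m) * Gamma (1 - \<alpha>) * sin (pi * \<alpha>) / pi"
proof -
  have "complex_of_real (rGamma \<alpha> * rGamma (1 - \<alpha>)) = of_real (sin (pi * \<alpha>) / pi)"
    using rGamma_reflection_complex[of "of_real \<alpha>"]
    by (simp add: rGamma_complex_of_real[symmetric] sin_of_real[symmetric])
  then have refl: "rGamma \<alpha> * rGamma (1 - \<alpha>) = sin (pi * \<alpha>) / pi" by (simp only: of_real_eq_iff)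
  have pos: "Gamma (1 - \<alpha>) > 0" "Gamma (\<alpha> + real m) > 0" using assms by (auto intro: Gamma_real_pos)
  have "rGamma \<alpha> = pochhammer \<alpha> m * rGamma (\<alpha> + of_nat m)" by (rule pochhammer_rGamma)
  then have "pochhammer \<alpha> m = rGamma \<alpha> * Gamma (\<alpha> + real m)" using pos by (simp add: rGamma_inverse_Gamma)
  moreover have "rGamma \<alpha> = Gamma (1 - \<alpha>) * (sin (pi * \<alpha>) / pi)"
    using refl pos by (simp add: rGamma_inverse_Gamma[of "1 - \<alpha>"] field_simps)
  ultimately show ?thesis by simp
qed

lemma Gamma_step_asymp:
  fixes s b :: real
  assumes "s > 0"
  shows "((\<lambda>W. Gamma (s * (W + 1) + b) / Gamma (s * W + b) / W powr s) \<longlongrightarrow> s powr s) at_top"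
proof -
  have lin: "filterlim (\<lambda>W. s * W + b) at_top at_top" using assms by real_asymp
  have 1: "((\<lambda>W. Gamma (s * W + b + s) / (Gamma (s * W + b) * (s * W + b) powr s)) \<longlongrightarrow> 1) at_top"
    by (rule filterlim_compose[OF Gamma_shift_asymp lin]) (use assms in simp)
  have "((\<lambda>W. (s * W + b) / W) \<longlongrightarrow> s) at_top" using assms by real_asymp
  then have 2: "((\<lambda>W. ((s * W + b) / W) powr s) \<longlongrightarrow> s powr s) at_top"
    using assms by (intro tendsto_intros) auto
  from tendsto_mult[OF 1 2]
  have "((\<lambda>W. Gamma (s * W + b + s) / (Gamma (s * W + b) * (s * W + b) powr s) * ((s * W + b) / W) powr s) \<longlongrightarrow> s powr s) at_top"
    by simp
  moreover have "eventually (\<lambda>W. s * W + b > 0) at_top" using lin by (simp add: filterlim_at_top_dense)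
  then have "eventually (\<lambda>W. Gamma (s * W + b + s) / (Gamma (s * W + b) * (s * W + b) powr s) * ((s * W + b) / W) powr s
     = Gamma (s * (W + 1) + b) / Gamma (s * W + b) / W powr s) at_top"
    using eventually_gt_at_top[of 0]
  proof eventually_elim
    case (elim W)
    have "s * W + b + s = s * (W + 1) + b" by (simp add: algebra_simps)
    then have e: "s * (W + 1) + b = s * W + b + s" by simp
    have "Gamma (s * W + b) > 0" using elim by (intro Gamma_real_pos)
    then show ?case unfolding e using elim by (simp add: powr_divide)
  qed
  ultimately show ?thesis by (rule Lim_transform_eventually)
qed

text \<open>For integer P the longer symbol is the old one with P new factors in front and R - P
  behind.\<close>

lemma pochhammer_integer_step:
  fixes a W :: real
  assumes PR: "P \<le> R" and R: "R > 0" and W: "real n = real R * W"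
  shows "pochhammer (a - real P * (W + 1)) (Suc (n + R)) = pochhammer (a - real P * W) (Suc n) *
     ((-1) ^ P * (\<Prod>i<P. real P * W + (- a) + (real i + 1)) * (\<Prod>i<R - P. real (R - P) * W + a + (real i + 1)))"
proof -
  define \<alpha> where "\<alpha> = a - real P * W"
  have "Suc (n + R) = P + (Suc n + (R - P))" using PR by simp
  then have "pochhammer (\<alpha> - real P) (Suc (n + R)) = pochhammer (\<alpha> - real P) P * (pochhammer \<alpha> (Suc n) * pochhammer (\<alpha> + real (Suc n)) (R - P))"
    by (simp only: pochhammer_product'[of _ P] pochhammer_product'[of _ "Suc n"] diff_add_cancel)
  moreover have "pochhammer (\<alpha> - real P) P = (-1) ^ P * (\<Prod>i<P. real P * W + (- a) + (real i + 1))"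
    using pochhammer_minus[of "real P - \<alpha>" P] by (simp add: \<alpha>_def pochhammer_conv_prod algebra_simps)
  moreover have "pochhammer (\<alpha> + real (Suc n)) (R - P) = (\<Prod>i<R - P. real (R - P) * W + a + (real i + 1))"
    using PR unfolding pochhammer_conv_prod by (intro prod.cong refl) (simp add: \<alpha>_def W of_nat_diff algebra_simps)
  ultimately show ?thesis by (simp add: \<alpha>_def algebra_simps)
qed

text \<open>The last equation equates two evaluations of the 1/W coefficient of \<open>Z\<close>,
  the normalised product of f(W) and the hypergeometric factor of the residue: by
  \<open>hyp_first_order\<close> applied to each factor, and by
  \<open>first_order_from_ratio\<close> from the explicit gamma factors.\<close>

lemma arithmetic_constraints:
  fixes p r a x :: real
  assumes par: "0 < p" "p < r" "0 < x" "x < 1" and sol: "solution_I p 0 r a (1/2) x"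
    and ne: "\<not> elementary p 0 r a (1/2) x"
  obtains P R :: nat where "0 < P" "P < R" "p = real P" "r = real R" "even (R - P)"
    "x ^ R * (real P ^ P * real (R - P) ^ (R - P)) = real R ^ R * (1 - x) ^ (R - P)"
    "(1 / p - 2 / r) * (p * x / (r - p * x)) / 2 + (1 / p - 1 / r) * (3 / 4) * (p * x / (r - p * x))\<^sup>2
      = arith_prod_coeff R 0 + arith_prod_coeff R 1 - arith_prod_coeff R (1/2)
        - arith_prod_coeff P (- a) - arith_prod_coeff (R - P) a"
proof -
  obtain R n0 n :: nat and u v :: "nat \<Rightarrow> complex" where rR: "r = real R" and sum: "(\<Sum>i<n. u i) = (\<Sum>i<n. v i)"
    and right: "eventually (\<lambda>W. of_real (rhyp (p * (W + 1) + a) (1/2) (r * (W + 1)) x) * (\<Prod>j<n. of_real W + v j)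
       = (\<Prod>i<n. of_real W + u i) * of_real (rhyp (p * W + a) (1/2) (r * W) x)) at_top"
    and nz: "\<And>k. residue_value p r a x (n0 + R * k) \<noteq> 0"
    and left: "\<And>k W. W = real n0 / real R + real k \<Longrightarrow>
       (\<Prod>j<n. - of_real (W + 1) + v j) * of_real (residue_value p r a x (n0 + R * k))
       = (\<Prod>i<n. - of_real (W + 1) + u i) * of_real (residue_value p r a x (n0 + R * Suc k))"
  proof (rule pole_progression[OF par sol ne])
    fix R n0 n :: nat and u v :: "nat \<Rightarrow> complex"
    assume *: "r = real R" "(\<Sum>i<n. u i) = (\<Sum>i<n. v i)"
      "eventually (\<lambda>W. of_real (rhyp (p * (W + 1) + a) (1/2) (r * (W + 1)) x) * (\<Prod>j<n. of_real W + v j)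
       = (\<Prod>i<n. of_real W + u i) * of_real (rhyp (p * W + a) (1/2) (r * W) x)) at_top"
      "\<And>k. residue_value p r a x (n0 + R * k) \<noteq> 0"
      "\<And>k W. W = real n0 / real R + real k \<Longrightarrow>
       (\<Prod>j<n. - of_real (W + 1) + v j) * of_real (residue_value p r a x (n0 + R * k))
       = (\<Prod>i<n. - of_real (W + 1) + u i) * of_real (residue_value p r a x (n0 + R * Suc k))"
    show thesis by (rule that[OF *(1-4)]) (rule *(5))
  qed
  have Rpos: "R > 0" "real R > 0" using par rR by auto
  define t where "t = real n0 / real R"
  define w where "w k = t + real k" for k
  have w_Suc: "w (Suc k) = w k + 1" for k by (simp add: w_def)
  have Rw: "real (n0 + R * k) = real R * w k" for k using Rpos by (simp add: w_def t_def distrib_left)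
  have Rw': "real (n0 + R * k) / r = w k" for k using Rpos unfolding Rw rR by simp
  have w_top: "filterlim w at_top sequentially" unfolding w_def [abs_def] by real_asymp
  note seq = filterlim_compose[OF _ w_top]
  define c where "c = (1 - p * x / r) powr (-1/2)"
  have px: "p * x < r" using par mult_strict_mono[of p r x 1] by simp
  then have c: "c > 0" unfolding c_def using par by simp
  define F where "F W = rhyp (p * W + a) (1/2) (r * W) x / c" for W
  define H where "H W = rhyp (p * W + (1 - a)) (1/2) (r * W + 2) x / c" for W
  define Z where "Z W = F W * H W" for W
  define \<tau> where "\<tau> = p * x / r / (1 - p * x / r)"
  define h where "h = (1 / p - 2 / r) * \<tau> / 2 + (1 / p - 1 / r) * (3 / 4) * \<tau>\<^sup>2"
  have F1: "(F \<longlongrightarrow> 1) at_top" using rhyp_tendsto[OF par, of a 0] by (simp add: F_def [abs_def] c_def)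
  have H1: "(H \<longlongrightarrow> 1) at_top" using rhyp_tendsto[OF par, of "1 - a" 2] by (simp add: H_def [abs_def] c_def)
  have Z1: "(Z \<longlongrightarrow> 1) at_top" using tendsto_mult[OF F1 H1] by (simp add: Z_def [abs_def])
  have hF: "((\<lambda>W. W * (F W - 1)) \<longlongrightarrow> (a / p - 0 / r) * \<tau> / 2 + (1 / p - 1 / r) * (3 / 8) * \<tau>\<^sup>2) at_top"
    using hyp_first_order[OF par, of a 0] unfolding F_def c_def \<tau>_def by (simp only: add_0_right)
  have hH: "((\<lambda>W. W * (H W - 1)) \<longlongrightarrow> ((1 - a) / p - 2 / r) * \<tau> / 2 + (1 / p - 1 / r) * (3 / 8) * \<tau>\<^sup>2) at_top"
    using hyp_first_order[OF par, of "1 - a" 2] unfolding H_def c_def \<tau>_def .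
  have limZ: "((\<lambda>W. W * (F W - 1) * H W + W * (H W - 1)) \<longlongrightarrow>
      ((a / p - 0 / r) * \<tau> / 2 + (1 / p - 1 / r) * (3 / 8) * \<tau>\<^sup>2) * 1 +
      (((1 - a) / p - 2 / r) * \<tau> / 2 + (1 / p - 1 / r) * (3 / 8) * \<tau>\<^sup>2)) at_top"
    by (intro tendsto_add tendsto_mult[OF hF H1] hH)
  have eqZ: "W * (F W - 1) * H W + W * (H W - 1) = W * (Z W - 1)" for W
    by (simp add: Z_def algebra_simps)
  \<comment> \<open>The contributions a / p and (1 - a) / p add up to 1 / p, so a drops out of this
    side.\<close>
  have eqh: "((a / p - 0 / r) * \<tau> / 2 + (1 / p - 1 / r) * (3 / 8) * \<tau>\<^sup>2) * 1 +
      (((1 - a) / p - 2 / r) * \<tau> / 2 + (1 / p - 1 / r) * (3 / 8) * \<tau>\<^sup>2) = h"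
  proof -
    have alg: "((A - 0 / r) * \<tau> / 2 + B * (3 / 8) * s) * 1 + ((A' - C) * \<tau> / 2 + B * (3 / 8) * s) = (A + A' - C) * \<tau> / 2 + B * (3 / 4) * s"
      for A A' B C s :: real by (simp add: field_simps)
    have "a / p + (1 - a) / p - 2 / r = 1 / p - 2 / r" by (simp flip: add_divide_distrib)
    then show ?thesis unfolding h_def alg by (simp only:)
  qed
  have hZ: "((\<lambda>W. W * (Z W - 1)) \<longlongrightarrow> h) at_top" using limZ unfolding eqZ eqh .

  define g where "g k = residue_factor p r a x (n0 + R * k)" for k
  have rv: "residue_value p r a x (n0 + R * k) = g k * (c * H (w k))" for k
  proof -
    have "real (n0 + R * k) + 2 = r * w k + 2" unfolding Rw rR ..
    then show ?thesis unfolding residue_value_def g_def H_def Rw' using c by simp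
  qed
  have g0: "g k \<noteq> 0" and H0: "H (w k) \<noteq> 0" for k using nz[of k] unfolding rv by auto
  define T where "T W = ((\<Prod>i<n. of_real W + u i) * (\<Prod>i<n. - of_real (W + 1) + v i)) /
      ((\<Prod>i<n. of_real W + v i) * (\<Prod>i<n. - of_real (W + 1) + u i))" for W :: real
  have T: "log_expansion T 0 0" unfolding T_def [abs_def] by (rule log_expansion_reflected_quotient[OF sum])
  \<comment> \<open>The step quotient of the residue times f(W). By the functional equation on the
    right and on the left it equals \<open>T\<close>, hence is 1 + o(1/W^2).\<close>
  define q where "q k = g (Suc k) / g k * (Z (w (Suc k)) / Z (w k))" for k
  have evF: "eventually (\<lambda>W. F W \<noteq> 0) at_top" by (rule tendsto_imp_eventually_ne[OF F1]) simp
  have evV: "eventually (\<lambda>W::real. (\<Prod>i<n. of_real W + v i) \<noteq> 0) at_top"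
    using eventually_linear_not_nonpos_Int[of n v] by eventually_elim (auto simp: prod_zero_iff)
  have evP: "eventually (\<lambda>W::real. (\<Prod>i<n. - of_real (W + 1) + u i) \<noteq> 0) at_top"
    using eventually_linear_not_nonpos_Int[of n "\<lambda>i. u i - 1"]
  proof eventually_elim
    case (elim W)
    have e: "- of_real (W + 1) + u i = - of_real W + (u i - 1)" for i by simp
    show ?case unfolding e prod_zero_iff[OF finite_lessThan] using elim by blast
  qed
  have evq: "eventually (\<lambda>k. of_real (q k) = T (w k)) sequentially"
    using eventually_compose_filterlim[OF right w_top] eventually_compose_filterlim[OF evF w_top]
      eventually_compose_filterlim[OF evV w_top] eventually_compose_filterlim[OF evP w_top]
  proof eventually_elim
    case (elim k)
    define A B A' B' where "A = (\<Prod>i<n. of_real (w k) + u i)" and "B = (\<Prod>i<n. of_real (w k) + v i)"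
      and "A' = (\<Prod>i<n. - of_real (w k + 1) + u i)" and "B' = (\<Prod>i<n. - of_real (w k + 1) + v i)"
    have n0s: "B \<noteq> 0" "A' \<noteq> 0" "F (w k) \<noteq> 0" using elim by (auto simp: A'_def B_def)
    have "of_real (c * F (w (Suc k))) * B = A * of_real (c * F (w k))"
      using elim(1) c unfolding A_def B_def F_def w_Suc by simp
    then have "of_real (F (w (Suc k))) * B = A * of_real (F (w k))" using c by (simp add: mult_ac)
    then have 1: "of_real (F (w (Suc k)) / F (w k)) = A / B" using n0s by (simp add: field_simps)
    have "B' * of_real (g k * (c * H (w k))) = A' * of_real (g (Suc k) * (c * H (w (Suc k))))"
      using left[of "w k" k] unfolding rv by (simp add: A'_def B'_def w_def t_def)
    then have "B' * of_real (g k * H (w k)) = A' * of_real (g (Suc k) * H (w (Suc k)))"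
      using c by (simp add: mult_ac)
    then have 2: "of_real (g (Suc k) / g k * (H (w (Suc k)) / H (w k))) = B' / A'"
      using n0s g0[of k] H0[of k] by (simp add: field_simps)
    have "q k = F (w (Suc k)) / F (w k) * (g (Suc k) / g k * (H (w (Suc k)) / H (w k)))"
      by (simp add: q_def Z_def mult_ac)
    then have "of_real (q k) = A / B * (B' / A')" unfolding 1[symmetric] 2[symmetric] by (simp only: of_real_mult)
    then show ?case by (simp add: T_def A_def B_def A'_def B'_def)
  qed
  have "(\<lambda>k. of_real (w k) ^ 2 * (T (w k) - 1)) \<longlonglongrightarrow> 0"
    by (rule seq[OF log_expansion_second[OF T]])
  then have "(\<lambda>k. of_real ((w k)\<^sup>2 * (q k - 1)) :: complex) \<longlonglongrightarrow> of_real 0"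
    unfolding of_real_0 by (rule Lim_transform_eventually) (use evq in \<open>eventually_elim, simp\<close>)
  then have q2: "(\<lambda>k. (w k)\<^sup>2 * (q k - 1)) \<longlonglongrightarrow> 0" by (simp only: tendsto_of_real_iff)
  have "(\<lambda>k. T (w k)) \<longlonglongrightarrow> 1" by (rule seq[OF log_expansion_tendsto[OF T]])
  then have "(\<lambda>k. of_real (q k) :: complex) \<longlonglongrightarrow> of_real 1"
    unfolding of_real_1 by (rule Lim_transform_eventually) (use evq in \<open>eventually_elim, simp\<close>)
  then have q1: "q \<longlonglongrightarrow> 1" by (simp only: tendsto_of_real_iff)
  have Zk: "(\<lambda>k. Z (w k)) \<longlonglongrightarrow> 1" by (rule seq[OF Z1])
  have Zr: "(\<lambda>k. Z (w (Suc k)) / Z (w k)) \<longlonglongrightarrow> 1"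
    using tendsto_divide[OF LIMSEQ_Suc[OF Zk] Zk] by simp
  have evZ: "eventually (\<lambda>k. Z (w k) \<noteq> 0) sequentially" by (rule tendsto_imp_eventually_ne[OF Zk]) simp
  then have evZ': "eventually (\<lambda>k. Z (w (Suc k)) \<noteq> 0) sequentially"
    by (subst eventually_sequentially_Suc[of "\<lambda>k. Z (w k) \<noteq> 0"])
  have "(\<lambda>k. q k / (Z (w (Suc k)) / Z (w k))) \<longlonglongrightarrow> 1"
    using tendsto_divide[OF q1 Zr] by simp
  then have gr: "(\<lambda>k. g (Suc k) / g k) \<longlonglongrightarrow> 1"
    by (rule Lim_transform_eventually) (use evZ evZ' in \<open>eventually_elim, simp add: q_def\<close>)

  define \<kappa> where "\<kappa> = (-1) ^ R * x ^ R * (1 - x) powr (p - real R)"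
  have \<kappa>: "\<kappa> \<noteq> 0" using par by (simp add: \<kappa>_def)
  define B where "B k = pochhammer (a - p * w k) (Suc (n0 + R * k))" for k
  have g_eq: "g k = residue_scale p r a x (n0 + R * k) * B k" for k
    unfolding g_def B_def residue_factor_eq Rw'[symmetric] by simp
  have B0: "B k \<noteq> 0" for k using g0[of k] by (auto simp: g_eq)
  have g_step: "g (Suc k) / g k = \<kappa> * scale_ratio R (w k) * (B (Suc k) / B k)" for k
  proof -
    have e: "n0 + R * Suc k = n0 + R * k + R" by simp
    have "residue_scale p r a x (n0 + R * Suc k) = residue_scale p r a x (n0 + R * k) * (\<kappa> * scale_ratio R (w k))"
      using residue_scale_step[OF par(3,4) Rpos(1), of p a "n0 + R * k"]
      unfolding e rR \<kappa>_def Rw'[unfolded rR] .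
    moreover have "residue_scale p r a x (n0 + R * k) \<noteq> 0" using residue_scale_nonzero par by simp
    ultimately show ?thesis using g_eq by simp
  qed
  note sr = log_expansion_scale_ratio[OF Rpos(1)]
  have sr1: "(\<lambda>k. scale_ratio R (w k) * (real R * w k) ^ R) \<longlonglongrightarrow> 1"
    by (rule seq[OF log_expansion_tendsto[OF sr]])
  have evw: "eventually (\<lambda>k. w k > 0) sequentially"
    using w_top by (simp add: filterlim_at_top_dense)

  have "p \<in> \<int>"
  proof (rule sin_ratio_limit_imp_Ints)
    define A1 A2 where "A1 W = Gamma ((r - p) * W + (a + 1))" and "A2 W = Gamma (p * W + (1 - a))" for W
    \<comment> \<open>K collects the limits of all non-oscillating factors of g (Suc k) / g k. Since
      that quotient tends to 1, the quotient of consecutive sines tends to 1 / K.\<close>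
    define K where "K = \<kappa> * 1 / real R ^ R * (r - p) powr (r - p) * p powr p"
    have K: "K \<noteq> 0" using \<kappa> par Rpos by (simp add: K_def)
    show "1 / K \<noteq> 0" using K by simp
    define s where "s k = sin (pi * (p * t - a) + pi * p * real k)" for k
    have ssin: "sin (pi * (a - p * w k)) = - s k" for k
    proof -
      have "pi * (a - p * w k) = - (pi * (p * t - a) + pi * p * real k)" by (simp add: w_def algebra_simps)
      then show ?thesis unfolding s_def by (simp only: sin_minus)
    qed
    have "eventually (\<lambda>W. (r - p) * W + (a + 1) > 0) at_top" "eventually (\<lambda>W. p * W + (1 - a) > 0) at_top"
      using par by real_asymp+
    note ev12 = eventually_compose_filterlim[OF this(1) w_top] eventually_compose_filterlim[OF this(2) w_top]
    have evB: "eventually (\<lambda>k. B k = A1 (w k) * A2 (w k) * (- s k) / pi \<and> A1 (w k) > 0 \<and> A2 (w k) > 0) sequentially"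
      using ev12
    proof eventually_elim
      case (elim k)
      have e1: "a - p * w k + real (Suc (n0 + R * k)) = (r - p) * w k + (a + 1)"
        using Rw[of k] by (simp add: rR algebra_simps)
      have e2: "1 - (a - p * w k) = p * w k + (1 - a)" by simp
      have "B k = A1 (w k) * A2 (w k) * (- s k) / pi"
        using pochhammer_reflection[of "a - p * w k" "Suc (n0 + R * k)"] elim
        unfolding B_def A1_def A2_def e1 e2 ssin by blast
      then show ?case using elim by (simp only: A1_def A2_def Gamma_real_pos simp_thms)
    qed
    then show "eventually (\<lambda>k. sin (pi * (p * t - a) + pi * p * real k) \<noteq> 0) sequentially"
      by eventually_elim (use B0 in \<open>auto simp: s_def[symmetric]\<close>)
    have evB': "eventually (\<lambda>k. B (Suc k) = A1 (w (Suc k)) * A2 (w (Suc k)) * (- s (Suc k)) / pi) sequentially"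
      using eventually_mono[OF evB] by (subst eventually_sequentially_Suc[of "\<lambda>k. B k = A1 (w k) * A2 (w k) * (- s k) / pi"]) auto
    have A1: "(\<lambda>k. A1 (w k + 1) / A1 (w k) / w k powr (r - p)) \<longlonglongrightarrow> (r - p) powr (r - p)"
      unfolding A1_def by (rule seq[OF Gamma_step_asymp]) (use par in simp)
    have A2: "(\<lambda>k. A2 (w k + 1) / A2 (w k) / w k powr p) \<longlonglongrightarrow> p powr p"
      unfolding A2_def by (rule seq[OF Gamma_step_asymp]) (use par in simp)
    have "(\<lambda>k. (g (Suc k) / g k) / (\<kappa> * (scale_ratio R (w k) * (real R * w k) ^ R) / real R ^ R
        * (A1 (w k + 1) / A1 (w k) / w k powr (r - p)) * (A2 (w k + 1) / A2 (w k) / w k powr p))) \<longlonglongrightarrow> 1 / K"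
      unfolding K_def using K Rpos unfolding K_def
      by (intro tendsto_divide tendsto_mult tendsto_const gr sr1 A1 A2) auto
    then show "(\<lambda>k. sin (pi * (p * t - a) + pi * p * real (Suc k)) / sin (pi * (p * t - a) + pi * p * real k)) \<longlonglongrightarrow> 1 / K"
      unfolding s_def[symmetric]
    proof (rule Lim_transform_eventually)
      have evs: "eventually (\<lambda>k. scale_ratio R (w k) * (real R * w k) ^ R \<noteq> 0) sequentially"
        by (rule tendsto_imp_eventually_ne[OF sr1]) simp
      show "eventually (\<lambda>k. (g (Suc k) / g k) / (\<kappa> * (scale_ratio R (w k) * (real R * w k) ^ R) / real R ^ R
        * (A1 (w k + 1) / A1 (w k) / w k powr (r - p)) * (A2 (w k + 1) / A2 (w k) / w k powr p)) = s (Suc k) / s k) sequentially"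
        using evB evB' evw evs
      proof eventually_elim
        case (elim k)
        have W: "w k powr (r - p) * w k powr p = w k ^ R"
          using elim by (simp add: rR powr_realpow flip: powr_add)
        have pos: "A1 (w k) > 0" "A2 (w k) > 0" "w k powr (r - p) > 0" "w k powr p > 0" using elim by auto
        have sk: "s k \<noteq> 0" using elim B0[of k] by auto
        have s0: "scale_ratio R (w k) \<noteq> 0" "w k \<noteq> 0" using elim by auto
        have B0': "A1 (w k + 1) * A2 (w k + 1) * s (Suc k) = - pi * B (Suc k)" using elim unfolding w_Suc by simp
        then have A0: "A1 (w k + 1) \<noteq> 0" "A2 (w k + 1) \<noteq> 0" using B0[of "Suc k"] by auto
        have den: "\<kappa> * (scale_ratio R (w k) * (real R * w k) ^ R) / real R ^ R
          * (A1 (w k + 1) / A1 (w k) / w k powr (r - p)) * (A2 (w k + 1) / A2 (w k) / w k powr p)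
          = \<kappa> * scale_ratio R (w k) * (A1 (w k + 1) / A1 (w k) * (A2 (w k + 1) / A2 (w k)))"
        proof -
          have alg: "\<kappa> * (sc * (RR * wR)) / RR * (a1 / w1) * (a2 / w2) = \<kappa> * sc * (a1 * a2)"
            if "RR \<noteq> 0" "w1 * w2 = wR" "wR \<noteq> 0" for sc RR wR a1 w1 a2 w2 :: real
            using that by (auto simp: field_simps)
          show ?thesis unfolding power_mult_distrib by (rule alg) (use Rpos W s0 in auto)
        qed
        have "B (Suc k) / B k = A1 (w k + 1) / A1 (w k) * (A2 (w k + 1) / A2 (w k)) * (s (Suc k) / s k)"
          using elim sk unfolding w_Suc by simp
        then show ?case unfolding g_step den using \<kappa> s0 A0 pos by simp
      qed
    qed
  qed
  then obtain P' where P': "p = of_int P'" by (auto elim: Ints_cases)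
  define P where "P = nat P'"
  have P: "p = real P" "P > 0" "P < R" using P' par rR by (auto simp: P_def)
  define S where "S = R - P"
  have S: "S > 0" "real S = r - p" "R = P + S" using P rR by (auto simp: S_def)

  \<comment> \<open>The step of the explicit factors divided by its limit \<open>\<Lambda>\<close>.
    Its 1/W coefficient is (-1/2 - (R + 1)/2) + (-a + (P + 1)/2) + (a + (S + 1)/2) = 0 as R = P +
    S.\<close>
  define gg where "gg W = scale_ratio R W * (real R * W) ^ R *
     ((\<Prod>i<P. real P * W + (- a) + (real i + 1)) / (real P * W) ^ P * ((\<Prod>i<S. real S * W + a + (real i + 1)) / (real S * W) ^ S))" for W
  define Q where "Q = arith_prod_coeff R 0 + arith_prod_coeff R 1 - arith_prod_coeff R (1/2)
        - arith_prod_coeff P (- a) - arith_prod_coeff S a"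
  have gg: "log_expansion gg 0 Q"
    unfolding gg_def [abs_def]
    by (rule log_expansion_cong[OF log_expansion_mult[OF sr log_expansion_mult[OF log_expansion_arith_prod[OF P(2), of "- a"] log_expansion_arith_prod[OF S(1), of a]]]])
       (simp_all add: Q_def S field_simps)
  define \<Lambda> where "\<Lambda> = \<kappa> * (-1) ^ P * (real P ^ P * real S ^ S) / real R ^ R"
  have gG: "eventually (\<lambda>k. g (Suc k) / g k = \<Lambda> * gg (w k)) sequentially"
    using evw
  proof eventually_elim
    case (elim k)
    have e: "n0 + R * Suc k = n0 + R * k + R" by simp
    have "B (Suc k) = B k * ((-1) ^ P * (\<Prod>i<P. real P * w k + (- a) + (real i + 1)) * (\<Prod>i<S. real S * w k + a + (real i + 1)))"
      using pochhammer_integer_step[OF less_imp_le[OF P(3)] Rpos(1) Rw]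
      unfolding B_def w_Suc S_def e P(1) .
    then have "B (Suc k) / B k = (-1) ^ P * (\<Prod>i<P. real P * w k + (- a) + (real i + 1)) * (\<Prod>i<S. real S * w k + a + (real i + 1))"
      using B0[of k] by simp
    moreover have "\<Lambda> * gg (w k) = \<kappa> * scale_ratio R (w k) * ((-1) ^ P * A * B)"
      if "A = (\<Prod>i<P. real P * w k + (- a) + (real i + 1))" "B = (\<Prod>i<S. real S * w k + a + (real i + 1))" for A B
    proof -
      have alg: "\<kappa> * e * (PP * SS) / RR * (sc * (RR * (WP * WS)) * (A / (PP * WP) * (B / (SS * WS)))) = \<kappa> * sc * (e * A * B)"
        if "PP \<noteq> 0" "SS \<noteq> 0" "RR \<noteq> 0" "WP \<noteq> 0" "WS \<noteq> 0" for e PP SS RR sc WP WS :: real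
        using that by (simp add: field_simps)
      have "w k ^ R = w k ^ P * w k ^ S" by (simp add: S power_add)
      then show ?thesis unfolding \<Lambda>_def gg_def power_mult_distrib that[symmetric]
        by (simp only:) (rule alg, use P S Rpos elim in auto)
    qed
    ultimately show ?case unfolding g_step by simp
  qed
  have gg1: "(\<lambda>k. gg (w k)) \<longlonglongrightarrow> 1" by (rule seq[OF log_expansion_tendsto[OF gg]])
  have "(\<lambda>k. \<Lambda> * gg (w k)) \<longlonglongrightarrow> \<Lambda> * 1" by (intro tendsto_mult tendsto_const gg1)
  moreover have "(\<lambda>k. \<Lambda> * gg (w k)) \<longlonglongrightarrow> 1" by (rule Lim_transform_eventually[OF gr gG])
  \<comment> \<open>This single equation carries both the relation between x, P, R and, through its
    sign, the parity of R - P.\<close>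
  ultimately have \<Lambda>1: "\<Lambda> = 1" using LIMSEQ_unique by fastforce

  have "(1 - x) powr (p - real R) * (1 - x) ^ S = 1"
  proof -
    have "(1 - x) ^ S = (1 - x) powr real S" using par by (simp add: powr_realpow)
    moreover have "p - real R + real S = 0" using S(2) rR by simp
    ultimately show ?thesis using par by (simp only: powr_add[symmetric]) simp
  qed
  then have pw: "(1 - x) powr (p - real R) = 1 / (1 - x) ^ S" using par by (simp add: field_simps)
  have sgn: "(-1) ^ (R + P) * (x ^ R * (real P ^ P * real S ^ S)) = real R ^ R * (1 - x) ^ S"
    using \<Lambda>1 par Rpos unfolding \<Lambda>_def \<kappa>_def pw by (simp add: power_add field_simps)
  have "even (R + P)"
  proof (rule ccontr)
    assume "odd (R + P)"
    then have "- (x ^ R * (real P ^ P * real S ^ S)) = real R ^ R * (1 - x) ^ S" using sgn by simp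
    moreover have "x ^ R * (real P ^ P * real S ^ S) > 0" "real R ^ R * (1 - x) ^ S > 0" using par P S Rpos by auto
    ultimately show False by linarith
  qed
  then have growth: "x ^ R * (real P ^ P * real S ^ S) = real R ^ R * (1 - x) ^ S" and ev: "even (R - P)"
    using sgn P by auto

  have "h = - (- Q)"
  proof (rule first_order_from_ratio)
    show "(\<lambda>k. (t + real k) * (Z (w k) - 1)) \<longlonglongrightarrow> h"
      using seq[OF hZ] by (simp add: w_def)
    \<comment> \<open>As q = gg times the quotient of consecutive values of Z, the step of Z is Z (q
      - gg) / gg. Times W^2, the part from q vanishes in the limit and the part from gg gives
      -Q.\<close>
    have "(\<lambda>k. Z (w k) * (((w k)\<^sup>2 * (q k - 1) - (w k)\<^sup>2 * (gg (w k) - 1)) / gg (w k))) \<longlonglongrightarrow> 1 * ((0 - Q) / 1)"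
      using seq[OF log_expansion_second[OF gg]] by (intro tendsto_mult tendsto_divide tendsto_diff Zk q2 gg1) auto
    then have "(\<lambda>k. (w k)\<^sup>2 * (Z (w (Suc k)) - Z (w k))) \<longlonglongrightarrow> 1 * ((0 - Q) / 1)"
    proof (rule Lim_transform_eventually)
      have evg: "eventually (\<lambda>k. gg (w k) \<noteq> 0) sequentially" by (rule tendsto_imp_eventually_ne[OF gg1]) simp
      show "eventually (\<lambda>k. Z (w k) * (((w k)\<^sup>2 * (q k - 1) - (w k)\<^sup>2 * (gg (w k) - 1)) / gg (w k))
         = (w k)\<^sup>2 * (Z (w (Suc k)) - Z (w k))) sequentially"
        using evg evZ gG
      proof eventually_elim
        case (elim k)
        have "q k = gg (w k) * (Z (w (Suc k)) / Z (w k))" using elim by (simp add: q_def \<Lambda>1)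
        then show ?case using elim by (simp add: field_simps)
      qed
    qed
    then show "(\<lambda>k. (t + real k)\<^sup>2 * (Z (w (Suc k)) - Z (w k))) \<longlonglongrightarrow> - Q" by (simp add: w_def)
  qed
  then have "h = Q" by simp
  moreover have "\<tau> = p * x / (r - p * x)" using par px by (simp add: \<tau>_def field_simps)
  ultimately show ?thesis
    using that[of P R] P rR ev growth unfolding h_def Q_def S_def by simp
qed

section \<open>Solving the constraints\<close>

text \<open>After P and S are divided by their greatest common divisor g, both sides are g-th powers
  of nonnegative numbers, so the g-th root may be taken. The remaining powers of g cancel because P1
  + S1 is the total degree on both sides.\<close>

lemma reduced_growth_equation:
  fixes x :: real
  assumes x: "0 < x" "x < 1" and pos: "P > 0" "S > 0"
    and eq: "x ^ (P + S) * (real P ^ P * real S ^ S) = real (P + S) ^ (P + S) * (1 - x) ^ S"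
  obtains g P1 S1 :: nat where "g > 0" "P = g * P1" "S = g * S1" "P1 > 0" "S1 > 0" "coprime P1 S1"
    "real (P1 + S1) / x > real (P1 + S1)"
    "(real (P1 + S1) / x) ^ P1 * (real (P1 + S1) / x - real (P1 + S1)) ^ S1 = real P1 ^ P1 * real S1 ^ S1"
proof -
  define g where "g = gcd P S"
  have g: "g > 0" using pos by (simp add: g_def)
  obtain P1 S1 where PS: "P = g * P1" "S = g * S1" "coprime P1 S1"
    using gcd_coprime_exists[of P S] pos by (metis g_def gcd_eq_0_iff mult.commute not_gr_zero)
  have pos1: "P1 > 0" "S1 > 0" using pos PS by (auto intro: gr0I)
  define R1 where "R1 = P1 + S1"
  have PSR: "P + S = g * R1" by (simp add: PS R1_def distrib_left)
  have gr: "real g > 0" using g by simp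
  have pm: "b ^ (g * n) = (b ^ n) ^ g" for b :: real and n by (metis mult.commute power_mult)
  have "(x ^ R1 * (real (g * P1) ^ P1 * real (g * S1) ^ S1)) ^ g = (real (g * R1) ^ R1 * (1 - x) ^ S1) ^ g"
    using eq unfolding PSR unfolding PS(1,2) pm power_mult_distrib .
  then have "x ^ R1 * (real (g * P1) ^ P1 * real (g * S1) ^ S1) = real (g * R1) ^ R1 * (1 - x) ^ S1"
    by (rule power_eq_imp_eq_base) (use x g in auto)
  then have "real g ^ R1 * (x ^ R1 * (P1 ^ P1 * S1 ^ S1)) = real g ^ R1 * (R1 ^ R1 * (1 - x) ^ S1)"
    by (simp add: power_mult_distrib R1_def power_add mult_ac)
  then have "x ^ R1 * (real P1 ^ P1 * real S1 ^ S1) = real R1 ^ R1 * (1 - x) ^ S1" using gr by simp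
  then have main: "real R1 ^ R1 * (1 - x) ^ S1 / x ^ R1 = real P1 ^ P1 * real S1 ^ S1" using x by (simp add: field_simps)
  have "real R1 / x - real R1 = real R1 * (1 - x) / x" using x by (simp add: field_simps)
  then have "(real R1 / x) ^ P1 * (real R1 / x - real R1) ^ S1 = real R1 ^ R1 * (1 - x) ^ S1 / x ^ R1"
    by (simp add: power_divide power_mult_distrib R1_def power_add)
  then have fin: "(real R1 / x) ^ P1 * (real R1 / x - real R1) ^ S1 = real P1 ^ P1 * real S1 ^ S1"
    using main by simp
  have "real R1 > 0" using pos1 by (simp add: R1_def)
  then have "real R1 / x > real R1" using x by (simp add: field_simps)
  then show ?thesis using that[OF g PS(1,2) pos1 PS(3)] fin unfolding R1_def by blast
qed

theorem theorem2p4: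
  fixes p r a x :: real
  assumes "0 < p" and "p < r" and "0 < x" and "x < 1"
    and "solution_I p 0 r a (1/2) x"
    and "\<not> elementary p 0 r a (1/2) x"
  shows "(x \<in> \<rat> \<longrightarrow>
            (\<exists>k::nat. k > 0 \<and>
               ((p, r, a, x) = (real k, 3 * real k, 0, 3/4) \<or>
                (p, r, a, x) = (real k, 3 * real k, 1/3, 3/4))))
       \<and> (quadratic_irrational x \<longrightarrow>
            (\<exists>k::nat. k > 0 \<and> (p, r, a, x) = (2 * real k, 4 * real k, 0, 2 * sqrt 2 - 2)))"
proof -
  obtain P R :: nat where PR: "0 < P" "P < R" "p = real P" "r = real R" "even (R - P)"
    and growth: "x ^ R * (real P ^ P * real (R - P) ^ (R - P)) = real R ^ R * (1 - x) ^ (R - P)"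
    and first: "(1 / p - 2 / r) * (p * x / (r - p * x)) / 2 + (1 / p - 1 / r) * (3 / 4) * (p * x / (r - p * x))\<^sup>2
      = arith_prod_coeff R 0 + arith_prod_coeff R 1 - arith_prod_coeff R (1/2)
        - arith_prod_coeff P (- a) - arith_prod_coeff (R - P) a"
    by (rule arithmetic_constraints[OF assms])
  define S where "S = R - P"
  have S: "S > 0" "R = P + S" using PR by (auto simp: S_def)
  note first = first[folded S_def, unfolded PR(3,4)]
  from growth have "x ^ (P + S) * (real P ^ P * real S ^ S) = real (P + S) ^ (P + S) * (1 - x) ^ S"
    unfolding S_def[symmetric] by (simp only: S(2))
  then obtain g P1 S1 where g: "g > 0" "P = g * P1" "S = g * S1" "P1 > 0" "S1 > 0" "coprime P1 S1"
    and u: "real (P1 + S1) / x > real (P1 + S1)"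
    "(real (P1 + S1) / x) ^ P1 * (real (P1 + S1) / x - real (P1 + S1)) ^ S1 = real P1 ^ P1 * real S1 ^ S1"
    using reduced_growth_equation[OF assms(3,4) PR(1) S(1)] by metis
  have gr: "real g > 0" using g by simp
  have rational: "\<exists>k::nat. k > 0 \<and> ((p, r, a, x) = (real k, 3 * real k, 0, 3/4) \<or> (p, r, a, x) = (real k, 3 * real k, 1/3, 3/4))"
    if "x \<in> \<rat>"
  proof -
    have "P1 = 1 \<and> S1 = 2 \<and> real (P1 + S1) / x = 4"
      by (rule rational_root_unique[OF g(6,4,5) u(1) _ u(2)]) (use that in simp)
    then have 1: "P = g" "S = 2 * g" "R = 3 * g" "x = 3 / 4" using g S assms by (auto simp: field_simps)
    have \<tau>: "real g * (3/4) / (real (3 * g) - real g * (3/4)) = 1/3" using gr by (simp add: field_simps)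
    \<comment> \<open>The remaining first-order equation is quadratic in a with vanishing constant
      term at this x; its two roots are the values of a in the two primitive solutions.\<close>
    have "a * (3 * a - 1) = 0"
      using first gr unfolding 1 \<tau> arith_prod_coeff_def
      by (simp add: power2_eq_square divide_simps) (simp add: algebra_simps)
    then have "a = 0 \<or> a = 1/3" by auto
    then show ?thesis using 1 PR g by (intro exI[of _ g]) auto
  qed
  have quadratic: "\<exists>k::nat. k > 0 \<and> (p, r, a, x) = (2 * real k, 4 * real k, 0, 2 * sqrt 2 - 2)"
    if irr: "quadratic_irrational x"
  proof -
    obtain A B C :: int where ABC: "A \<noteq> 0" "of_int A * x\<^sup>2 + of_int B * x + of_int C = 0" and xQ: "x \<notin> \<rat>"
      using irr by (auto simp: quadratic_irrational_def)
    define k where "k = P1 + S1"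
    have k: "real k > 0" using g by (simp add: k_def)
    have uQ: "real k / x \<notin> \<rat>"
    proof
      assume "real k / x \<in> \<rat>"
      then have "real k / (real k / x) \<in> \<rat>" by (rule Rats_divide[OF Rats_of_nat])
      then show False using xQ k assms by simp
    qed
    have C: "C \<noteq> 0"
    proof
      assume "C = 0"
      then have "x * (of_int A * x + of_int B) = 0" using ABC(2) by (simp add: power2_eq_square algebra_simps)
      then have "of_int A * x + of_int B = 0" using assms(3) by simp
      then have "x = - of_int B / of_int A" using ABC(1) by (simp add: field_simps)
      then show False using xQ by simp
    qed
    \<comment> \<open>The reversed polynomial of x, rescaled by k; C is non-zero because x is
      irrational, so it is a genuine quadratic.\<close>
    have "of_int C * (real k / x)\<^sup>2 + of_int (B * int k) * (real k / x) + of_int (A * int k * int k)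
       = (real k / x)\<^sup>2 * (of_int A * x\<^sup>2 + of_int B * x + of_int C)"
      using assms by (simp add: power2_eq_square field_simps)
    then have "of_int C * (real k / x)\<^sup>2 + of_int (B * int k) * (real k / x) + of_int (A * int k * int k) = 0"
      unfolding ABC(2) by simp
    from quadratic_root_unique[OF g(6,4,5) u uQ[unfolded k_def] C this[unfolded k_def]]
    have q: "P1 = 1" "S1 = 1" "real (P1 + S1) / x = 1 + sqrt 2" by auto
    have s2: "sqrt 2 * sqrt 2 = (2 :: real)" by simp
    have "x * (1 + sqrt 2) = 2" using q assms by (simp add: field_simps)
    then have "x * ((1 + sqrt 2) * (sqrt 2 - 1)) = 2 * (sqrt 2 - 1)" by (simp only: mult.assoc[symmetric])
    then have x: "x = 2 * sqrt 2 - 2" using s2 by (simp add: algebra_simps)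
    have 1: "P = g" "S = g" "R = 2 * g" using q g S by auto
    \<comment> \<open>R - P = g here, so the sign condition forces g to be even: the primitive
      solution has p = 2, r = 4 rather than p = 1, r = 2.\<close>
    have "even g" using PR(5) 1 S by simp
    then obtain j where j: "g = 2 * j" by (elim evenE)
    have x2: "2 - x > 0" using assms by simp
    have "real (2 * g) - real g * x = real g * (2 - x)" by (simp add: algebra_simps)
    then have "real g * x / (real (2 * g) - real g * x) = x / (2 - x)" using gr by simp
    also have "\<dots> = sqrt 2 / 2" using x2 s2 unfolding x by (simp add: field_simps)
    finally have \<tau>: "real g * x / (real (2 * g) - real g * x) = sqrt 2 / 2" .
    have \<tau>2: "(sqrt 2 / 2)\<^sup>2 = (1 / 2 :: real)" by (simp add: power_divide)
    have \<tau>1: "1 / real g - 2 / real (2 * g) = 0" using gr by simp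
    \<comment> \<open>With P = S the terms linear in a cancel, and the constant term vanishes at
      this x.\<close>
    have "a * a = 0"
      using first gr unfolding 1 \<tau> \<tau>2 \<tau>1 arith_prod_coeff_def
      by (simp add: power2_eq_square divide_simps) (simp add: algebra_simps)
    then show ?thesis using 1 PR j x g by (intro exI[of _ j]) auto
  qed
  show ?thesis using rational quadratic by blast
qed

end
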